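(* Let $K$ be a commutative ring and let $R$ be a $K$-algebra endowed with an $(\mathbb{N}^n,\preceq)$-filtration $F=\{F_\alpha(R)\mid \alpha\in\mathbb{N}^n\}$, where $\preceq$ is any admissible order on $\mathbb{N}^n$. Suppose that the associated $\mathbb{N}^n$-graded algebra is an iterated Ore extension $$G^F(R)=\Lambda[y_1;\sigma_1]\cdots[y_s;\sigma_s],$$ where $y_1,\dots,y_s$ are homogeneous elements. Suppose moreover that: (a) $\Lambda=F_0(R)$ is left noetherian; (b) for all $1\leqslant i<j\leqslant s$ there exists $q_{ji}\in\Lambda$ such that $y_jy_i=q_{ji}y_iy_j$; (c) $F_\alpha(R)$ is a finitely generated left $\Lambda$-module for every $\alpha\in\mathbb{N}^n$. Then $R$ can be endowed with an $\mathbb{N}$-filtration $\{R_k\mid k\in\mathbb{N}\}$ such that: 1. $R_0=\Lambda$; 2. $R_k$ is a finitely generated left $\Lambda$-module for every $k\in\mathbb{N}$; 3. the associated graded ring satisfies $gr(R)\cong\Lambda[y_1;\sigma_1]\cdots[y_s;\sigma_s]$.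
   Context: An admissible order on $\mathbb{N}^n$ (additive monoid of vectors of non-negative integers) is a total order $\preceq$ such that $\alpha\preceq\beta$ implies $\alpha+\gamma\preceq\beta+\gamma$, and $0\preceq\alpha$ for all $\alpha$. An $(\mathbb{N}^n,\preceq)$-filtration on a $K$-algebra $R$ is a family of $K$-submodules $F=\{F_\alpha(R)\mid\alpha\in\mathbb{N}^n\}$ of $R$ with: $F_\alpha(R)\subseteq F_\beta(R)$ if $\alpha\preceq\beta$; $F_\gamma(R)F_\delta(R)\subseteq F_{\gamma+\delta}(R)$ for all $\gamma,\delta$; $\bigcup_\alpha F_\alpha(R)=R$; $1\in F_0(R)$. An $\mathbb{N}$-filtration is the case $n=1$ with the usual order. Put $F^-_\gamma(R)=\bigcup_{\gamma'\prec\gamma}F_{\gamma'}(R)$, with $F^-_0(R)=\{0\}$, and $G_\gamma(R)=F_\gamma(R)/F^-_\gamma(R)$. The associated graded algebra is $G^F(R)=\bigoplus_{\gamma\in\mathbb{N}^n}G_\gamma(R)$ with product $(r+F^-_\gamma(R))(r'+F^-_\delta(R))=rr'+F^-_{\gamma+\delta}(R)$; its degree-$0$ component is $F_0(R)$. For an $\mathbb{N}$-filtration $\{R_k\}$ it is written $gr(R)=\bigoplus_{k\ge0}R_k/R_{k-1}$ (with $R_{-1}=0$). For a ring $S$ and a ring endomorphism $\sigma$ of $S$, the Ore extension $S[y;\sigma]$ is the ring containing $S$ and $y$ that is free as a left $S$-module on the powers of $y$, with $ya=\sigma(a)y$ for $a\in S$; an iterated Ore extension $\Lambda[y_1;\sigma_1]\cdots[y_s;\sigma_s]$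 is obtained by repeating this, $\sigma_j$ being an endomorphism of $\Lambda[y_1;\sigma_1]\cdots[y_{j-1};\sigma_{j-1}]$. *)

theory Defs
  imports "HOL-Analysis.Finite_Cartesian_Product" "HOL-Algebra.Algebra"
begin

section \<open>Noncommutative algebras and finiteness conditions\<close>

text \<open>The library locale \<open>algebra\<close> is restricted to commutative algebras.\<close>

locale assoc_algebra = module K R + ring R
  for K (structure) and R (structure) +
  assumes smult_mult_left: "\<lbrakk>c \<in> carrier K; x \<in> carrier R; y \<in> carrier R\<rbrakk>
      \<Longrightarrow> (c \<odot>\<^bsub>R\<^esub> x) \<otimes>\<^bsub>R\<^esub> y = c \<odot>\<^bsub>R\<^esub> (x \<otimes>\<^bsub>R\<^esub> y)"
    and smult_mult_right: "\<lbrakk>c \<in> carrier K; x \<in> carrier R; y \<in> carrier R\<rbrakk>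
      \<Longrightarrow> x \<otimes>\<^bsub>R\<^esub> (c \<odot>\<^bsub>R\<^esub> y) = c \<odot>\<^bsub>R\<^esub> (x \<otimes>\<^bsub>R\<^esub> y)"

text \<open>Here \<open>M\<close> is a subset of \<open>R\<close> on which the subring \<open>L\<close> of \<open>R\<close> acts by left multiplication.\<close>

definition fin_gen_left :: "('a, 'm) ring_scheme \<Rightarrow> 'a set \<Rightarrow> 'a set \<Rightarrow> bool" where
  "fin_gen_left R L M \<longleftrightarrow>
    (\<exists>S. finite S \<and> S \<subseteq> M \<and> M = {\<Oplus>\<^bsub>R\<^esub>s\<in>S. c s \<otimes>\<^bsub>R\<^esub> s | c. c \<in> S \<rightarrow> L})"

definition left_ideal :: "'a set \<Rightarrow> ('a, 'm) ring_scheme \<Rightarrow> bool" where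
  "left_ideal I R \<longleftrightarrow>
    additive_subgroup I R \<and> (\<forall>a\<in>carrier R. \<forall>x\<in>I. a \<otimes>\<^bsub>R\<^esub> x \<in> I)"

definition left_noetherian :: "('a, 'm) ring_scheme \<Rightarrow> bool" where
  "left_noetherian R \<longleftrightarrow> (\<forall>I. left_ideal I R \<longrightarrow> fin_gen_left R (carrier R) I)"


section \<open>Filtrations\<close>

text \<open>Both \<open>\<nat>\<^sup>n\<close>-filtrations (index type \<^typ>\<open>nat ^ 'n\<close>, any admissible order) and
  \<open>\<nat>\<close>-filtrations (index type \<^typ>\<open>nat\<close>, usual order) are instances of the following, where
  \<open>lteq\<close> is the order on the index monoid.\<close>

definition admissible_order :: "('i::comm_monoid_add \<Rightarrow> 'i \<Rightarrow> bool) \<Rightarrow> bool" where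
  "admissible_order lteq \<longleftrightarrow>
    reflp lteq \<and> transp lteq \<and> antisymp lteq \<and> totalp lteq \<and>
    (\<forall>\<alpha> \<beta> \<gamma>. lteq \<alpha> \<beta> \<longrightarrow> lteq (\<alpha> + \<gamma>) (\<beta> + \<gamma>)) \<and> (\<forall>\<alpha>. lteq 0 \<alpha>)"

definition filtration ::
  "('k, 'l) ring_scheme \<Rightarrow> ('k, 'a, 'm) module_scheme \<Rightarrow>
   ('i::comm_monoid_add \<Rightarrow> 'i \<Rightarrow> bool) \<Rightarrow> ('i \<Rightarrow> 'a set) \<Rightarrow> bool" where
  "filtration K R lteq F \<longleftrightarrow>
    (\<forall>\<alpha>. submodule (F \<alpha>) K R) \<and>
    (\<forall>\<alpha> \<beta>. lteq \<alpha> \<beta> \<longrightarrow> F \<alpha> \<subseteq> F \<beta>) \<and>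
    (\<forall>\<gamma> \<delta>. \<forall>x\<in>F \<gamma>. \<forall>y\<in>F \<delta>. x \<otimes>\<^bsub>R\<^esub> y \<in> F (\<gamma> + \<delta>)) \<and>
    (\<Union>\<alpha>. F \<alpha>) = carrier R \<and>
    \<one>\<^bsub>R\<^esub> \<in> F 0"

definition Fminus ::
  "('a, 'm) ring_scheme \<Rightarrow> ('i::comm_monoid_add \<Rightarrow> 'i \<Rightarrow> bool) \<Rightarrow> ('i \<Rightarrow> 'a set) \<Rightarrow> 'i \<Rightarrow> 'a set" where
  "Fminus R lteq F \<gamma> = (if \<gamma> = 0 then {\<zero>\<^bsub>R\<^esub>} else \<Union>{F \<gamma>' | \<gamma>'. lteq \<gamma>' \<gamma> \<and> \<gamma>' \<noteq> \<gamma>})"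


section \<open>The associated graded ring\<close>

definition gr_piece ::
  "('a, 'm) ring_scheme \<Rightarrow> ('i::comm_monoid_add \<Rightarrow> 'i \<Rightarrow> bool) \<Rightarrow> ('i \<Rightarrow> 'a set) \<Rightarrow> 'i \<Rightarrow> 'a set monoid" where
  "gr_piece R lteq F \<gamma> = (R\<lparr>carrier := F \<gamma>\<rparr>) A_Mod (Fminus R lteq F \<gamma>)"

text \<open>An element of the direct sum is the family of its components; the zero of the component
  of degree \<open>\<gamma>\<close> is the coset \<open>Fminus R lteq F \<gamma>\<close>. The map \<open>gr_embed0\<close> is the
  identification of \<open>F 0\<close> with the degree-\<open>0\<close> component.\<close>

definition gr_supp ::
  "('a, 'm) ring_scheme \<Rightarrow> ('i::comm_monoid_add \<Rightarrow> 'i \<Rightarrow> bool) \<Rightarrow> ('i \<Rightarrow> 'a set) \<Rightarrow> ('i \<Rightarrow> 'a set) \<Rightarrow> 'i set" where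
  "gr_supp R lteq F g = {\<gamma>. g \<gamma> \<noteq> Fminus R lteq F \<gamma>}"

definition gr_embed0 ::
  "('a, 'm) ring_scheme \<Rightarrow> ('i::comm_monoid_add \<Rightarrow> 'i \<Rightarrow> bool) \<Rightarrow> ('i \<Rightarrow> 'a set) \<Rightarrow> 'a \<Rightarrow> 'i \<Rightarrow> 'a set" where
  "gr_embed0 R lteq F a =
    (\<lambda>\<gamma>. if \<gamma> = 0 then Fminus R lteq F 0 +>\<^bsub>R\<^esub> a else Fminus R lteq F \<gamma>)"

text \<open>The product is the biadditive extension of
  \<open>(r + F\<^sup>-\<^sub>\<gamma>)(r' + F\<^sup>-\<^sub>\<delta>) = rr' + F\<^sup>-\<^bsub>\<gamma>+\<delta>\<^esub>\<close>. The sum (\<^const>\<open>finprod\<close> in the multiplicatively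
  written group \<^const>\<open>gr_piece\<close>) runs over the supports so that it is finite for every index monoid.\<close>

definition assoc_graded ::
  "('a, 'm) ring_scheme \<Rightarrow> ('i::comm_monoid_add \<Rightarrow> 'i \<Rightarrow> bool) \<Rightarrow> ('i \<Rightarrow> 'a set) \<Rightarrow> ('i \<Rightarrow> 'a set) ring" where
  "assoc_graded R lteq F =
    \<lparr>carrier = carrier (sum_group UNIV (gr_piece R lteq F)),
     monoid.mult = (\<lambda>g h \<epsilon>.
       finprod (gr_piece R lteq F \<epsilon>) (\<lambda>(\<gamma>, \<delta>). [mod (Fminus R lteq F \<epsilon>):] (g \<gamma>) \<Otimes>\<^bsub>R\<^esub> (h \<delta>))
         {(\<gamma>, \<delta>). \<gamma> \<in> gr_supp R lteq F g \<and> \<delta> \<in> gr_supp R lteq F h \<and> \<gamma> + \<delta> = \<epsilon>}),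
     one = gr_embed0 R lteq F \<one>\<^bsub>R\<^esub>,
     ring.zero = monoid.one (sum_group UNIV (gr_piece R lteq F)),
     ring.add = monoid.mult (sum_group UNIV (gr_piece R lteq F))\<rparr>"

definition gr_component ::
  "('a, 'm) ring_scheme \<Rightarrow> ('i::comm_monoid_add \<Rightarrow> 'i \<Rightarrow> bool) \<Rightarrow> ('i \<Rightarrow> 'a set) \<Rightarrow> 'i \<Rightarrow> ('i \<Rightarrow> 'a set) set" where
  "gr_component R lteq F \<gamma> = {g \<in> carrier (assoc_graded R lteq F). gr_supp R lteq F g \<subseteq> {\<gamma>}}"

definition gr_homogeneous ::
  "('a, 'm) ring_scheme \<Rightarrow> ('i::comm_monoid_add \<Rightarrow> 'i \<Rightarrow> bool) \<Rightarrow> ('i \<Rightarrow> 'a set) \<Rightarrow> ('i \<Rightarrow> 'a set) \<Rightarrow> bool" where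
  "gr_homogeneous R lteq F g \<longleftrightarrow> (\<exists>\<gamma>. g \<in> gr_component R lteq F \<gamma>)"


section \<open>Iterated Ore extensions\<close>

text \<open>\<open>ore_extension T S y \<sigma>\<close>: the ring \<open>T\<close> is \<open>S[y;\<sigma>]\<close>.\<close>

definition ore_extension :: "('a, 'm) ring_scheme \<Rightarrow> 'a set \<Rightarrow> 'a \<Rightarrow> ('a \<Rightarrow> 'a) \<Rightarrow> bool" where
  "ore_extension T S y \<sigma> \<longleftrightarrow>
    ring T \<and> subring S T \<and> y \<in> carrier T \<and>
    \<sigma> \<in> ring_hom (T\<lparr>carrier := S\<rparr>) (T\<lparr>carrier := S\<rparr>) \<and>
    (\<forall>a\<in>S. y \<otimes>\<^bsub>T\<^esub> a = \<sigma> a \<otimes>\<^bsub>T\<^esub> y) \<and>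
    (\<forall>t\<in>carrier T. \<exists>!c::nat \<Rightarrow> 'a.
       range c \<subseteq> S \<and> finite {k. c k \<noteq> \<zero>\<^bsub>T\<^esub>} \<and>
       t = (\<Oplus>\<^bsub>T\<^esub>k\<in>{k. c k \<noteq> \<zero>\<^bsub>T\<^esub>}. c k \<otimes>\<^bsub>T\<^esub> (y [^]\<^bsub>T\<^esub> k)))"

text \<open>\<open>iterated_ore_extension T L s y \<sigma>\<close>: the ring \<open>T\<close> is \<open>L[y\<^sub>1;\<sigma>\<^sub>1]\<dots>[y\<^sub>s;\<sigma>\<^sub>s]\<close>; only the
  values of \<open>y\<close> and \<open>\<sigma>\<close> on \<open>{1..s}\<close> matter, and \<open>S j\<close> is the
  subring \<open>L[y\<^sub>1;\<sigma>\<^sub>1]\<dots>[y\<^sub>j;\<sigma>\<^sub>j]\<close>.\<close>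

definition iterated_ore_extension ::
  "('a, 'm) ring_scheme \<Rightarrow> 'a set \<Rightarrow> nat \<Rightarrow> (nat \<Rightarrow> 'a) \<Rightarrow> (nat \<Rightarrow> 'a \<Rightarrow> 'a) \<Rightarrow> bool" where
  "iterated_ore_extension T L s y \<sigma> \<longleftrightarrow>
    ring T \<and>
    (\<exists>S::nat \<Rightarrow> 'a set. S 0 = L \<and> S s = carrier T \<and>
      (\<forall>j\<in>{1..s}. ore_extension (T\<lparr>carrier := S j\<rparr>) (S (j - 1)) (y j) (\<sigma> j)))"

end

theory Submission
  imports Defs "HOL-Library.Multiset"
begin

text \<open>
  Lift the homogeneous generators \<open>y\<^sub>j\<close> of degree \<open>\<gamma>\<^sub>j\<close> to \<open>x\<^sub>j \<in> F\<^bsub>\<gamma>\<^sub>j\<^esub>(R)\<close>. The ordered monomials \<open>x\<^sup>d\<close> form a left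
  \<open>\<Lambda>\<close>-basis of \<open>R\<close> such that \<open>F\<^sub>\<alpha>(R)\<close> is spanned by those of degree \<open>\<preceq> \<alpha>\<close>; by (c) there are finitely many
  of them. So only finitely many monomials can occur in the lower terms of the relations
  \<open>x\<^sub>j a = \<sigma>\<^sub>j(a) x\<^sub>j + \<dots>\<close> and \<open>x\<^sub>j x\<^sub>i = q\<^sub>j\<^sub>i x\<^sub>i x\<^sub>j + \<dots>\<close>, and Fourier--Motzkin elimination yields positive integer
  weights \<open>w\<^sub>1, \<dots>, w\<^sub>s\<close> for which all of these lower terms also have lower weight. Noetherian induction on the
  degree then gives \<open>x\<^sup>a m x\<^sup>b = c x\<^bsup>a+b\<^esup> + \<dots>\<close> with lower terms that are smaller both in degree and in
  weight. Hence the filtration by weight and \<open>F\<close> have the same leading coefficients \<open>c\<close>, which determine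
  the associated graded ring.
\<close>

section \<open>Left linear combinations\<close>

text \<open>Elimination applies because the differences \<open>e - d\<close> of exponent vectors
  with \<open>deg d\<close> strictly below \<open>deg e\<close> are closed under addition and never
  zero. Both facts come straight from strict compatibility of the order, so no representation of the
  order by real functionals is needed. The Ore structure only places \<open>\<sigma> j a\<close> in
  the subring generated by \<Lambda> and the earlier generators. That the leading coefficient lies
  in \<Lambda> itself is forced by comparing degrees: linear independence excludes generators of
  degree 0 unless the ring is trivial. The trivial ring is therefore a separate case, and there the
  monomials are not independent in any useful sense. The two graded rings are not compared through
  generators and relations. Each is identified with one and the same multiplication on finitely
  supported coefficient functions, whose formula mentions neither degree nor weight.\<close>

lemma (in abelian_monoid) finsum_fibres:
  assumes "finite I" "finite J" "h ` I \<subseteq> J" "f \<in> I \<rightarrow> carrier G"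
  shows "(\<Oplus>j\<in>J. \<Oplus>i\<in>{i\<in>I. h i = j}. f i) = finsum G f I"
proof -
  have "finsum G f (\<Union>j\<in>J. {i\<in>I. h i = j}) = (\<Oplus>j\<in>J. \<Oplus>i\<in>{i\<in>I. h i = j}. f i)"
    using assms by (intro add.finprod_UN_disjoint) (auto simp: pairwise_def disjnt_def)
  moreover have "(\<Union>j\<in>J. {i\<in>I. h i = j}) = I"
    using assms by auto
  ultimately show ?thesis by simp
qed

text \<open>Closing under the addition of one term at a time gives membership a list-like induction
  rule, so most arguments about spans carry neither finite sums nor coefficient functions.\<close>

definition lspan :: "('a, 'm) ring_scheme \<Rightarrow> 'a set \<Rightarrow> ('e \<Rightarrow> 'a) \<Rightarrow> 'e set \<Rightarrow> 'a set" where
  "lspan T L B D =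
    \<Inter>{M. \<zero>\<^bsub>T\<^esub> \<in> M \<and> (\<forall>a\<in>L. \<forall>d\<in>D. \<forall>v\<in>M. a \<otimes>\<^bsub>T\<^esub> B d \<oplus>\<^bsub>T\<^esub> v \<in> M)}"

lemma lspan_zero: "\<zero>\<^bsub>T\<^esub> \<in> lspan T L B D"
  by (simp add: lspan_def)

lemma lspan_step:
  "\<lbrakk>a \<in> L; d \<in> D; v \<in> lspan T L B D\<rbrakk> \<Longrightarrow> a \<otimes>\<^bsub>T\<^esub> B d \<oplus>\<^bsub>T\<^esub> v \<in> lspan T L B D"
  by (auto simp: lspan_def)

lemma lspan_induct [consumes 1, case_names zero add]:
  assumes "v \<in> lspan T L B D" "P \<zero>\<^bsub>T\<^esub>"
    "\<And>a d v. \<lbrakk>a \<in> L; d \<in> D; v \<in> lspan T L B D; P v\<rbrakk> \<Longrightarrow> P (a \<otimes>\<^bsub>T\<^esub> B d \<oplus>\<^bsub>T\<^esub> v)"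
  shows "P v"
proof -
  have "v \<in> {v \<in> lspan T L B D. P v}"
    by (rule subsetD[OF _ assms(1)], subst lspan_def, rule Inter_lower)
      (auto intro: assms lspan_zero lspan_step)
  then show ?thesis by simp
qed

lemma lspan_mono: "D \<subseteq> D' \<Longrightarrow> lspan T L B D \<subseteq> lspan T L B D'"
  unfolding lspan_def by blast

text \<open>The setting is used twice: for monomials in the filtered ring with scalars
  \<open>F 0\<close>, and for Ore monomials in the graded ring with scalars the image of
  \<open>F 0\<close>.\<close>

locale left_family = ring T for T (structure) +
  fixes L :: "'a set" and B :: "'e \<Rightarrow> 'a" and E :: "'e set"
  assumes subring_L: "subring L T"
    and B_closed: "d \<in> E \<Longrightarrow> B d \<in> carrier T"
begin

lemmas L_rules = subringE[OF subring_L]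

lemma L_carrier: "a \<in> L \<Longrightarrow> a \<in> carrier T"
  using L_rules(1) by auto

lemma L_zero: "\<zero> \<in> L" using L_rules(2) .
lemma L_one: "\<one> \<in> L" using L_rules(3) .

abbreviation span :: "'e set \<Rightarrow> 'a set" where "span \<equiv> lspan T L B"

lemma span_closed: "v \<in> span D \<Longrightarrow> D \<subseteq> E \<Longrightarrow> v \<in> carrier T"
  by (induction rule: lspan_induct) (auto simp: L_carrier B_closed subset_iff)

lemma span_add:
  assumes "D \<subseteq> E" "v \<in> span D" "w \<in> span D"
  shows "v \<oplus> w \<in> span D"
  using assms(2)
proof (induction rule: lspan_induct)
  case zero
  then show ?case using assms(3) span_closed[OF assms(3,1)] by simp
next
  case (add a d v)
  have "(a \<otimes> B d \<oplus> v) \<oplus> w = a \<otimes> B d \<oplus> (v \<oplus> w)"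
    using add assms by (intro a_assoc) (auto simp: L_carrier B_closed subset_iff span_closed)
  then show ?case using add by (simp add: lspan_step)
qed

lemma span_scale:
  assumes "D \<subseteq> E" "a \<in> L" "v \<in> span D"
  shows "a \<otimes> v \<in> span D"
  using assms(3)
proof (induction rule: lspan_induct)
  case zero
  then show ?case using assms(2) by (simp add: lspan_zero L_carrier)
next
  case (add b d v)
  have "a \<otimes> (b \<otimes> B d \<oplus> v) = (a \<otimes> b) \<otimes> B d \<oplus> a \<otimes> v"
    using add assms by (auto simp: L_carrier B_closed subset_iff span_closed r_distr m_assoc)
  then show ?case using add assms L_rules(6) by (simp add: lspan_step)
qed

lemma span_uminus:
  assumes "D \<subseteq> E" "v \<in> span D"
  shows "\<ominus> v \<in> span D"
proof -
  have "\<ominus> v = (\<ominus> \<one>) \<otimes> v"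
    using span_closed[OF assms(2,1)] by (simp add: l_minus)
  then show ?thesis
    using span_scale[OF assms(1) _ assms(2)] L_rules(3,5) by metis
qed

lemma span_gen:
  assumes "D \<subseteq> E" "a \<in> L" "d \<in> D"
  shows "a \<otimes> B d \<in> span D"
  using lspan_step[OF assms(2,3) lspan_zero[of T L B]] assms
  by (auto simp: L_carrier B_closed subset_iff)

lemma span_base: "D \<subseteq> E \<Longrightarrow> d \<in> D \<Longrightarrow> B d \<in> span D"
  using span_gen[of D \<one> d] L_one B_closed[of d] by auto

lemma span_least:
  assumes "v \<in> span D" "\<zero> \<in> M" "\<And>u w. u \<in> M \<Longrightarrow> w \<in> M \<Longrightarrow> u \<oplus> w \<in> M"
    "\<And>a d. a \<in> L \<Longrightarrow> d \<in> D \<Longrightarrow> a \<otimes> B d \<in> M"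
  shows "v \<in> M"
  using assms(1) by (induction rule: lspan_induct) (auto intro: assms)

lemma span_finsum:
  assumes "D \<subseteq> E" "\<And>i. i \<in> A \<Longrightarrow> f i \<in> span D"
  shows "finsum T f A \<in> span D"
  using assms(2)
proof (induction A rule: infinite_finite_induct)
  case (infinite A)
  then show ?case by (simp add: finsum_infinite lspan_zero)
next
  case empty
  then show ?case by (simp add: lspan_zero)
next
  case (insert x A)
  then have "finsum T f (insert x A) = f x \<oplus> finsum T f A"
    using span_closed[OF _ assms(1)] by (intro finsum_insert) auto
  then show ?case using insert assms(1) span_add by auto
qed

subsection \<open>Coefficient functions\<close>

text \<open>Since these functions are total and vanish outside \<open>E\<close>, linear independence
  becomes an equation between functions, with no restriction to an index set.\<close>

definition coeffs :: "('e \<Rightarrow> 'a) set" where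
  "coeffs = {f. (\<forall>d. f d \<in> L) \<and> finite {d. f d \<noteq> \<zero>} \<and> {d. f d \<noteq> \<zero>} \<subseteq> E}"

definition lc :: "('e \<Rightarrow> 'a) \<Rightarrow> 'a" where
  "lc f = (\<Oplus>d\<in>{d. f d \<noteq> \<zero>}. f d \<otimes> B d)"

lemma coeffsD:
  assumes "f \<in> coeffs"
  shows "f d \<in> L" "f d \<in> carrier T" "finite {d. f d \<noteq> \<zero>}" "{d. f d \<noteq> \<zero>} \<subseteq> E"
  using assms L_carrier by (auto simp: coeffs_def)

lemma lc_eq:
  assumes "f \<in> coeffs" "finite A" "A \<subseteq> E" "{d. f d \<noteq> \<zero>} \<subseteq> A"
  shows "lc f = (\<Oplus>d\<in>A. f d \<otimes> B d)"
  unfolding lc_def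
  using assms coeffsD[OF assms(1)]
  by (intro add.finprod_mono_neutral_cong_left) (auto simp: B_closed subset_iff)

lemma coeffs_add:
  assumes "f \<in> coeffs" "g \<in> coeffs"
  shows "(\<lambda>d. f d \<oplus> g d) \<in> coeffs"
proof -
  have "{d. f d \<oplus> g d \<noteq> \<zero>} \<subseteq> {d. f d \<noteq> \<zero>} \<union> {d. g d \<noteq> \<zero>}" by auto
  then show ?thesis
    using assms L_rules(7) unfolding coeffs_def by (auto dest: finite_subset)
qed

lemma lc_add:
  assumes "f \<in> coeffs" "g \<in> coeffs"
  shows "lc (\<lambda>d. f d \<oplus> g d) = lc f \<oplus> lc g"
proof -
  let ?A = "{d. f d \<noteq> \<zero>} \<union> {d. g d \<noteq> \<zero>}"
  note A = coeffsD[OF assms(1)] coeffsD[OF assms(2)]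
  have "lc (\<lambda>d. f d \<oplus> g d) = (\<Oplus>d\<in>?A. (f d \<oplus> g d) \<otimes> B d)"
    using A coeffs_add[OF assms] by (intro lc_eq) auto
  also have "\<dots> = (\<Oplus>d\<in>?A. f d \<otimes> B d \<oplus> g d \<otimes> B d)"
    using A by (intro finsum_cong' refl) (auto simp: B_closed subset_iff l_distr)
  also have "\<dots> = (\<Oplus>d\<in>?A. f d \<otimes> B d) \<oplus> (\<Oplus>d\<in>?A. g d \<otimes> B d)"
    using A by (intro finsum_addf) (auto simp: B_closed subset_iff)
  also have "\<dots> = lc f \<oplus> lc g"
    using A assms lc_eq[of f ?A] lc_eq[of g ?A] by auto
  finally show ?thesis .
qed

lemma lc_in_span:
  assumes "f \<in> coeffs" "{d. f d \<noteq> \<zero>} \<subseteq> D" "D \<subseteq> E"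
  shows "lc f \<in> span D"
  unfolding lc_def using assms coeffsD[OF assms(1)]
  by (intro span_finsum) (auto intro: span_gen)

lemma lc_single:
  assumes "a \<in> L" "d \<in> E"
  shows "(\<lambda>e. if e = d then a else \<zero>) \<in> coeffs" "lc (\<lambda>e. if e = d then a else \<zero>) = a \<otimes> B d"
proof -
  have *: "{e. (if e = d then a else \<zero>) \<noteq> \<zero>} \<subseteq> {d}" by auto
  show 1: "(\<lambda>e. if e = d then a else \<zero>) \<in> coeffs"
    using assms L_zero finite_subset[OF *] by (auto simp: coeffs_def)
  show "lc (\<lambda>e. if e = d then a else \<zero>) = a \<otimes> B d"
    using lc_eq[OF 1, of "{d}"] assms * by (auto simp: L_carrier B_closed)
qed

lemma coeffs_zero: "(\<lambda>e. \<zero>) \<in> coeffs" "lc (\<lambda>e. \<zero>) = \<zero>"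
  by (auto simp: coeffs_def lc_def L_zero)

lemma span_lcE:
  assumes "v \<in> span D" "D \<subseteq> E"
  obtains f where "f \<in> coeffs" "{d. f d \<noteq> \<zero>} \<subseteq> D" "v = lc f"
  using assms(1)
proof (induction arbitrary: thesis rule: lspan_induct)
  case zero
  show ?case using zero[of "\<lambda>e. \<zero>"] coeffs_zero by auto
next
  case (add a d v)
  from add.IH obtain f where f: "f \<in> coeffs" "{d. f d \<noteq> \<zero>} \<subseteq> D" "v = lc f" by auto
  have d: "d \<in> E" using add assms by auto
  let ?g = "\<lambda>e. (if e = d then a else \<zero>) \<oplus> f e"
  have "?g \<in> coeffs" "lc ?g = a \<otimes> B d \<oplus> v"
    using coeffs_add[OF lc_single(1)[OF add(1) d] f(1)] lc_add[OF lc_single(1)[OF add(1) d] f(1)]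
      lc_single(2)[OF add(1) d] f(3) by auto
  moreover have "{d. ?g d \<noteq> \<zero>} \<subseteq> D"
    using add f by auto
  ultimately show ?case using add.prems by auto
qed

end

section \<open>Positive functionals\<close>

text \<open>If both sets are nonempty, density supplies a point between the maximum of one and the
  minimum of the other. This is why the elimination below passes through rationals although its
  vectors and its functional are integral.\<close>

lemma finite_sets_separated:
  fixes A B :: "'a::linordered_field set"
  assumes "finite A" "finite B" "\<And>a b. a \<in> A \<Longrightarrow> b \<in> B \<Longrightarrow> a < b"
  shows "\<exists>t. (\<forall>a\<in>A. a < t) \<and> (\<forall>b\<in>B. t < b)"
proof (cases "A = {}")
  case True
  have "Min B - 1 < b" if "b \<in> B" for b
  proof -
    have "Min B \<le> b" using that assms(2) by simp
    then show ?thesis by linarith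
  qed
  then show ?thesis using True by blast
next
  case A: False
  have m: "a \<le> Max A" if "a \<in> A" for a using that assms by simp
  show ?thesis
  proof (cases "B = {}")
    case True
    have "a < Max A + 1" if "a \<in> A" for a using m[OF that] by linarith
    then show ?thesis using True by blast
  next
    case False
    then have "Max A < Min B" using A assms by auto
    then obtain t where "Max A < t" "t < Min B" using dense by blast
    then show ?thesis using A False assms(1,2) by auto
  qed
qed

text \<open>Fourier--Motzkin elimination of the coordinate \<open>i\<close>: the combinations
  \<open>d i * e - e i * d\<close> with \<open>e i < 0 < d i\<close> lie in \<open>P\<close> and have vanishing \<open>i\<close>-th coordinate.\<close>

lemma positive_functional_exists:
  fixes P :: "('i \<Rightarrow> int) set"
  assumes "finite I"
    and add: "\<And>v w. v \<in> P \<Longrightarrow> w \<in> P \<Longrightarrow> (\<lambda>i. v i + w i) \<in> P"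
    and nz: "(\<lambda>_. 0) \<notin> P"
    and "finite D" "D \<subseteq> P" "\<And>v i. v \<in> D \<Longrightarrow> i \<notin> I \<Longrightarrow> v i = 0"
  shows "\<exists>u::'i \<Rightarrow> int. \<forall>v\<in>D. 0 < (\<Sum>i\<in>I. u i * v i)"
  using assms(1,4-6)
proof (induction I arbitrary: D rule: finite_induct)
  case empty
  then have "v = (\<lambda>_. 0)" if "v \<in> D" for v using that by auto
  then have "D = {}" using empty nz by auto
  then show ?case by simp
next
  case (insert k I)
  \<comment> \<open>Only positive multiples are available: they are iterated sums inside
    \<open>P\<close>, while the multiple by 0 is excluded by \<open>nz\<close>.\<close>
  have scale: "(\<lambda>i. int (Suc n) * v i) \<in> P" if "v \<in> P" for v n
  proof (induction n)
    case (Suc n)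
    have "(\<lambda>i. int (Suc n) * v i + v i) \<in> P" using add[OF Suc that] .
    then show ?case by (simp add: algebra_simps)
  qed (use that in simp)
  have scale': "(\<lambda>i. c * v i) \<in> P" if "v \<in> P" "c > 0" for v c
    using scale[OF that(1), of "nat c - 1"] that by (simp add: algebra_simps)
  define D0 where "D0 = {d\<in>D. d k = 0}"
  define Dp where "Dp = {d\<in>D. d k > 0}"
  define Dm where "Dm = {d\<in>D. d k < 0}"
  define comb where "comb d e = (\<lambda>i. d k * e i + (- e k) * d i)" for d e :: "'i \<Rightarrow> int"
  define D' where "D' = D0 \<union> (\<lambda>(d, e). comb d e) ` (Dp \<times> Dm)"
  have "finite D'" using insert.prems by (auto simp: D'_def D0_def Dp_def Dm_def)
  moreover have "D' \<subseteq> P"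
  proof -
    have "comb d e \<in> P" if "d \<in> Dp" "e \<in> Dm" for d e
      unfolding comb_def using that insert.prems(2)
      by (intro add scale') (auto simp: Dp_def Dm_def)
    then show ?thesis using insert.prems(2) by (auto simp: D'_def D0_def)
  qed
  moreover have "v i = 0" if "v \<in> D'" "i \<notin> I" for v i
  proof (cases "i = k")
    case False
    then have z: "d i = 0" if "d \<in> D" for d
      using insert.prems(3)[OF that, of i] \<open>i \<notin> I\<close> by simp
    have "comb d e i = 0" if "d \<in> D" "e \<in> D" for d e
      using z[OF that(1)] z[OF that(2)] by (simp add: comb_def)
    then show ?thesis using \<open>v \<in> D'\<close> z by (auto simp: D'_def D0_def Dp_def Dm_def)
  qed (use that(1) in \<open>auto simp: D'_def D0_def Dp_def Dm_def comb_def\<close>)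
  ultimately obtain u where u: "\<forall>v\<in>D'. 0 < (\<Sum>i\<in>I. u i * v i)"
    using insert.IH by blast
  define U where "U v = (\<Sum>i\<in>I. u i * v i)" for v
  \<comment> \<open>With \<open>t\<close> as the value of the functional on the new coordinate,
    positivity on \<open>d\<close> reads \<open>U d + t * d k > 0\<close>. So \<open>lo d\<close> is
    a lower bound for \<open>t\<close> if \<open>d k > 0\<close> and an upper bound if
    \<open>d k < 0\<close>; positivity on the combinations says that these bounds are
    compatible.\<close>
  define lo where "lo d = - rat_of_int (U d) / rat_of_int (d k)" for d
  have less: "lo d < lo e" if "d \<in> Dp" "e \<in> Dm" for d e
  proof -
    have "0 < U (comb d e)" using u that by (auto simp: D'_def U_def)
    also have "U (comb d e) = d k * U e + (- e k) * U d"
      by (simp add: U_def comb_def algebra_simps sum_subtractf sum_distrib_left sum_negf)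
    finally have "0 < d k * U e + (- e k) * U d" .
    then have "rat_of_int 0 < rat_of_int (d k * U e + (- e k) * U d)"
      by (simp only: of_int_less_iff)
    then have "rat_of_int (e k) * rat_of_int (U d) < rat_of_int (d k) * rat_of_int (U e)" by simp
    moreover have "d k > 0" "e k < 0" using that by (auto simp: Dp_def Dm_def)
    ultimately show ?thesis
      by (simp add: lo_def field_simps)
  qed
  have "\<exists>t. (\<forall>a\<in>lo ` Dp. a < t) \<and> (\<forall>b\<in>lo ` Dm. t < b)"
    by (rule finite_sets_separated) (use insert.prems less in \<open>auto simp: Dp_def Dm_def\<close>)
  then obtain t where t: "\<And>d. d \<in> Dp \<Longrightarrow> lo d < t" "\<And>e. e \<in> Dm \<Longrightarrow> t < lo e"
    by auto
  obtain p q where pq: "t = of_int p / of_int q" "q > 0"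
    by (metis quotient_of_div quotient_of_denom_pos surj_pair)
  \<comment> \<open>Clearing the denominator of \<open>t = p / q\<close>; as \<open>q\<close> is
    positive, no sign changes.\<close>
  define u' where "u' i = (if i = k then p else q * u i)" for i
  have "0 < (\<Sum>i\<in>insert k I. u' i * v i)" if v: "v \<in> D" for v
  proof -
    have "(\<Sum>i\<in>insert k I. u' i * v i) = p * v k + (\<Sum>i\<in>I. u' i * v i)"
      using insert.hyps by (simp add: u'_def)
    also have "(\<Sum>i\<in>I. u' i * v i) = (\<Sum>i\<in>I. q * (u i * v i))"
      using insert.hyps by (intro sum.cong) (auto simp: u'_def)
    also have "\<dots> = q * U v" by (simp add: U_def sum_distrib_left)
    finally have eq: "(\<Sum>i\<in>insert k I. u' i * v i) = p * v k + q * U v" .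
    consider "v k = 0" | "v k > 0" | "v k < 0" by linarith
    then show ?thesis
    proof cases
      case 1
      then have "v \<in> D'" using v by (simp add: D'_def D0_def)
      then have "0 < U v" using u by (simp add: U_def)
      then show ?thesis using eq 1 pq by simp
    next
      case 2
      then have "lo v < t" using t v by (simp add: Dp_def)
      then have "0 < rat_of_int p * rat_of_int (v k) + rat_of_int q * rat_of_int (U v)"
        using pq 2 by (simp add: lo_def field_simps)
      then have "rat_of_int 0 < of_int (p * v k + q * U v)" by simp
      then show ?thesis unfolding eq by (simp only: of_int_less_iff)
    next
      case 3
      then have "t < lo v" using t v by (simp add: Dm_def)
      then have "0 < rat_of_int p * rat_of_int (v k) + rat_of_int q * rat_of_int (U v)"
        using pq 3 by (simp add: lo_def field_simps)
      then have "rat_of_int 0 < of_int (p * v k + q * U v)" by simp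
      then show ?thesis unfolding eq by (simp only: of_int_less_iff)
    qed
  qed
  then show ?case by blast
qed

section \<open>The associated graded ring in terms of representatives\<close>

text \<open>Vectors with an arbitrary admissible order and natural numbers with the usual one are
  both instances. Cancellation in the index monoid is what makes translation strictly
  monotone.\<close>

locale admissible =
  fixes lteq :: "'i::cancel_comm_monoid_add \<Rightarrow> 'i \<Rightarrow> bool"
  assumes admissible_order: "admissible_order lteq"
begin

definition lt :: "'i \<Rightarrow> 'i \<Rightarrow> bool" where "lt a b \<longleftrightarrow> lteq a b \<and> a \<noteq> b"

sublocale ord: linorder lteq lt
proof
  note A = admissible_order[unfolded admissible_order_def]
  show "lteq x x" for x using A by (auto dest: reflpD)
  show "lt x y \<longleftrightarrow> lteq x y \<and> \<not> lteq y x" for x y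
    using A by (auto simp: lt_def dest: antisympD)
  show "lteq x y \<Longrightarrow> lteq y z \<Longrightarrow> lteq x z" for x y z using A by (blast dest: transpD)
  show "lteq x y \<Longrightarrow> lteq y x \<Longrightarrow> x = y" for x y using A by (blast dest: antisympD)
  show "lteq x y \<or> lteq y x" for x y
    using A by (metis reflpD totalpD)
qed

lemma zero_lteq: "lteq 0 a"
  using admissible_order by (simp add: admissible_order_def)

lemma add_mono: "lteq a b \<Longrightarrow> lteq c d \<Longrightarrow> lteq (a + c) (b + d)"
  using admissible_order unfolding admissible_order_def by (metis add.commute ord.order_trans)

lemma add_lt_le:
  assumes "lt a b" "lteq c d"
  shows "lt (a + c) (b + d)"
proof -
  have "lt (a + c) (b + c)"
    using assms(1) add_mono[of a b c c] by (simp add: lt_def)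
  also have "lteq (b + c) (b + d)"
    using assms(2) add_mono[of b b c d] by simp
  finally show ?thesis .
qed

lemma add_le_lt: "lteq a b \<Longrightarrow> lt c d \<Longrightarrow> lt (a + c) (b + d)"
  using add_lt_le[of c d a b] by (simp add: add.commute)

lemma not_lt_zero [simp]: "\<not> lt a 0"
  using zero_lteq[of a] by (simp add: ord.not_less)

lemma zero_lt: "a \<noteq> 0 \<Longrightarrow> lt 0 a"
  using zero_lteq[of a] by (auto simp: lt_def)

lemma add_eq_0_iff: "a + b = (0::'i) \<longleftrightarrow> a = 0 \<and> b = 0"
proof (cases "a = 0")
  case False
  then have "lt (0 + 0) (a + b)" by (intro add_lt_le zero_lt zero_lteq)
  then show ?thesis using False by (auto simp: lt_def)
qed simp

end

text \<open>The action of \<open>K\<close> is forgotten here, since the graded ring depends only on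
  the additive subgroups. It returns in \<open>refiltration\<close>.\<close>

locale ring_filtration = ring R + admissible lteq
  for R :: "('a, 'm) ring_scheme" (structure)
    and lteq :: "'i::cancel_comm_monoid_add \<Rightarrow> 'i \<Rightarrow> bool" +
  fixes F :: "'i \<Rightarrow> 'a set"
  assumes F_subgroup: "additive_subgroup (F \<alpha>) R"
    and F_mono: "lteq \<alpha> \<beta> \<Longrightarrow> F \<alpha> \<subseteq> F \<beta>"
    and F_mult: "x \<in> F \<gamma> \<Longrightarrow> y \<in> F \<delta> \<Longrightarrow> x \<otimes> y \<in> F (\<gamma> + \<delta>)"
    and F_Union: "(\<Union>\<alpha>. F \<alpha>) = carrier R"
    and F_one: "\<one> \<in> F 0"
begin

abbreviation Fm :: "'i \<Rightarrow> 'a set" where "Fm \<equiv> Fminus R lteq F"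
abbreviation P :: "'i \<Rightarrow> 'a set monoid" where "P \<equiv> gr_piece R lteq F"
abbreviation G :: "('i \<Rightarrow> 'a set) ring" where "G \<equiv> assoc_graded R lteq F"
abbreviation emb :: "'a \<Rightarrow> 'i \<Rightarrow> 'a set" where "emb \<equiv> gr_embed0 R lteq F"

lemma F_carrier: "x \<in> F \<alpha> \<Longrightarrow> x \<in> carrier R"
  using F_Union by auto

lemma F_zero: "\<zero> \<in> F \<alpha>"
  using additive_subgroup.zero_closed[OF F_subgroup] .

lemma F_add: "x \<in> F \<alpha> \<Longrightarrow> y \<in> F \<alpha> \<Longrightarrow> x \<oplus> y \<in> F \<alpha>"
  using additive_subgroup.a_closed[OF F_subgroup] .

lemma F_uminus: "x \<in> F \<alpha> \<Longrightarrow> \<ominus> x \<in> F \<alpha>"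
  using additive_subgroup.a_inv_closed[OF F_subgroup] is_abelian_group by blast

lemma F_finsum: "(\<And>i. i \<in> A \<Longrightarrow> f i \<in> F \<alpha>) \<Longrightarrow> finsum R f A \<in> F \<alpha>"
proof (induction A rule: infinite_finite_induct)
  case (insert x A)
  then show ?case by (subst finsum_insert) (auto intro: F_add F_carrier)
qed (auto simp: F_zero finsum_infinite)

lemma F0_subring: "subring (F 0) R"
  using F_carrier F_one F_uminus F_add F_mult[of _ 0 _ 0] by (intro subringI) auto

lemma F0_mult: "x \<in> F 0 \<Longrightarrow> y \<in> F \<delta> \<Longrightarrow> x \<otimes> y \<in> F \<delta>"
  using F_mult[of x 0 y \<delta>] by simp

text \<open>This absorbs the separate clause at index 0: nothing lies below 0, and for \<gamma>
  different from 0 the zero element already belongs to \<open>F 0\<close>, which is a smaller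
  piece.\<close>

lemma Fm_iff: "x \<in> Fm \<gamma> \<longleftrightarrow> x = \<zero> \<or> (\<exists>\<delta>. lt \<delta> \<gamma> \<and> x \<in> F \<delta>)"
  using zero_lt[of \<gamma>] F_zero by (auto simp: Fminus_def lt_def[symmetric])

lemma Fm_zero: "\<zero> \<in> Fm \<gamma>"
  by (simp add: Fm_iff)

lemma Fm_at_0: "Fm 0 = {\<zero>}"
  by (simp add: Fminus_def)

lemma Fm_F: "x \<in> Fm \<gamma> \<Longrightarrow> x \<in> F \<gamma>"
  using F_zero F_mono by (auto simp: Fm_iff lt_def)

lemma Fm_carrier: "x \<in> Fm \<gamma> \<Longrightarrow> x \<in> carrier R"
  using Fm_F F_carrier by blast

lemma Fm_add: "x \<in> Fm \<gamma> \<Longrightarrow> y \<in> Fm \<gamma> \<Longrightarrow> x \<oplus> y \<in> Fm \<gamma>"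
proof -
  assume xy: "x \<in> Fm \<gamma>" "y \<in> Fm \<gamma>"
  show ?thesis
  proof (cases "x = \<zero> \<or> y = \<zero>")
    case True
    then show ?thesis using xy Fm_carrier by auto
  next
    case False
    then obtain \<delta> \<epsilon> where *: "lt \<delta> \<gamma>" "x \<in> F \<delta>" "lt \<epsilon> \<gamma>" "y \<in> F \<epsilon>"
      using xy by (auto simp: Fm_iff)
    show ?thesis
    proof (cases "lteq \<delta> \<epsilon>")
      case True
      then show ?thesis using * F_mono F_add[of x \<epsilon> y] by (auto simp: Fm_iff)
    next
      case False
      then have "lteq \<epsilon> \<delta>" using ord.linear by blast
      then show ?thesis using * F_mono F_add[of x \<delta> y] by (auto simp: Fm_iff)
    qed
  qed
qed

lemma Fm_uminus: "x \<in> Fm \<gamma> \<Longrightarrow> \<ominus> x \<in> Fm \<gamma>"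
  using F_uminus by (auto simp: Fm_iff)

lemma Fm_mult_right: "x \<in> F \<gamma> \<Longrightarrow> y \<in> Fm \<delta> \<Longrightarrow> x \<otimes> y \<in> Fm (\<gamma> + \<delta>)"
  using F_mult[of x \<gamma> y] add_le_lt[OF ord.order_refl, of _ \<delta> \<gamma>] F_carrier[of x]
  by (auto simp: Fm_iff)

lemma Fm_mult_left: "x \<in> Fm \<gamma> \<Longrightarrow> y \<in> F \<delta> \<Longrightarrow> x \<otimes> y \<in> Fm (\<gamma> + \<delta>)"
  using F_mult[of x _ y \<delta>] add_lt_le[OF _ ord.order_refl, of _ \<gamma> \<delta>] F_carrier[of y]
  by (auto simp: Fm_iff)

lemma Fm_subgroup: "additive_subgroup (Fm \<gamma>) R"
  by (intro additive_subgroupI add.subgroupI)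
    (use Fm_carrier Fm_zero[of \<gamma>] Fm_uminus Fm_add in \<open>auto simp flip: a_inv_def\<close>)

lemma Fm_abelian: "abelian_subgroup (Fm \<gamma>) R"
  by (intro abelian_subgroupI3 Fm_subgroup is_abelian_group)

definition cset :: "'i \<Rightarrow> 'a \<Rightarrow> 'a set" where "cset \<gamma> r = Fm \<gamma> +> r"

lemma mem_cset: "r \<in> carrier R \<Longrightarrow> x \<in> cset \<gamma> r \<longleftrightarrow> x \<in> carrier R \<and> x \<ominus> r \<in> Fm \<gamma>"
proof
  assume r: "r \<in> carrier R"
  {
    assume "x \<in> cset \<gamma> r"
    then obtain h where h: "h \<in> Fm \<gamma>" "x = h \<oplus> r" by (auto simp: cset_def a_r_coset_def')
    then show "x \<in> carrier R \<and> x \<ominus> r \<in> Fm \<gamma>"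
      using r Fm_carrier[OF h(1)] by (auto simp: a_minus_def a_assoc r_neg)
  }
  assume "x \<in> carrier R \<and> x \<ominus> r \<in> Fm \<gamma>"
  moreover from this have "x = (x \<ominus> r) \<oplus> r" using r by (simp add: a_minus_def a_assoc l_neg)
  ultimately show "x \<in> cset \<gamma> r" unfolding cset_def a_r_coset_def' by blast
qed

lemma cset_eq_iff:
  assumes "r \<in> carrier R" "r' \<in> carrier R"
  shows "cset \<gamma> r = cset \<gamma> r' \<longleftrightarrow> r \<ominus> r' \<in> Fm \<gamma>"
proof
  assume "cset \<gamma> r = cset \<gamma> r'"
  moreover have "r \<in> cset \<gamma> r" using assms Fm_zero by (simp add: mem_cset a_minus_def r_neg)
  ultimately show "r \<ominus> r' \<in> Fm \<gamma>" using assms by (simp add: mem_cset)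
next
  assume d: "r \<ominus> r' \<in> Fm \<gamma>"
  interpret abelian_subgroup "Fm \<gamma>" R by (rule Fm_abelian)
  have "r \<in> Fm \<gamma> +> r'" using d assms mem_cset[of r' r] by (simp add: cset_def)
  then show "cset \<gamma> r = cset \<gamma> r'" using a_repr_independence' assms by (simp add: cset_def)
qed

lemma cset_Fm: "r \<in> Fm \<gamma> \<Longrightarrow> cset \<gamma> r = Fm \<gamma>"
  using abelian_subgroup.a_rcos_const[OF Fm_abelian] by (simp add: cset_def)

lemma cset_zero: "cset \<gamma> \<zero> = Fm \<gamma>"
  by (rule cset_Fm[OF Fm_zero])

lemma cset_eq_Fm: "r \<in> carrier R \<Longrightarrow> cset \<gamma> r = Fm \<gamma> \<longleftrightarrow> r \<in> Fm \<gamma>"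
  using cset_eq_iff[of r \<zero> \<gamma>] by (simp add: cset_zero a_minus_def)

lemma cset_add: "r \<in> carrier R \<Longrightarrow> r' \<in> carrier R \<Longrightarrow> cset \<gamma> r <+> cset \<gamma> r' = cset \<gamma> (r \<oplus> r')"
  using abelian_subgroup.a_rcos_sum[OF Fm_abelian] by (simp add: cset_def)

text \<open>The product of cosets is defined as a union over all representatives. All members of the
  union coincide because \<open>a \<otimes> b \<ominus> r \<otimes> r'\<close> equals \<open>(a
  \<ominus> r) \<otimes> b \<oplus> r \<otimes> (b \<ominus> r')\<close>, and both summands lie in
  \<open>Fm (\<gamma> + \<delta>)\<close>.\<close>

lemma cset_mult:
  assumes "r \<in> F \<gamma>" "r' \<in> F \<delta>"
  shows "[mod (Fm (\<gamma> + \<delta>)):] cset \<gamma> r \<Otimes> cset \<delta> r' = cset (\<gamma> + \<delta>) (r \<otimes> r')"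
proof -
  have *: "Fm (\<gamma> + \<delta>) +> (a \<otimes> b) = cset (\<gamma> + \<delta>) (r \<otimes> r')"
    if ab: "a \<in> cset \<gamma> r" "b \<in> cset \<delta> r'" for a b
  proof -
    have c: "r \<in> carrier R" "r' \<in> carrier R" using assms F_carrier by auto
    with ab have a: "a \<in> carrier R" "a \<ominus> r \<in> Fm \<gamma>" and b: "b \<in> carrier R" "b \<ominus> r' \<in> Fm \<delta>"
      by (auto simp: mem_cset)
    have "b = (b \<ominus> r') \<oplus> r'" using b(1) c by (simp add: a_minus_def a_assoc l_neg)
    then have "b \<in> F \<delta>" using F_add[OF Fm_F[OF b(2)] assms(2)] by simp
    have "a \<otimes> b \<ominus> r \<otimes> r' = (a \<ominus> r) \<otimes> b \<oplus> r \<otimes> (b \<ominus> r')"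
    proof -
      have "(a \<ominus> r) \<otimes> b \<oplus> r \<otimes> (b \<ominus> r') = a \<otimes> b \<oplus> (\<ominus> (r \<otimes> b) \<oplus> r \<otimes> b) \<oplus> \<ominus> (r \<otimes> r')"
        using a(1) b(1) c by (simp add: a_minus_def l_distr r_distr l_minus r_minus a_assoc)
      then show ?thesis using a(1) b(1) c by (simp add: l_neg a_minus_def)
    qed
    then have "a \<otimes> b \<ominus> r \<otimes> r' \<in> Fm (\<gamma> + \<delta>)"
      using Fm_mult_left[OF a(2) \<open>b \<in> F \<delta>\<close>] Fm_mult_right[OF assms(1) b(2)] Fm_add by simp
    then show ?thesis using cset_eq_iff a b c by (simp add: cset_def)
  qed
  have "r \<in> cset \<gamma> r" "r' \<in> cset \<delta> r'"
    using assms F_carrier Fm_zero by (auto simp: mem_cset a_minus_def r_neg)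
  then show ?thesis
    unfolding rcoset_mult_def using * by auto
qed

lemma piece_simps:
  "carrier (P \<gamma>) = cset \<gamma> ` F \<gamma>" "A \<otimes>\<^bsub>P \<gamma>\<^esub> B = A <+> B" "\<one>\<^bsub>P \<gamma>\<^esub> = Fm \<gamma>"
  by (auto simp: gr_piece_def A_FactGroup_def FactGroup_def RCOSETS_def r_coset_def cset_def
      a_r_coset_def set_add_def set_mult_def)

lemma piece_comm_group: "comm_group (P \<gamma>)"
proof (rule comm_groupI)
  show "\<exists>y\<in>carrier (P \<gamma>). y \<otimes>\<^bsub>P \<gamma>\<^esub> x = \<one>\<^bsub>P \<gamma>\<^esub>" if x: "x \<in> carrier (P \<gamma>)" for x
  proof -
    obtain r where r: "x = cset \<gamma> r" "r \<in> F \<gamma>" using x by (auto simp: piece_simps)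
    then have "cset \<gamma> (\<ominus> r) \<otimes>\<^bsub>P \<gamma>\<^esub> x = \<one>\<^bsub>P \<gamma>\<^esub>"
      using F_carrier by (simp add: piece_simps cset_add l_neg cset_zero)
    then show ?thesis using r F_uminus by (auto simp: piece_simps)
  qed
  show "\<one>\<^bsub>P \<gamma>\<^esub> \<in> carrier (P \<gamma>)"
    using F_zero cset_zero by (auto simp: piece_simps image_iff)
  show "\<one>\<^bsub>P \<gamma>\<^esub> \<otimes>\<^bsub>P \<gamma>\<^esub> x = x" if "x \<in> carrier (P \<gamma>)" for x
    using that cset_add[OF zero_closed, of _ \<gamma>] F_carrier by (auto simp: piece_simps cset_zero)
  show "x \<otimes>\<^bsub>P \<gamma>\<^esub> z = z \<otimes>\<^bsub>P \<gamma>\<^esub> x" if "x \<in> carrier (P \<gamma>)" "z \<in> carrier (P \<gamma>)" for x z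
  proof -
    obtain a b where "x = cset \<gamma> a" "z = cset \<gamma> b" "a \<in> carrier R" "b \<in> carrier R"
      using \<open>x \<in> carrier (P \<gamma>)\<close> \<open>z \<in> carrier (P \<gamma>)\<close> F_carrier by (auto simp: piece_simps)
    then show ?thesis by (simp add: piece_simps cset_add a_comm)
  qed
qed (auto simp: piece_simps cset_add F_carrier F_add a_assoc)

lemma piece_group: "group (P \<gamma>)"
  using piece_comm_group by (simp add: comm_group_def)

lemma piece_finprod:
  assumes "\<And>i. i \<in> A \<Longrightarrow> f i \<in> F \<gamma>"
  shows "finprod (P \<gamma>) (\<lambda>i. cset \<gamma> (f i)) A = cset \<gamma> (finsum R f A)"
proof -
  interpret comm_group "P \<gamma>" by (rule piece_comm_group)
  show ?thesis using assms
  proof (induction A rule: infinite_finite_induct)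
    case (infinite A)
    then show ?case by (simp add: finprod_infinite finsum_infinite cset_zero piece_simps)
  next
    case empty
    then show ?case by (simp add: cset_zero piece_simps)
  next
    case (insert x A)
    have c: "f \<in> A \<rightarrow> carrier R" "f x \<in> carrier R" using insert.prems F_carrier by auto
    have "finprod (P \<gamma>) (\<lambda>i. cset \<gamma> (f i)) (insert x A)
        = cset \<gamma> (f x) \<otimes>\<^bsub>P \<gamma>\<^esub> cset \<gamma> (finsum R f A)"
      using insert by (subst finprod_insert) (auto simp: piece_simps)
    also have "\<dots> = cset \<gamma> (finsum R f (insert x A))"
      using insert c by (simp add: piece_simps cset_add)
    finally show ?case .
  qed
qed

definition fam :: "('i \<Rightarrow> 'a) \<Rightarrow> 'i \<Rightarrow> 'a set" where "fam r = (\<lambda>\<gamma>. cset \<gamma> (r \<gamma>))"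

definition Fams :: "('i \<Rightarrow> 'a) set" where
  "Fams = {r. (\<forall>\<gamma>. r \<gamma> \<in> F \<gamma>) \<and> finite {\<gamma>. r \<gamma> \<noteq> \<zero>}}"

lemma graded_carrier: "carrier G = {g. (\<forall>\<gamma>. g \<gamma> \<in> cset \<gamma> ` F \<gamma>) \<and> finite {\<gamma>. g \<gamma> \<noteq> Fm \<gamma>}}"
  using carrier_sum_group[of UNIV P, OF piece_group]
  by (auto simp: assoc_graded_def piece_simps)

lemma fam_in_graded: "r \<in> Fams \<Longrightarrow> fam r \<in> carrier G"
proof -
  assume r: "r \<in> Fams"
  have "{\<gamma>. fam r \<gamma> \<noteq> Fm \<gamma>} \<subseteq> {\<gamma>. r \<gamma> \<noteq> \<zero>}" by (auto simp: fam_def cset_zero)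
  then show ?thesis using r by (auto simp: graded_carrier Fams_def fam_def dest: finite_subset)
qed

lemma graded_famE:
  assumes "g \<in> carrier G"
  obtains r where "r \<in> Fams" "g = fam r" "{\<gamma>. r \<gamma> \<noteq> \<zero>} = gr_supp R lteq F g"
proof -
  have "\<forall>\<gamma>. \<exists>x\<in>F \<gamma>. g \<gamma> = cset \<gamma> x" using assms by (auto simp: graded_carrier)
  then obtain r0 where r0: "\<And>\<gamma>. r0 \<gamma> \<in> F \<gamma>" "\<And>\<gamma>. g \<gamma> = cset \<gamma> (r0 \<gamma>)" by metis
  \<comment> \<open>A trivial component may have a nonzero representative in \<open>Fm\<close>.
    Resetting those to zero makes the support of \<open>r\<close> equal to that of \<open>g\<close>,
    hence finite.\<close>
  define r where "r \<gamma> = (if g \<gamma> = Fm \<gamma> then \<zero> else r0 \<gamma>)" for \<gamma>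
  have "{\<gamma>. r \<gamma> \<noteq> \<zero>} = {\<gamma>. g \<gamma> \<noteq> Fm \<gamma>}"
    using r0 by (auto simp: r_def cset_zero)
  moreover have "g = fam r" using r0(2) by (auto simp: fun_eq_iff fam_def r_def cset_zero)
  ultimately show ?thesis
    using that[of r] assms r0 F_zero by (auto simp: Fams_def r_def graded_carrier gr_supp_def)
qed

lemma fam_add:
  assumes "r \<in> Fams" "r' \<in> Fams"
  shows "fam r \<oplus>\<^bsub>G\<^esub> fam r' = fam (\<lambda>\<gamma>. r \<gamma> \<oplus> r' \<gamma>)"
proof -
  have "cset \<gamma> (r \<gamma>) <+> cset \<gamma> (r' \<gamma>) = cset \<gamma> (r \<gamma> \<oplus> r' \<gamma>)" for \<gamma>
    using assms F_carrier by (intro cset_add) (auto simp: Fams_def)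
  then show ?thesis
    by (simp add: assoc_graded_def fam_def piece_simps fun_eq_iff)
qed

lemma fam_zero: "\<zero>\<^bsub>G\<^esub> = fam (\<lambda>\<gamma>. \<zero>)"
  by (auto simp: assoc_graded_def fam_def piece_simps cset_zero)

lemma fam_emb: "emb a = fam (\<lambda>\<gamma>. if \<gamma> = 0 then a else \<zero>)"
  by (auto simp: fun_eq_iff gr_embed0_def fam_def cset_def[symmetric] cset_zero)

lemma fam_one: "\<one>\<^bsub>G\<^esub> = fam (\<lambda>\<gamma>. if \<gamma> = 0 then \<one> else \<zero>)"
  using fam_emb by (simp add: assoc_graded_def)

lemma fam_eq_iff:
  assumes "r \<in> Fams" "r' \<in> Fams"
  shows "fam r = fam r' \<longleftrightarrow> (\<forall>\<gamma>. r \<gamma> \<ominus> r' \<gamma> \<in> Fm \<gamma>)"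
proof -
  have "cset \<gamma> (r \<gamma>) = cset \<gamma> (r' \<gamma>) \<longleftrightarrow> r \<gamma> \<ominus> r' \<gamma> \<in> Fm \<gamma>" for \<gamma>
    using assms F_carrier by (intro cset_eq_iff) (auto simp: Fams_def)
  then show ?thesis by (simp add: fam_def fun_eq_iff)
qed

lemma fam_mult:
  assumes "r \<in> Fams" "r' \<in> Fams" "finite A" "finite B"
    and "{\<gamma>. r \<gamma> \<noteq> \<zero>} \<subseteq> A" "{\<gamma>. r' \<gamma> \<noteq> \<zero>} \<subseteq> B"
  shows "fam r \<otimes>\<^bsub>G\<^esub> fam r' =
    fam (\<lambda>\<epsilon>. \<Oplus>p\<in>{p \<in> A \<times> B. fst p + snd p = \<epsilon>}. r (fst p) \<otimes> r' (snd p))"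
proof
  fix \<epsilon>
  interpret PG: comm_group "P \<epsilon>" by (rule piece_comm_group)
  note r = assms(1,2)[unfolded Fams_def, simplified]
  define S where "S = {(\<gamma>, \<delta>). \<gamma> \<in> gr_supp R lteq F (fam r) \<and>
    \<delta> \<in> gr_supp R lteq F (fam r') \<and> \<gamma> + \<delta> = \<epsilon>}"
  define S' where "S' = {p \<in> A \<times> B. fst p + snd p = \<epsilon>}"
  have "S \<subseteq> S'" using assms(5,6)
    by (auto simp: S_def S'_def gr_supp_def fam_def cset_zero)
  have "finite S'" by (rule finite_subset[of _ "A \<times> B"]) (use assms in \<open>auto simp: S'_def\<close>)
  have prod: "[mod (Fm \<epsilon>):] (fam r \<gamma>) \<Otimes> (fam r' \<delta>) = cset \<epsilon> (r \<gamma> \<otimes> r' \<delta>)"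
    if "\<gamma> + \<delta> = \<epsilon>" for \<gamma> \<delta>
    using cset_mult[of "r \<gamma>" \<gamma> "r' \<delta>" \<delta>] r that by (simp add: fam_def)
  have inF: "r \<gamma> \<otimes> r' \<delta> \<in> F \<epsilon>" if "\<gamma> + \<delta> = \<epsilon>" for \<gamma> \<delta>
    using F_mult[of "r \<gamma>" \<gamma> "r' \<delta>" \<delta>] r that by simp
  have "(fam r \<otimes>\<^bsub>G\<^esub> fam r') \<epsilon>
    = finprod (P \<epsilon>) (\<lambda>(\<gamma>, \<delta>). [mod (Fm \<epsilon>):] (fam r \<gamma>) \<Otimes> (fam r' \<delta>)) S"
    by (simp add: assoc_graded_def S_def)
  also have "\<dots> = finprod (P \<epsilon>) (\<lambda>x. cset \<epsilon> (r (fst x) \<otimes> r' (snd x))) S"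
  proof (rule PG.finprod_cong'[OF refl])
    show "(\<lambda>x. cset \<epsilon> (r (fst x) \<otimes> r' (snd x))) \<in> S \<rightarrow> carrier (P \<epsilon>)"
      using inF \<open>S \<subseteq> S'\<close> by (auto simp: S'_def piece_simps)
    show "(case x of (\<gamma>, \<delta>) \<Rightarrow> [mod (Fm \<epsilon>):] (fam r \<gamma>) \<Otimes> (fam r' \<delta>)) =
        cset \<epsilon> (r (fst x) \<otimes> r' (snd x))" if "x \<in> S" for x
      using that prod[of "fst x" "snd x"] by (simp add: S_def split_beta)
  qed
  also have "\<dots> = finprod (P \<epsilon>) (\<lambda>x. cset \<epsilon> (r (fst x) \<otimes> r' (snd x))) S'"
  proof (rule PG.finprod_mono_neutral_cong_left[OF \<open>finite S'\<close> \<open>S \<subseteq> S'\<close>])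
    fix x assume x: "x \<in> S' - S"
    obtain \<gamma> \<delta> where xe: "x = (\<gamma>, \<delta>)" by force
    then have e: "\<gamma> + \<delta> = \<epsilon>" using x by (auto simp: S'_def)
    have "r \<gamma> \<in> Fm \<gamma> \<or> r' \<delta> \<in> Fm \<delta>"
      using x xe cset_eq_Fm[of "r \<gamma>" \<gamma>] cset_eq_Fm[of "r' \<delta>" \<delta>] r(1) r(2)
        F_carrier[of "r \<gamma>" \<gamma>] F_carrier[of "r' \<delta>" \<delta>]
      by (auto simp: S_def S'_def gr_supp_def fam_def)
    then have "r \<gamma> \<otimes> r' \<delta> \<in> Fm \<epsilon>"
      using Fm_mult_left[of "r \<gamma>" \<gamma> "r' \<delta>" \<delta>] Fm_mult_right[of "r \<gamma>" \<gamma> "r' \<delta>" \<delta>] r e by auto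
    then show "cset \<epsilon> (r (fst x) \<otimes> r' (snd x)) = \<one>\<^bsub>P \<epsilon>\<^esub>"
      using xe by (simp add: cset_Fm piece_simps)
  qed (use inF in \<open>auto simp: S'_def piece_simps\<close>)
  also have "\<dots> = cset \<epsilon> (\<Oplus>x\<in>S'. r (fst x) \<otimes> r' (snd x))"
    by (rule piece_finprod) (use inF in \<open>auto simp: S'_def\<close>)
  finally show "(fam r \<otimes>\<^bsub>G\<^esub> fam r') \<epsilon> =
    fam (\<lambda>\<epsilon>. \<Oplus>p\<in>{p \<in> A \<times> B. fst p + snd p = \<epsilon>}. r (fst p) \<otimes> r' (snd p)) \<epsilon>"
    by (simp add: fam_def S'_def)
qed

subsection \<open>Homogeneous elements\<close>

definition cls :: "'i \<Rightarrow> 'a \<Rightarrow> 'i \<Rightarrow> 'a set" where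
  "cls \<gamma> r = fam (\<lambda>\<delta>. if \<delta> = \<gamma> then r else \<zero>)"

lemma cls_Fams: "r \<in> F \<gamma> \<Longrightarrow> (\<lambda>\<delta>. if \<delta> = \<gamma> then r else \<zero>) \<in> Fams"
  using F_zero by (auto simp: Fams_def)

lemma cls_in_graded: "r \<in> F \<gamma> \<Longrightarrow> cls \<gamma> r \<in> carrier G"
  unfolding cls_def by (intro fam_in_graded cls_Fams)

lemma cls_add: "r \<in> F \<gamma> \<Longrightarrow> r' \<in> F \<gamma> \<Longrightarrow> cls \<gamma> r \<oplus>\<^bsub>G\<^esub> cls \<gamma> r' = cls \<gamma> (r \<oplus> r')"
  unfolding cls_def
  by (subst fam_add) (auto simp: fun_eq_iff fam_def F_zero F_carrier intro!: cls_Fams)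

lemma cls_mult:
  assumes "r \<in> F \<gamma>" "r' \<in> F \<delta>"
  shows "cls \<gamma> r \<otimes>\<^bsub>G\<^esub> cls \<delta> r' = cls (\<gamma> + \<delta>) (r \<otimes> r')"
proof -
  have c: "r \<otimes> r' \<in> carrier R" using assms F_carrier by auto
  have "{p \<in> {\<gamma>} \<times> {\<delta>}. fst p + snd p = \<epsilon>} = (if \<epsilon> = \<gamma> + \<delta> then {(\<gamma>, \<delta>)} else {})"
    for \<epsilon> by auto
  then have "(\<Oplus>p\<in>{p \<in> {\<gamma>} \<times> {\<delta>}. fst p + snd p = \<epsilon>}.
      (if fst p = \<gamma> then r else \<zero>) \<otimes> (if snd p = \<delta> then r' else \<zero>)) =
      (if \<epsilon> = \<gamma> + \<delta> then r \<otimes> r' else \<zero>)" for \<epsilon>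
    using c by simp
  moreover have "fam (\<lambda>\<delta>. if \<delta> = \<gamma> then r else \<zero>) \<otimes>\<^bsub>G\<^esub> fam (\<lambda>\<epsilon>. if \<epsilon> = \<delta> then r' else \<zero>) =
    fam (\<lambda>\<epsilon>. \<Oplus>p\<in>{p \<in> {\<gamma>} \<times> {\<delta>}. fst p + snd p = \<epsilon>}.
      (if fst p = \<gamma> then r else \<zero>) \<otimes> (if snd p = \<delta> then r' else \<zero>))"
    using assms by (intro fam_mult cls_Fams) auto
  ultimately show ?thesis unfolding cls_def by simp
qed

lemma cls_at: "cls \<gamma> r \<delta> = cset \<delta> (if \<delta> = \<gamma> then r else \<zero>)"
  by (simp add: cls_def fam_def)

lemma cls_zero: "cls \<gamma> \<zero> = \<zero>\<^bsub>G\<^esub>"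
  by (simp add: cls_def fam_zero)

lemma cls_eq_zero: "r \<in> Fm \<gamma> \<Longrightarrow> cls \<gamma> r = \<zero>\<^bsub>G\<^esub>"
  by (auto simp: fun_eq_iff cls_def fam_zero fam_def cset_zero cset_Fm)

lemma emb_eq_cls: "emb a = cls 0 a"
  by (simp add: cls_def fam_emb)

lemma one_eq_cls: "\<one>\<^bsub>G\<^esub> = cls 0 \<one>"
  by (simp add: cls_def fam_one)

lemma emb_eq_zero_iff: "a \<in> F 0 \<Longrightarrow> emb a = \<zero>\<^bsub>G\<^esub> \<longleftrightarrow> a = \<zero>"
  unfolding emb_eq_cls cls_def fam_zero
  by (subst fam_eq_iff) (use cls_Fams F_carrier F_zero in \<open>auto simp: Fams_def Fm_at_0 Fm_zero a_minus_def\<close>)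

lemma homogeneousE:
  assumes "gr_homogeneous R lteq F g"
  obtains \<gamma> r where "r \<in> F \<gamma>" "g = cls \<gamma> r"
proof -
  obtain \<gamma> where g: "g \<in> carrier G" "gr_supp R lteq F g \<subseteq> {\<gamma>}"
    using assms by (auto simp: gr_homogeneous_def gr_component_def)
  from g(1) obtain r where r: "r \<in> Fams" "g = fam r" "{\<gamma>. r \<gamma> \<noteq> \<zero>} = gr_supp R lteq F g"
    by (rule graded_famE)
  have "r = (\<lambda>\<delta>. if \<delta> = \<gamma> then r \<gamma> else \<zero>)" using r(3) g(2) by fastforce
  then show ?thesis using that[of "r \<gamma>" \<gamma>] r by (auto simp: cls_def Fams_def)
qed

end

lemma ring_filtrationI:
  fixes R (structure) and lteq :: "'i::cancel_comm_monoid_add \<Rightarrow> 'i \<Rightarrow> bool"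
  assumes "ring R" "admissible_order lteq" "filtration K R lteq F"
  shows "ring_filtration R lteq F"
proof -
  interpret ring R by fact
  note F = assms(3)[unfolded filtration_def]
  have "additive_subgroup (F \<alpha>) R" for \<alpha>
    using F by (intro additive_subgroupI) (auto simp: submodule_def)
  moreover have "F \<alpha> \<subseteq> F \<beta>" if "lteq \<alpha> \<beta>" for \<alpha> \<beta>
    using F that by blast
  ultimately show ?thesis
    using F assms(2)
    by (intro ring_filtration.intro admissible.intro ring_filtration_axioms.intro ring_axioms) auto
qed

lemma (in semiring) finsum_mult_finsum:
  assumes "finite A" "finite A'" "f \<in> A \<rightarrow> carrier R" "g \<in> A' \<rightarrow> carrier R"
  shows "finsum R f A \<otimes> finsum R g A' = (\<Oplus>p\<in>A \<times> A'. f (fst p) \<otimes> g (snd p))"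
  using assms(1,3)
proof (induction A rule: finite_induct)
  case empty
  then show ?case using assms by simp
next
  case (insert a A)
  have eq: "insert a A \<times> A' = Pair a ` A' \<union> A \<times> A'" by auto
  have "(\<Oplus>p\<in>insert a A \<times> A'. f (fst p) \<otimes> g (snd p)) =
    (\<Oplus>p\<in>Pair a ` A'. f (fst p) \<otimes> g (snd p)) \<oplus> (\<Oplus>p\<in>A \<times> A'. f (fst p) \<otimes> g (snd p))"
    unfolding eq using insert assms by (intro finsum_Un_disjoint) (auto simp: Pi_iff)
  also have "(\<Oplus>p\<in>Pair a ` A'. f (fst p) \<otimes> g (snd p)) = (\<Oplus>b\<in>A'. f a \<otimes> g b)"
    using insert assms by (subst finsum_reindex) (auto simp: inj_on_def Pi_iff)
  also have "\<dots> = f a \<otimes> finsum R g A'"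
    using insert assms by (intro finsum_rdistr[symmetric]) (auto simp: Pi_iff)
  finally show ?case using insert assms by (simp add: l_distr finsum_closed Pi_iff)
qed

context left_family
begin

lemma coeffs_uminus: "f \<in> coeffs \<Longrightarrow> (\<lambda>d. \<ominus> f d) \<in> coeffs"
proof -
  assume f: "f \<in> coeffs"
  then have "{d. \<ominus> f d \<noteq> \<zero>} = {d. f d \<noteq> \<zero>}" using coeffsD(2)[OF f] by auto
  then show ?thesis using f L_rules(5) by (auto simp: coeffs_def)
qed

lemma coeffs_minus: "f \<in> coeffs \<Longrightarrow> g \<in> coeffs \<Longrightarrow> (\<lambda>d. f d \<ominus> g d) \<in> coeffs"
  unfolding a_minus_def by (intro coeffs_add coeffs_uminus)

lemma lc_closed: "f \<in> coeffs \<Longrightarrow> lc f \<in> carrier T"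
  using span_closed[OF lc_in_span[of f E]] coeffsD(4) by auto

lemma lc_minus:
  assumes "f \<in> coeffs" "g \<in> coeffs"
  shows "lc (\<lambda>d. f d \<ominus> g d) = lc f \<ominus> lc g"
proof -
  have eq: "(f d \<ominus> g d) \<oplus> g d = f d" for d
    using assms coeffsD(2) by (simp add: a_minus_def a_assoc l_neg)
  have "lc (\<lambda>d. f d \<ominus> g d) \<oplus> lc g = lc f"
    using lc_add[OF coeffs_minus[OF assms] assms(2)] by (simp add: eq)
  then show ?thesis
    using lc_closed[OF assms(1)] lc_closed[OF assms(2)] lc_closed[OF coeffs_minus[OF assms]]
    by (metis add.inv_solve_right a_minus_def)
qed

lemma coeffs_restrict: "f \<in> coeffs \<Longrightarrow> (\<lambda>d. if Q d then f d else \<zero>) \<in> coeffs"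
  unfolding coeffs_def using L_zero
  by (auto intro: rev_finite_subset[of "{d. f d \<noteq> \<zero>}"])

end

section \<open>The coefficient model of the associated graded ring\<close>

text \<open>\<open>c a m b\<close> is the coefficient of \<open>B (a + b)\<close> in \<open>B a * m * B b\<close>, all other
  contributions being suppressed.\<close>

definition coeff_ring ::
  "('a, 'm) ring_scheme \<Rightarrow> ('e \<Rightarrow> 'a) set \<Rightarrow> ('e::comm_monoid_add \<Rightarrow> 'a \<Rightarrow> 'e \<Rightarrow> 'a) \<Rightarrow> ('e \<Rightarrow> 'a) ring" where
  "coeff_ring R C c =
    \<lparr>carrier = C,
     monoid.mult = (\<lambda>f g e.
       \<Oplus>\<^bsub>R\<^esub>p\<in>{p \<in> {d. f d \<noteq> \<zero>\<^bsub>R\<^esub>} \<times> {d. g d \<noteq> \<zero>\<^bsub>R\<^esub>}. fst p + snd p = e}.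
         f (fst p) \<otimes>\<^bsub>R\<^esub> c (fst p) (g (snd p)) (snd p)),
     one = (\<lambda>e. if e = 0 then \<one>\<^bsub>R\<^esub> else \<zero>\<^bsub>R\<^esub>),
     ring.zero = (\<lambda>e. \<zero>\<^bsub>R\<^esub>),
     ring.add = (\<lambda>f g e. f e \<oplus>\<^bsub>R\<^esub> g e)\<rparr>"

text \<open>Neither \<open>lteq\<close> nor \<open>deg\<close> enters \<open>coeff_ring\<close>.
  Hence two filtrations of one ring that share \<open>B\<close>, \<open>E\<close>, the degree-0
  piece and \<open>c\<close> have isomorphic graded rings.\<close>

locale filtered_basis = ring_filtration R lteq F + left_family R "F 0" B E
  for R :: "('a, 'm) ring_scheme" (structure)
    and lteq :: "'i::cancel_comm_monoid_add \<Rightarrow> 'i \<Rightarrow> bool" and F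
    and B :: "'e::comm_monoid_add \<Rightarrow> 'a" and E +
  fixes deg :: "'e \<Rightarrow> 'i" and c :: "'e \<Rightarrow> 'a \<Rightarrow> 'e \<Rightarrow> 'a"
  assumes E_zero: "0 \<in> E" and E_add: "a \<in> E \<Longrightarrow> b \<in> E \<Longrightarrow> a + b \<in> E"
    and deg_zero: "deg 0 = 0" and deg_add: "a \<in> E \<Longrightarrow> b \<in> E \<Longrightarrow> deg (a + b) = deg a + deg b"
    and B_zero: "B 0 = \<one>"
    and free: "f \<in> coeffs \<Longrightarrow> lc f = \<zero> \<Longrightarrow> f = (\<lambda>_. \<zero>)"
    and F_span: "F \<alpha> = span {d \<in> E. lteq (deg d) \<alpha>}"
    and c_closed: "a \<in> E \<Longrightarrow> m \<in> F 0 \<Longrightarrow> b \<in> E \<Longrightarrow> c a m b \<in> F 0"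
    and c_lead: "a \<in> E \<Longrightarrow> m \<in> F 0 \<Longrightarrow> b \<in> E \<Longrightarrow>
      B a \<otimes> m \<otimes> B b \<ominus> c a m b \<otimes> B (a + b) \<in> span {d \<in> E. lt (deg d) (deg (a + b))}"
begin

lemmas in_spanI = subsetD[OF equalityD1[OF F_span]]
lemmas in_FI = subsetD[OF equalityD2[OF F_span]]

lemma B_in_F: "d \<in> E \<Longrightarrow> B d \<in> F (deg d)"
  by (rule in_FI, rule span_base) auto

lemma Fm_span: "Fm \<alpha> = span {d \<in> E. lt (deg d) \<alpha>}"
proof
  show "Fm \<alpha> \<subseteq> span {d \<in> E. lt (deg d) \<alpha>}"
  proof
    fix x assume "x \<in> Fm \<alpha>"
    then consider "x = \<zero>" | \<delta> where "lt \<delta> \<alpha>" "x \<in> F \<delta>" by (auto simp: Fm_iff)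
    then show "x \<in> span {d \<in> E. lt (deg d) \<alpha>}"
    proof cases
      case 2
      then have "{d \<in> E. lteq (deg d) \<delta>} \<subseteq> {d \<in> E. lt (deg d) \<alpha>}"
        using ord.le_less_trans by blast
      from lspan_mono[OF this] in_spanI[OF 2(2)] show ?thesis by (rule subsetD)
    qed (simp add: lspan_zero)
  qed
  show "span {d \<in> E. lt (deg d) \<alpha>} \<subseteq> Fm \<alpha>"
  proof
    fix v assume "v \<in> span {d \<in> E. lt (deg d) \<alpha>}"
    then show "v \<in> Fm \<alpha>"
      by (rule span_least)
        (use Fm_zero Fm_add F0_mult[OF _ B_in_F] in \<open>auto simp: Fm_iff\<close>)
  qed
qed

definition hpart :: "('e \<Rightarrow> 'a) \<Rightarrow> 'i \<Rightarrow> 'a" where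
  "hpart f \<gamma> = lc (\<lambda>d. if deg d = \<gamma> then f d else \<zero>)"

lemma hpart_supp: "{\<gamma>. hpart f \<gamma> \<noteq> \<zero>} \<subseteq> deg ` {d. f d \<noteq> \<zero>}"
proof -
  have "hpart f \<gamma> = \<zero>" if "\<gamma> \<notin> deg ` {d. f d \<noteq> \<zero>}" for \<gamma>
  proof -
    have "(\<lambda>d. if deg d = \<gamma> then f d else \<zero>) = (\<lambda>d. \<zero>)" using that by (auto simp: fun_eq_iff)
    then show ?thesis by (simp add: hpart_def coeffs_zero)
  qed
  then show ?thesis by auto
qed

lemma hpart_Fams: "f \<in> coeffs \<Longrightarrow> hpart f \<in> Fams"
proof -
  assume f: "f \<in> coeffs"
  have "hpart f \<gamma> \<in> F \<gamma>" for \<gamma>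
    unfolding hpart_def using coeffsD[OF f]
    by (intro in_FI[of _ \<gamma>] lc_in_span coeffs_restrict f) (auto split: if_splits)
  moreover have "finite {\<gamma>. hpart f \<gamma> \<noteq> \<zero>}"
    using hpart_supp[of f] by (rule finite_subset) (use coeffsD(3)[OF f] in auto)
  ultimately show ?thesis by (auto simp: Fams_def)
qed

lemma hpart_eq:
  assumes "f \<in> coeffs" "finite A" "A \<subseteq> E" "{d. f d \<noteq> \<zero>} \<subseteq> A"
  shows "hpart f \<gamma> = (\<Oplus>d\<in>{d\<in>A. deg d = \<gamma>}. f d \<otimes> B d)"
proof -
  have "hpart f \<gamma> = (\<Oplus>d\<in>{d\<in>A. deg d = \<gamma>}. (if deg d = \<gamma> then f d else \<zero>) \<otimes> B d)"
    unfolding hpart_def by (rule lc_eq) (use assms in \<open>auto intro: coeffs_restrict split: if_splits\<close>)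
  also have "\<dots> = (\<Oplus>d\<in>{d\<in>A. deg d = \<gamma>}. f d \<otimes> B d)"
    using assms coeffsD(2)[OF assms(1)] B_closed by (intro finsum_cong' refl) auto
  finally show ?thesis .
qed

lemma hpart_add:
  assumes "f \<in> coeffs" "g \<in> coeffs"
  shows "hpart (\<lambda>d. f d \<oplus> g d) = (\<lambda>\<gamma>. hpart f \<gamma> \<oplus> hpart g \<gamma>)"
proof
  fix \<gamma>
  have "(\<lambda>d. if deg d = \<gamma> then f d \<oplus> g d else \<zero>) =
    (\<lambda>d. (if deg d = \<gamma> then f d else \<zero>) \<oplus> (if deg d = \<gamma> then g d else \<zero>))" by auto
  then show "hpart (\<lambda>d. f d \<oplus> g d) \<gamma> = hpart f \<gamma> \<oplus> hpart g \<gamma>"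
    using assms by (simp add: hpart_def lc_add coeffs_restrict)
qed

abbreviation C :: "('e \<Rightarrow> 'a) ring" where "C \<equiv> coeff_ring R coeffs c"

lemma Fm_finsum_diff:
  assumes "\<And>q. q \<in> I \<Longrightarrow> t q \<in> carrier R" "\<And>q. q \<in> I \<Longrightarrow> u q \<in> carrier R"
    "\<And>q. q \<in> I \<Longrightarrow> t q \<ominus> u q \<in> Fm \<epsilon>"
  shows "finsum R t I \<ominus> finsum R u I \<in> Fm \<epsilon>"
  using assms
proof (induction I rule: infinite_finite_induct)
  case (insert x I)
  have "finsum R t (insert x I) \<ominus> finsum R u (insert x I) =
    (t x \<ominus> u x) \<oplus> (finsum R t I \<ominus> finsum R u I)"
    using insert.prems(1,2) insert.hyps
    by (simp add: finsum_closed minus_add a_minus_def Pi_def a_ac)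
  then show ?case using insert Fm_add by simp
qed (auto simp: Fm_zero finsum_infinite a_minus_def)

text \<open>Both sides are sums over pairs of terms of \<open>f\<close> and \<open>g\<close>: the
  graded product groups the pairs by their two degrees, the coefficient product by the sum of their
  exponents. In a fixed total degree the two sums run over the same pairs, and each summand differs
  by a left multiple of the error in \<open>c_lead\<close>, which lies in \<open>Fm\<close>.\<close>

lemma coeff_mult:
  assumes "f \<in> coeffs" "g \<in> coeffs"
  shows "f \<otimes>\<^bsub>C\<^esub> g \<in> coeffs"
    and "fam (hpart (f \<otimes>\<^bsub>C\<^esub> g)) = fam (hpart f) \<otimes>\<^bsub>G\<^esub> fam (hpart g)"
proof -
  note f = coeffsD[OF assms(1)] and g = coeffsD[OF assms(2)]
  define S where "S = {d. f d \<noteq> \<zero>} \<times> {d. g d \<noteq> \<zero>}"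
  \<comment> \<open>For a pair \<open>q\<close> of exponents, \<open>t q\<close> is the full product
    of the two terms and \<open>u q\<close> the coefficient that is retained for the exponent
    \<open>s q\<close>.\<close>
  define u where "u q = f (fst q) \<otimes> c (fst q) (g (snd q)) (snd q)" for q
  define t where "t q = f (fst q) \<otimes> B (fst q) \<otimes> (g (snd q) \<otimes> B (snd q))" for q
  define s where "s q = fst q + snd q" for q :: "'e \<times> 'e"
  define J where "J = s ` S"
  have finS: "finite S" using f g by (simp add: S_def)
  have fE: "f d \<noteq> \<zero> \<Longrightarrow> d \<in> E" and gE: "g d \<noteq> \<zero> \<Longrightarrow> d \<in> E" for d
    using f(4) g(4) by auto
  have SE: "fst q \<in> E" "snd q \<in> E" "s q \<in> E" if "q \<in> S" for q
    using that fE gE E_add by (auto simp: S_def s_def)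
  have finJ: "finite J" and JE: "J \<subseteq> E"
    using finS SE by (auto simp: J_def)
  have u_F: "u q \<in> F 0" if "q \<in> S" for q
    unfolding u_def using SE[OF that] f g by (intro F0_mult c_closed) auto
  have m: "(f \<otimes>\<^bsub>C\<^esub> g) e = (\<Oplus>q\<in>{q\<in>S. s q = e}. u q)" for e
    by (simp add: coeff_ring_def S_def u_def s_def)
  have mJ: "(f \<otimes>\<^bsub>C\<^esub> g) e = \<zero>" if "e \<notin> J" for e
  proof -
    have "{q\<in>S. s q = e} = {}" using that by (auto simp: J_def)
    then show ?thesis unfolding m by (simp only: finsum_empty)
  qed
  then have supp: "{e. (f \<otimes>\<^bsub>C\<^esub> g) e \<noteq> \<zero>} \<subseteq> J" by auto
  have "(f \<otimes>\<^bsub>C\<^esub> g) e \<in> F 0" for e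
    unfolding m by (rule F_finsum) (use u_F in auto)
  then show fg: "f \<otimes>\<^bsub>C\<^esub> g \<in> coeffs"
    using supp finJ JE by (auto simp: coeffs_def dest: finite_subset)
  define A where "A = deg ` {d. f d \<noteq> \<zero>}"
  define A' where "A' = deg ` {d. g d \<noteq> \<zero>}"
  have u_c: "u q \<otimes> B (s q) \<in> carrier R" and t_c: "t q \<in> carrier R" if "q \<in> S" for q
    using u_F[OF that] SE[OF that] f g F_carrier by (auto simp: t_def B_closed)
  have "finite A" "finite A'" using f g by (auto simp: A_def A'_def)
  moreover have "{\<gamma>. hpart f \<gamma> \<noteq> \<zero>} \<subseteq> A" "{\<gamma>. hpart g \<gamma> \<noteq> \<zero>} \<subseteq> A'"
    unfolding A_def A'_def by (rule hpart_supp)+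
  ultimately have "fam (hpart f) \<otimes>\<^bsub>G\<^esub> fam (hpart g) =
    fam (\<lambda>\<epsilon>. \<Oplus>p\<in>{p \<in> A \<times> A'. fst p + snd p = \<epsilon>}. hpart f (fst p) \<otimes> hpart g (snd p))"
    (is "_ = fam ?r")
    by (intro fam_mult hpart_Fams assms)
  moreover have r: "?r \<epsilon> = (\<Oplus>q\<in>{q\<in>S. deg (s q) = \<epsilon>}. t q)" for \<epsilon>
  proof -
    let ?h = "\<lambda>q. (deg (fst q), deg (snd q))"
    let ?I = "{q\<in>S. deg (s q) = \<epsilon>}" and ?J = "{p \<in> A \<times> A'. fst p + snd p = \<epsilon>}"
    have "hpart f (fst p) \<otimes> hpart g (snd p) = (\<Oplus>q\<in>{q\<in>?I. ?h q = p}. t q)" if "p \<in> ?J" for p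
    proof -
      have "hpart f (fst p) \<otimes> hpart g (snd p) =
        (\<Oplus>q\<in>{d \<in> {d. f d \<noteq> \<zero>}. deg d = fst p} \<times> {d \<in> {d. g d \<noteq> \<zero>}. deg d = snd p}. t q)"
        unfolding hpart_eq[OF assms(1) f(3,4) order_refl] hpart_eq[OF assms(2) g(3,4) order_refl] t_def
        by (rule finsum_mult_finsum) (use f g B_closed in auto)
      also have "{d \<in> {d. f d \<noteq> \<zero>}. deg d = fst p} \<times> {d \<in> {d. g d \<noteq> \<zero>}. deg d = snd p} =
          {q\<in>?I. ?h q = p}"
        using that f g by (auto simp: S_def s_def deg_add subset_iff)
      finally show ?thesis .
    qed
    then have "?r \<epsilon> = (\<Oplus>p\<in>?J. \<Oplus>q\<in>{q\<in>?I. ?h q = p}. t q)"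
      using t_c by (intro finsum_cong' refl) (auto intro!: finsum_closed)
    also have "\<dots> = finsum R t ?I"
      using finS \<open>finite A\<close> \<open>finite A'\<close> t_c SE
      by (intro finsum_fibres) (auto simp: A_def A'_def S_def s_def deg_add)
    finally show ?thesis .
  qed
  moreover have h: "hpart (f \<otimes>\<^bsub>C\<^esub> g) \<epsilon> = (\<Oplus>q\<in>{q\<in>S. deg (s q) = \<epsilon>}. u q \<otimes> B (s q))" for \<epsilon>
  proof -
    let ?I = "{q\<in>S. deg (s q) = \<epsilon>}" and ?J = "{e \<in> J. deg e = \<epsilon>}"
    have "(f \<otimes>\<^bsub>C\<^esub> g) e \<otimes> B e = (\<Oplus>q\<in>{q\<in>?I. s q = e}. u q \<otimes> B (s q))" if "e \<in> ?J" for e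
    proof -
      have eq: "{q\<in>?I. s q = e} = {q\<in>S. s q = e}" using that by auto
      have "(f \<otimes>\<^bsub>C\<^esub> g) e \<otimes> B e = (\<Oplus>q\<in>{q\<in>S. s q = e}. u q \<otimes> B e)"
        unfolding m using that JE finS F_carrier[OF u_F] B_closed by (intro finsum_ldistr) auto
      also have "\<dots> = (\<Oplus>q\<in>{q\<in>S. s q = e}. u q \<otimes> B (s q))"
        using u_c by (intro finsum_cong' refl) auto
      finally show ?thesis unfolding eq .
    qed
    then have "(\<Oplus>e\<in>?J. (f \<otimes>\<^bsub>C\<^esub> g) e \<otimes> B e) = (\<Oplus>e\<in>?J. \<Oplus>q\<in>{q\<in>?I. s q = e}. u q \<otimes> B (s q))"
      using u_c by (intro finsum_cong' refl) (auto intro!: finsum_closed)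
    also have "\<dots> = (\<Oplus>q\<in>?I. u q \<otimes> B (s q))"
      using finS finJ u_c by (intro finsum_fibres) (auto simp: J_def)
    finally show ?thesis
      using hpart_eq[OF fg finJ JE supp] by simp
  qed
  have "t q \<ominus> u q \<otimes> B (s q) \<in> Fm (deg (s q))" if q: "q \<in> S" for q
  proof -
    obtain a b where ab: "q = (a, b)" by force
    have E: "a \<in> E" "b \<in> E" "a + b \<in> E" and c: "c a (g b) b \<in> F 0"
      using SE[OF q] g(1) by (auto simp: ab s_def intro: c_closed)
    have "t q \<ominus> u q \<otimes> B (s q) = f a \<otimes> (B a \<otimes> g b \<otimes> B b \<ominus> c a (g b) b \<otimes> B (a + b))"
      using f(2) g(2) B_closed[OF E(1)] B_closed[OF E(2)] B_closed[OF E(3)] F_carrier[OF c]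
      by (simp add: ab t_def u_def s_def a_minus_def r_distr r_minus m_assoc)
    also have "\<dots> \<in> Fm (0 + deg (a + b))"
      using f(1) c_lead[OF E(1) g(1) E(2)] unfolding Fm_span[symmetric] by (rule Fm_mult_right)
    finally show ?thesis by (simp add: ab s_def)
  qed
  then have d: "?r \<epsilon> \<ominus> hpart (f \<otimes>\<^bsub>C\<^esub> g) \<epsilon> \<in> Fm \<epsilon>" for \<epsilon>
    unfolding r h using t_c u_c by (intro Fm_finsum_diff) auto
  have "?r \<epsilon> \<in> carrier R" "hpart (f \<otimes>\<^bsub>C\<^esub> g) \<epsilon> \<in> carrier R" for \<epsilon>
    unfolding r h using t_c u_c by (auto intro!: finsum_closed)
  then have "cset \<epsilon> (?r \<epsilon>) = cset \<epsilon> (hpart (f \<otimes>\<^bsub>C\<^esub> g) \<epsilon>)" for \<epsilon>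
    using d by (subst cset_eq_iff) auto
  then have "fam ?r = fam (hpart (f \<otimes>\<^bsub>C\<^esub> g))"
    unfolding fam_def by (intro ext) auto
  ultimately show "fam (hpart (f \<otimes>\<^bsub>C\<^esub> g)) = fam (hpart f) \<otimes>\<^bsub>G\<^esub> fam (hpart g)"
    by simp
qed

text \<open>Equal classes in degree \<open>deg d\<close> mean that the homogeneous part of the
  difference is also a combination \<open>k\<close> of monomials of smaller degree. By linear
  independence the two coefficient functions agree, and \<open>k\<close> vanishes at
  \<open>d\<close>.\<close>

lemma hpart_inj:
  assumes "f \<in> coeffs" "g \<in> coeffs" "fam (hpart f) = fam (hpart g)"
  shows "f = g"
proof
  fix d
  note fg = coeffs_minus[OF assms(1,2)]
  let ?h = "\<lambda>e. if deg e = deg d then f e \<ominus> g e else \<zero>"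
  have h: "?h \<in> coeffs" using coeffs_restrict[OF fg] .
  have "?h = (\<lambda>e. (if deg e = deg d then f e else \<zero>) \<ominus> (if deg e = deg d then g e else \<zero>))"
    by (auto simp: a_minus_def)
  then have "lc ?h = hpart f (deg d) \<ominus> hpart g (deg d)"
    unfolding hpart_def using assms by (simp add: lc_minus coeffs_restrict)
  also have "\<dots> \<in> Fm (deg d)"
    using fam_eq_iff[OF hpart_Fams hpart_Fams] assms by blast
  finally obtain k where k: "k \<in> coeffs" "{e. k e \<noteq> \<zero>} \<subseteq> {e \<in> E. lt (deg e) (deg d)}" "lc ?h = lc k"
    unfolding Fm_span by (rule span_lcE) auto
  have "lc (\<lambda>e. ?h e \<ominus> k e) = \<zero>"
    using lc_minus[OF h k(1)] k(3) lc_closed[OF k(1)] by (simp add: a_minus_def r_neg)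
  then have "?h d \<ominus> k d = \<zero>"
    using free[OF coeffs_minus[OF h k(1)], THEN fun_cong, of d] by simp
  moreover have "k d = \<zero>" using k(2) by auto
  ultimately have "f d \<ominus> g d = \<zero>"
    using coeffsD(2)[OF fg] by (simp add: a_minus_def)
  then show "f d = g d"
    using coeffsD(2)[OF assms(1)] coeffsD(2)[OF assms(2)] by simp
qed

text \<open>A representative in \<open>F \<gamma>\<close> expands into monomials of degree at most
  \<gamma>. Discarding those of smaller degree changes it only by an element of
  \<open>Fm \<gamma>\<close>, so the coefficients in exact degree suffice.\<close>

lemma hpart_surj:
  assumes "x \<in> carrier G"
  shows "\<exists>f\<in>coeffs. x = fam (hpart f)"
proof -
  obtain r where r: "r \<in> Fams" "x = fam r" using assms by (rule graded_famE)
  have "\<exists>k. k \<in> coeffs \<and> {d. k d \<noteq> \<zero>} \<subseteq> {d \<in> E. lteq (deg d) \<gamma>} \<and> r \<gamma> = lc k" for \<gamma>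
  proof -
    have "r \<gamma> \<in> span {d \<in> E. lteq (deg d) \<gamma>}"
      using r(1) by (intro in_spanI) (auto simp: Fams_def)
    then show ?thesis by (rule span_lcE) auto
  qed
  then obtain k where k: "\<And>\<gamma>. k \<gamma> \<in> coeffs" "\<And>\<gamma>. {d. k \<gamma> d \<noteq> \<zero>} \<subseteq> {d \<in> E. lteq (deg d) \<gamma>}"
    "\<And>\<gamma>. r \<gamma> = lc (k \<gamma>)" by metis
  define f where "f d = k (deg d) d" for d
  \<comment> \<open>The expansions are chosen arbitrarily, so finiteness of the support of
    \<open>f\<close> needs linear independence: a zero representative has only the zero expansion,
    and only finitely many representatives are nonzero.\<close>
  have "f d = \<zero>" if "r (deg d) = \<zero>" for d
    using free[OF k(1), of "deg d"] k(3) that by (simp add: f_def fun_eq_iff)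
  then have "{d. f d \<noteq> \<zero>} \<subseteq> (\<Union>\<gamma>\<in>{\<gamma>. r \<gamma> \<noteq> \<zero>}. {d. k \<gamma> d \<noteq> \<zero>})"
    by (auto simp: f_def)
  moreover have "finite \<dots>"
    using r(1) coeffsD(3)[OF k(1)] by (auto simp: Fams_def)
  ultimately have "finite {d. f d \<noteq> \<zero>}" by (rule finite_subset)
  moreover have "f d \<in> F 0" "f d \<noteq> \<zero> \<Longrightarrow> d \<in> E" for d
    using coeffsD(1,4)[OF k(1), of "deg d"] by (auto simp: f_def)
  ultimately have "f \<in> coeffs" by (auto simp: coeffs_def)
  have "r \<gamma> \<ominus> hpart f \<gamma> \<in> Fm \<gamma>" for \<gamma>
  proof -
    have eq: "(\<lambda>d. if deg d = \<gamma> then f d else \<zero>) = (\<lambda>d. if deg d = \<gamma> then k \<gamma> d else \<zero>)"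
      by (auto simp: f_def)
    have "r \<gamma> \<ominus> hpart f \<gamma> = lc (\<lambda>d. k \<gamma> d \<ominus> (if deg d = \<gamma> then k \<gamma> d else \<zero>))"
      using lc_minus[OF k(1) coeffs_restrict[OF k(1)]] k(3) by (simp add: hpart_def eq)
    also have "\<dots> \<in> Fm \<gamma>"
      unfolding Fm_span
    proof (rule lc_in_span)
      show "{d. k \<gamma> d \<ominus> (if deg d = \<gamma> then k \<gamma> d else \<zero>) \<noteq> \<zero>} \<subseteq> {d \<in> E. lt (deg d) \<gamma>}"
        using k(2)[of \<gamma>] coeffsD(2)[OF k(1)[of \<gamma>]] by (auto simp: lt_def a_minus_def r_neg)
    qed (intro coeffs_minus coeffs_restrict k, auto)
    finally show ?thesis .
  qed
  then have "fam r = fam (hpart f)"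
    using fam_eq_iff[OF r(1) hpart_Fams[OF \<open>f \<in> coeffs\<close>]] by simp
  then show ?thesis using r \<open>f \<in> coeffs\<close> by auto
qed

lemma coeff_ring_iso: "(\<lambda>f. fam (hpart f)) \<in> ring_iso C G"
proof (rule ring_iso_memI)
  have C: "carrier C = coeffs" "x \<oplus>\<^bsub>C\<^esub> y = (\<lambda>e. x e \<oplus> y e)" for x y
    by (auto simp: coeff_ring_def)
  show "fam (hpart f) \<in> carrier G" if "f \<in> carrier C" for f
    using that fam_in_graded hpart_Fams by (simp add: C)
  show "fam (hpart (f \<otimes>\<^bsub>C\<^esub> g)) = fam (hpart f) \<otimes>\<^bsub>G\<^esub> fam (hpart g)"
    if "f \<in> carrier C" "g \<in> carrier C" for f g
    using coeff_mult that by (simp add: C)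
  show "fam (hpart (f \<oplus>\<^bsub>C\<^esub> g)) = fam (hpart f) \<oplus>\<^bsub>G\<^esub> fam (hpart g)"
    if "f \<in> carrier C" "g \<in> carrier C" for f g
    using that by (simp add: C hpart_add fam_add hpart_Fams)
  have "hpart \<one>\<^bsub>C\<^esub> = (\<lambda>\<gamma>. if \<gamma> = 0 then \<one> else \<zero>)"
  proof
    fix \<gamma>
    have "(\<lambda>d. if deg d = \<gamma> then \<one>\<^bsub>C\<^esub> d else \<zero>) =
        (if \<gamma> = 0 then \<lambda>d. if d = 0 then \<one> else \<zero> else (\<lambda>d. \<zero>))"
      using deg_zero by (auto simp: coeff_ring_def fun_eq_iff)
    then show "hpart \<one>\<^bsub>C\<^esub> \<gamma> = (if \<gamma> = 0 then \<one> else \<zero>)"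
      using lc_single(2)[OF F_one E_zero] coeffs_zero B_zero by (simp add: hpart_def)
  qed
  then show "fam (hpart \<one>\<^bsub>C\<^esub>) = \<one>\<^bsub>G\<^esub>" by (simp add: fam_one)
  show "bij_betw (\<lambda>f. fam (hpart f)) (carrier C) (carrier G)"
    unfolding C bij_betw_def
    using hpart_inj hpart_surj fam_in_graded hpart_Fams by (auto simp: inj_on_def image_iff)
qed

end

text \<open>\<open>C\<close> need not be known to be a ring. Closure of its operations is enough to
  verify directly that \<open>\<psi>\<close> after the inverse of \<open>\<phi>\<close> is an
  isomorphism.\<close>

lemma ring_iso_quotient:
  assumes "\<phi> \<in> ring_iso C S" "\<psi> \<in> ring_iso C T"
    and closed: "\<And>f g. f \<in> carrier C \<Longrightarrow> g \<in> carrier C \<Longrightarrow> f \<otimes>\<^bsub>C\<^esub> g \<in> carrier C"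
      "\<And>f g. f \<in> carrier C \<Longrightarrow> g \<in> carrier C \<Longrightarrow> f \<oplus>\<^bsub>C\<^esub> g \<in> carrier C" "\<one>\<^bsub>C\<^esub> \<in> carrier C"
  shows "S \<simeq> T"
proof -
  note a = ring_iso_memE[OF assms(1)] and b = ring_iso_memE[OF assms(2)]
  define \<theta> where "\<theta> = the_inv_into (carrier C) \<phi>"
  have inj: "inj_on \<phi> (carrier C)" and im: "\<phi> ` carrier C = carrier S"
    using a(5) by (auto simp: bij_betw_def)
  have \<theta>: "\<theta> (\<phi> f) = f" if "f \<in> carrier C" for f
    using inj that by (simp add: \<theta>_def the_inv_into_f_f)
  have "\<psi> \<circ> \<theta> \<in> ring_iso S T"
  proof (rule ring_iso_memI)
    show "bij_betw (\<psi> \<circ> \<theta>) (carrier S) (carrier T)"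
      unfolding \<theta>_def using a(5) b(5) by (rule bij_betw_trans[OF bij_betw_the_inv_into])
    show "(\<psi> \<circ> \<theta>) \<one>\<^bsub>S\<^esub> = \<one>\<^bsub>T\<^esub>"
      using a(4) b(4) \<theta>[OF closed(3)] by simp
    fix x assume "x \<in> carrier S"
    then obtain f where f: "x = \<phi> f" "f \<in> carrier C" using im by auto
    then show "(\<psi> \<circ> \<theta>) x \<in> carrier T" using \<theta> b(1) by simp
    fix y assume "y \<in> carrier S"
    then obtain g where g: "y = \<phi> g" "g \<in> carrier C" using im by auto
    have "x \<otimes>\<^bsub>S\<^esub> y = \<phi> (f \<otimes>\<^bsub>C\<^esub> g)" "x \<oplus>\<^bsub>S\<^esub> y = \<phi> (f \<oplus>\<^bsub>C\<^esub> g)"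
      using a f g by auto
    then show "(\<psi> \<circ> \<theta>) (x \<otimes>\<^bsub>S\<^esub> y) = (\<psi> \<circ> \<theta>) x \<otimes>\<^bsub>T\<^esub> (\<psi> \<circ> \<theta>) y"
      "(\<psi> \<circ> \<theta>) (x \<oplus>\<^bsub>S\<^esub> y) = (\<psi> \<circ> \<theta>) x \<oplus>\<^bsub>T\<^esub> (\<psi> \<circ> \<theta>) y"
      using f g \<theta> closed b by auto
  qed
  then show ?thesis by (auto simp: is_ring_iso_def)
qed

section \<open>Ordered monomials and iterated Ore extensions\<close>

definition list_prod :: "('a, 'm) monoid_scheme \<Rightarrow> ('j \<Rightarrow> 'a) \<Rightarrow> 'j list \<Rightarrow> 'a" where
  "list_prod T y xs = foldr (\<lambda>i r. y i \<otimes>\<^bsub>T\<^esub> r) xs \<one>\<^bsub>T\<^esub>"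

text \<open>The exponent vector of an ordered monomial is encoded as a multiset of indices.\<close>

definition monomial :: "('a, 'm) monoid_scheme \<Rightarrow> ('j::linorder \<Rightarrow> 'a) \<Rightarrow> 'j multiset \<Rightarrow> 'a" where
  "monomial T y d = list_prod T y (sorted_list_of_multiset d)"

definition exponents :: "nat \<Rightarrow> nat multiset set" where
  "exponents j = {d. set_mset d \<subseteq> {1..j}}"

lemma exponents_simps [simp]:
  "{#} \<in> exponents j" "a + b \<in> exponents j \<longleftrightarrow> a \<in> exponents j \<and> b \<in> exponents j"
  "add_mset i a \<in> exponents j \<longleftrightarrow> i \<in> {1..j} \<and> a \<in> exponents j"
  by (auto simp: exponents_def)

lemma exponents_mono: "i \<le> j \<Longrightarrow> exponents i \<subseteq> exponents j"
  by (auto simp: exponents_def)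

section \<open>Ordered products of generators in a monoid\<close>

context monoid
begin

lemma list_prod_closed: "(\<And>i. i \<in> set xs \<Longrightarrow> y i \<in> carrier G) \<Longrightarrow> list_prod G y xs \<in> carrier G"
  by (induction xs) (auto simp: list_prod_def)

lemma list_prod_append:
  "(\<And>i. i \<in> set xs \<union> set ys \<Longrightarrow> y i \<in> carrier G) \<Longrightarrow>
    list_prod G y (xs @ ys) = list_prod G y xs \<otimes> list_prod G y ys"
proof (induction xs)
  case Nil
  then show ?case using list_prod_closed[of ys y] by (simp add: list_prod_def)
next
  case (Cons x xs)
  then have "list_prod G y xs \<in> carrier G" "list_prod G y ys \<in> carrier G" "y x \<in> carrier G"
    by (auto intro!: list_prod_closed)
  with Cons show ?case by (simp add: list_prod_def m_assoc)
qed

lemma monomial_closed: "(\<And>i. i \<in># d \<Longrightarrow> y i \<in> carrier G) \<Longrightarrow> monomial G y d \<in> carrier G"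
  unfolding monomial_def by (rule list_prod_closed) auto

lemma monomial_empty: "monomial G y {#} = \<one>"
  by (simp add: monomial_def list_prod_def)

lemma monomial_single: "y i \<in> carrier G \<Longrightarrow> monomial G y {#i#} = y i"
  by (simp add: monomial_def list_prod_def)

lemma monomial_Cons:
  assumes "\<And>k. k \<in># d \<Longrightarrow> i \<le> k"
  shows "monomial G y (add_mset i d) = y i \<otimes> monomial G y d"
proof -
  have "sorted_list_of_multiset (add_mset i d) = i # sorted_list_of_multiset d"
    using assms by (simp add: insort_is_Cons)
  then show ?thesis by (simp add: monomial_def list_prod_def)
qed

lemma monomial_snoc:
  assumes "\<And>i. i \<in># d \<Longrightarrow> y i \<in> carrier G" "y k \<in> carrier G" "\<And>i. i \<in># d \<Longrightarrow> i \<le> k"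
  shows "monomial G y (add_mset k d) = monomial G y d \<otimes> y k"
proof -
  have "sorted (sorted_list_of_multiset d @ [k])"
    using assms(3) by (auto simp: sorted_append)
  then have "sorted_list_of_multiset (add_mset k d) = sorted_list_of_multiset d @ [k]"
    using sorted_list_of_multiset_mset[of "sorted_list_of_multiset d @ [k]"]
    by (simp add: sorted_sort_id del: sorted_list_of_multiset_insert sorted_list_of_multiset_mset)
  moreover have "list_prod G y (sorted_list_of_multiset d @ [k]) =
      list_prod G y (sorted_list_of_multiset d) \<otimes> list_prod G y [k]"
    using assms by (intro list_prod_append) auto
  moreover have "list_prod G y [k] = y k" using assms(2) by (simp add: list_prod_def)
  ultimately show ?thesis by (simp only: monomial_def)
qed

lemma monomial_replicate:
  assumes "\<And>i. i \<in># d \<Longrightarrow> y i \<in> carrier G" "y k \<in> carrier G" "\<And>i. i \<in># d \<Longrightarrow> i \<le> k"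
  shows "monomial G y (d + replicate_mset n k) = monomial G y d \<otimes> y k [^] n"
proof (induction n)
  case 0
  then show ?case using monomial_closed[of d y] assms(1) by simp
next
  case (Suc n)
  have "monomial G y (d + replicate_mset (Suc n) k) = monomial G y (d + replicate_mset n k) \<otimes> y k"
  proof -
    have "monomial G y (add_mset k (d + replicate_mset n k)) = monomial G y (d + replicate_mset n k) \<otimes> y k"
      by (rule monomial_snoc) (use assms in \<open>auto split: if_splits\<close>)
    then show ?thesis by simp
  qed
  then show ?case
    using Suc monomial_closed[of d y] assms by (simp add: m_assoc)
qed

end

lemma (in left_family) span_mult_right:
  assumes "v \<in> span D" "D \<subseteq> E" "D' \<subseteq> E" "p \<in> carrier T" "\<And>d. d \<in> D \<Longrightarrow> B d \<otimes> p \<in> span D'"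
  shows "v \<otimes> p \<in> span D'"
  using assms(1)
proof (induction rule: lspan_induct)
  case zero
  then show ?case using assms by (simp add: lspan_zero)
next
  case (add a d v)
  then have "(a \<otimes> B d \<oplus> v) \<otimes> p = a \<otimes> (B d \<otimes> p) \<oplus> v \<otimes> p"
    using assms span_closed[OF add(3)] L_carrier B_closed by (simp add: l_distr m_assoc subset_iff)
  then show ?case using add assms by (simp add: span_add span_scale)
qed

lemma (in ring) finsum_subring:
  assumes "subring H R" "f \<in> A \<rightarrow> H"
  shows "finsum (R\<lparr>carrier := H\<rparr>) f A = finsum R f A"
proof -
  interpret H: ring "R\<lparr>carrier := H\<rparr>" using subring_is_ring[OF assms(1)] .
  have sub: "H \<subseteq> carrier R" using subringE(1)[OF assms(1)] .
  show ?thesis using assms(2)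
  proof (induction A rule: infinite_finite_induct)
    case (insert x A)
    then have "f \<in> A \<rightarrow> H" "f x \<in> H" "f \<in> A \<rightarrow> carrier R" "f x \<in> carrier R" using sub by auto
    then show ?case using insert H.finsum_insert[of A x f] by simp
  qed (simp_all add: finsum_infinite H.finsum_infinite)
qed

section \<open>The monomial basis of an iterated Ore extension\<close>

locale ore_tower = ring T for T (structure) +
  fixes L :: "'a set" and s :: nat and y :: "nat \<Rightarrow> 'a" and \<sigma> :: "nat \<Rightarrow> 'a \<Rightarrow> 'a" and S :: "nat \<Rightarrow> 'a set"
  assumes S_0: "S 0 = L" and S_s: "S s = carrier T"
    and ext: "j \<in> {1..s} \<Longrightarrow> ore_extension (T\<lparr>carrier := S j\<rparr>) (S (j - 1)) (y j) (\<sigma> j)"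
begin

text \<open>The induction runs downwards from \<open>S s = carrier T\<close>, because an Ore
  extension only relates a stage to the next larger one.\<close>

lemma S_subring: "j \<le> s \<Longrightarrow> subring (S j) T"
proof (induction rule: inc_induct)
  case base
  then show ?case using S_s carrier_is_subring by simp
next
  case (step j)
  have e: "ring (T\<lparr>carrier := S (Suc j)\<rparr>)" "subring (S j) (T\<lparr>carrier := S (Suc j)\<rparr>)"
    using ext[of "Suc j"] step by (auto simp: ore_extension_def)
  then have "S j \<subseteq> carrier T"
    using subringE(1)[OF e(2)] subringE(1)[OF step.IH] by simp
  moreover have "ring (T\<lparr>carrier := S j\<rparr>)"
    using ring.subring_is_ring[OF e] by simp
  ultimately show ?case by (rule ring_incl_imp_subring)
qed

lemma S_carrier: "j \<le> s \<Longrightarrow> x \<in> S j \<Longrightarrow> x \<in> carrier T"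
  using subringE(1)[OF S_subring] by auto

lemma S_Suc: "Suc j \<le> s \<Longrightarrow> S j \<subseteq> S (Suc j)"
  using ext[of "Suc j"] subringE(1)[of "S j" "T\<lparr>carrier := S (Suc j)\<rparr>"]
  by (auto simp: ore_extension_def)

lemma S_mono: "i \<le> j \<Longrightarrow> j \<le> s \<Longrightarrow> S i \<subseteq> S j"
proof (induction rule: dec_induct)
  case (step j)
  then show ?case using S_Suc[of j] by auto
qed simp

lemma y_in_S: "1 \<le> i \<Longrightarrow> i \<le> j \<Longrightarrow> j \<le> s \<Longrightarrow> y i \<in> S j"
  using ext[of i] S_mono[of i j] by (auto simp: ore_extension_def)

lemma y_carrier: "1 \<le> i \<Longrightarrow> i \<le> s \<Longrightarrow> y i \<in> carrier T"
  using y_in_S[of i s] S_s by simp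

text \<open>The unique expansion is given inside the ring with carrier \<open>S (Suc j)\<close>. Its
  sums, products and powers agree with those of \<open>T\<close> because this carrier is a
  subring.\<close>

lemma S_basis:
  assumes "Suc j \<le> s" "t \<in> S (Suc j)"
  shows "\<exists>!c. range c \<subseteq> S j \<and> finite {k. c k \<noteq> \<zero>} \<and>
    t = (\<Oplus>k\<in>{k. c k \<noteq> \<zero>}. c k \<otimes> (y (Suc j) [^] (k::nat)))"
proof -
  let ?T = "T\<lparr>carrier := S (Suc j)\<rparr>"
  have sub: "subring (S (Suc j)) T" using S_subring assms by blast
  have yS: "y (Suc j) [^] k \<in> S (Suc j)" for k :: nat
    using subringE(3,6)[OF sub] y_in_S[of "Suc j" "Suc j"] assms by (induction k) auto
  have "finsum ?T (\<lambda>k. c k \<otimes>\<^bsub>?T\<^esub> (y (Suc j) [^]\<^bsub>?T\<^esub> k)) {k. c k \<noteq> \<zero>\<^bsub>?T\<^esub>} =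
    (\<Oplus>k\<in>{k. c k \<noteq> \<zero>}. c k \<otimes> (y (Suc j) [^] (k::nat)))" if "range c \<subseteq> S j" for c
  proof -
    have "c k \<otimes> (y (Suc j) [^] k) \<in> S (Suc j)" for k
      using that S_Suc[OF assms(1)] yS by (intro subringE(6)[OF sub]) auto
    then have "finsum ?T (\<lambda>k. c k \<otimes> (y (Suc j) [^] k)) {k. c k \<noteq> \<zero>} =
        (\<Oplus>k\<in>{k. c k \<noteq> \<zero>}. c k \<otimes> (y (Suc j) [^] (k::nat)))"
      by (intro finsum_subring[OF sub]) auto
    then show ?thesis by (simp add: nat_pow_consistent[symmetric])
  qed
  then have eq: "(range c \<subseteq> S j \<and> finite {k. c k \<noteq> \<zero>\<^bsub>?T\<^esub>} \<and>
      t = finsum ?T (\<lambda>k. c k \<otimes>\<^bsub>?T\<^esub> (y (Suc j) [^]\<^bsub>?T\<^esub> k)) {k. c k \<noteq> \<zero>\<^bsub>?T\<^esub>}) \<longleftrightarrow>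
    (range c \<subseteq> S j \<and> finite {k. c k \<noteq> \<zero>} \<and>
      t = (\<Oplus>k\<in>{k. c k \<noteq> \<zero>}. c k \<otimes> (y (Suc j) [^] (k::nat))))" for c
    by auto
  have "\<exists>!c. range c \<subseteq> S j \<and> finite {k::nat. c k \<noteq> \<zero>\<^bsub>?T\<^esub>} \<and>
      t = finsum ?T (\<lambda>k. c k \<otimes>\<^bsub>?T\<^esub> (y (Suc j) [^]\<^bsub>?T\<^esub> k)) {k. c k \<noteq> \<zero>\<^bsub>?T\<^esub>}"
  proof -
    have "ore_extension ?T (S j) (y (Suc j)) (\<sigma> (Suc j))"
      using ext[of "Suc j"] assms(1) by simp
    note all = this[unfolded ore_extension_def, THEN conjunct2, THEN conjunct2, THEN conjunct2,
        THEN conjunct2, THEN conjunct2]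
    show ?thesis using bspec[OF all, of t] assms(2) by simp
  qed
  then show ?thesis unfolding eq .
qed

abbreviation Y :: "nat multiset \<Rightarrow> 'a" where "Y \<equiv> monomial T y"

sublocale left_family T L Y "exponents s"
proof (intro left_family.intro left_family_axioms.intro ring_axioms)
  show "subring L T" using S_subring[of 0] S_0 by simp
  show "Y d \<in> carrier T" if "d \<in> exponents s" for d
    using that by (intro monomial_closed y_carrier) (auto simp: exponents_def)
qed

lemma exponents_sub: "j \<le> s \<Longrightarrow> exponents j \<subseteq> exponents s"
  by (rule exponents_mono)

lemma Y_replicate:
  assumes "Suc j \<le> s" "d \<in> exponents j"
  shows "Y (d + replicate_mset k (Suc j)) = Y d \<otimes> y (Suc j) [^] k"
  using assms by (intro monomial_replicate y_carrier) (auto simp: exponents_def subset_iff)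

text \<open>Expand in powers of the newest generator and expand the coefficients by induction. Right
  multiplication of an ordered monomial in the earlier generators by such a power is again an
  ordered monomial.\<close>

lemma S_span: "j \<le> s \<Longrightarrow> S j \<subseteq> span (exponents j)"
proof (induction j)
  case 0
  show ?case
  proof
    fix t assume "t \<in> S 0"
    then have "t \<otimes> Y {#} \<in> span (exponents 0)"
      using S_0 by (intro span_gen exponents_mono) auto
    then show "t \<in> span (exponents 0)"
      using \<open>t \<in> S 0\<close> S_carrier[of 0] by (simp add: monomial_empty)
  qed
next
  case (Suc j)
  show ?case
  proof
    fix t assume "t \<in> S (Suc j)"
    then obtain c where c: "range c \<subseteq> S j" "t = (\<Oplus>k\<in>{k. c k \<noteq> \<zero>}. c k \<otimes> (y (Suc j) [^] (k::nat)))"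
      using S_basis[OF Suc.prems] by blast
    have yc: "y (Suc j) [^] (k::nat) \<in> carrier T" for k
      using y_in_S[of "Suc j" s] S_s Suc.prems by simp
    have "c k \<otimes> (y (Suc j) [^] k) \<in> span (exponents (Suc j))" for k
    proof (rule span_mult_right)
      show "c k \<in> span (exponents j)" using c Suc by auto
      show "Y d \<otimes> (y (Suc j) [^] k) \<in> span (exponents (Suc j))" if "d \<in> exponents j" for d
      proof -
        have "d + replicate_mset k (Suc j) \<in> exponents (Suc j)"
          using that by (auto simp: exponents_def)
        then show ?thesis
          using span_base[OF exponents_sub[OF Suc.prems]] Y_replicate[OF Suc.prems that] by metis
      qed
    qed (use Suc.prems yc in \<open>auto intro!: exponents_mono\<close>)
    then show "t \<in> span (exponents (Suc j))"
      unfolding c(2) by (intro span_finsum exponents_mono Suc.prems) auto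
  qed
qed

lemma span_S: "j \<le> s \<Longrightarrow> span (exponents j) \<subseteq> S j"
proof
  fix v assume j: "j \<le> s" and v: "v \<in> span (exponents j)"
  note sub = subringE[OF S_subring[OF j]]
  have prod: "list_prod T y xs \<in> S j" if "set xs \<subseteq> {1..j}" for xs
    using that by (induction xs) (auto simp: list_prod_def intro!: sub y_in_S j)
  show "v \<in> S j"
  proof (rule span_least[OF v])
    fix a d assume "a \<in> L" "d \<in> exponents j"
    then show "a \<otimes> Y d \<in> S j"
      using S_mono[of 0 j] S_0 j prod[of "sorted_list_of_multiset d"]
      by (auto simp: monomial_def exponents_def intro!: sub)
  qed (auto intro: sub)
qed

text \<open>Terms are grouped by the multiplicity \<open>k\<close> of the newest index
  \<open>Suc j\<close>. The group for \<open>k\<close> equals \<open>lc (g k)\<close> times the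
  \<open>k\<close>-th power of the generator, with \<open>lc (g k)\<close> in \<open>S j\<close>.
  Uniqueness of the expansion of zero kills every \<open>lc (g k)\<close>, and the induction
  hypothesis kills \<open>g k\<close>.\<close>

lemma S_free:
  assumes "j \<le> s" "f \<in> coeffs" "{d. f d \<noteq> \<zero>} \<subseteq> exponents j" "lc f = \<zero>"
  shows "f = (\<lambda>_. \<zero>)"
  using assms
proof (induction j arbitrary: f)
  case 0
  then have sub: "{d. f d \<noteq> \<zero>} \<subseteq> {{#}}" by (auto simp: exponents_def)
  have "f {#} = lc f"
    using lc_eq[OF 0(2) _ _ sub] coeffsD(2)[OF 0(2)] by (simp add: monomial_empty)
  then show ?case using sub 0(4) by (auto simp: fun_eq_iff)
next
  case (Suc j)
  define e where "e k d = d + replicate_mset k (Suc j)" for k and d :: "nat multiset"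
  define g where "g k d = (if d \<in> exponents j then f (e k d) else \<zero>)" for k d
  have inj: "inj (e k)" for k by (auto simp: inj_def e_def)
  have jE: "exponents j \<subseteq> exponents s" using Suc.prems(1) by (intro exponents_mono) simp
  have g: "g k \<in> coeffs" "{d. g k d \<noteq> \<zero>} \<subseteq> exponents j" for k
  proof -
    have "{d. g k d \<noteq> \<zero>} \<subseteq> e k -` {d. f d \<noteq> \<zero>}" by (auto simp: g_def)
    then have "finite {d. g k d \<noteq> \<zero>}"
      using finite_vimageI[OF coeffsD(3)[OF Suc.prems(2)] inj] finite_subset by blast
    moreover show "{d. g k d \<noteq> \<zero>} \<subseteq> exponents j" by (auto simp: g_def)
    ultimately show "g k \<in> coeffs"
      using coeffsD(1)[OF Suc.prems(2)] L_zero jE by (auto simp: coeffs_def g_def)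
  qed
  let ?A = "{d. f d \<noteq> \<zero>}"
  have A: "finite ?A" "?A \<subseteq> exponents s" using coeffsD[OF Suc.prems(2)] by auto
  define K where "K = (\<lambda>d. count d (Suc j)) ` ?A"
  have finK: "finite K" using A by (simp add: K_def)
  have yc: "y (Suc j) [^] (k::nat) \<in> carrier T" for k
    using y_in_S[of "Suc j" s] S_s Suc.prems by simp
  have img: "{d \<in> ?A. count d (Suc j) = k} = e k ` {d. g k d \<noteq> \<zero>}" for k
  proof (intro equalityI subsetI)
    fix d assume d: "d \<in> {d \<in> ?A. count d (Suc j) = k}"
    define d' where "d' = filter_mset (\<lambda>i. i \<noteq> Suc j) d"
    have "d = e k d'"
      using d by (auto simp: e_def d'_def multiset_eq_iff)
    moreover have "d' \<in> exponents j"
      using d Suc.prems(3) by (force simp: d'_def exponents_def)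
    ultimately show "d \<in> e k ` {d. g k d \<noteq> \<zero>}"
      using d by (auto simp: g_def)
  next
    fix d assume "d \<in> e k ` {d. g k d \<noteq> \<zero>}"
    then show "d \<in> {d \<in> ?A. count d (Suc j) = k}"
      by (auto simp: g_def e_def exponents_def count_eq_zero_iff split: if_splits)
  qed
  have fibre: "(\<Oplus>d\<in>{d \<in> ?A. count d (Suc j) = k}. f d \<otimes> Y d) = lc (g k) \<otimes> y (Suc j) [^] k" for k
  proof -
    have gE: "g k d \<otimes> Y d \<in> carrier T" "e k d \<in> exponents s" "d \<in> exponents j" "f (e k d) = g k d"
      if "g k d \<noteq> \<zero>" for d
    proof -
      show d: "d \<in> exponents j" "f (e k d) = g k d" using that by (auto simp: g_def split: if_splits)
      then show "e k d \<in> exponents s" using that A by auto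
      show "g k d \<otimes> Y d \<in> carrier T" using coeffsD(2)[OF g(1)] B_closed d jE by auto
    qed
    have "(\<Oplus>d\<in>e k ` {d. g k d \<noteq> \<zero>}. f d \<otimes> Y d) = (\<Oplus>d\<in>{d. g k d \<noteq> \<zero>}. f (e k d) \<otimes> Y (e k d))"
      using gE B_closed[OF gE(2)] coeffsD(2)[OF g(1)] inj_on_subset[OF inj]
      by (intro finsum_reindex) auto
    also have "\<dots> = (\<Oplus>d\<in>{d. g k d \<noteq> \<zero>}. (g k d \<otimes> Y d) \<otimes> y (Suc j) [^] k)"
    proof (intro finsum_cong' refl)
      fix d assume d: "d \<in> {d. g k d \<noteq> \<zero>}"
      then show "f (e k d) \<otimes> Y (e k d) = (g k d \<otimes> Y d) \<otimes> y (Suc j) [^] k"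
        using Y_replicate[OF Suc.prems(1), of d k] gE[of d] coeffsD(2)[OF g(1), of k d] B_closed[of d] jE yc
        by (auto simp: e_def m_assoc)
    qed (use gE yc in auto)
    also have "\<dots> = lc (g k) \<otimes> y (Suc j) [^] k"
      unfolding lc_def using gE yc coeffsD(3)[OF g(1)] by (intro finsum_ldistr[symmetric]) auto
    finally show ?thesis unfolding img .
  qed
  have sumK: "(\<Oplus>k\<in>K. lc (g k) \<otimes> y (Suc j) [^] k) = lc f"
    unfolding lc_def[of f] fibre[symmetric]
    using A finK coeffsD(2)[OF Suc.prems(2)] B_closed by (intro finsum_fibres) (auto simp: K_def)
  have outK: "lc (g k) = \<zero>" if "k \<notin> K" for k
  proof -
    have "{d. g k d \<noteq> \<zero>} = {}" using img[of k] that by (auto simp: K_def)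
    then have "g k = (\<lambda>_. \<zero>)" by auto
    then show ?thesis by (simp add: coeffs_zero)
  qed
  have sum: "(\<Oplus>k\<in>{k. lc (g k) \<noteq> \<zero>}. lc (g k) \<otimes> y (Suc j) [^] k) = lc f"
    unfolding sumK[symmetric]
    using outK finK lc_closed[OF g(1)] yc by (intro add.finprod_mono_neutral_cong_left) auto
  have rng: "range (\<lambda>k. lc (g k)) \<subseteq> S j"
    using lc_in_span[OF g jE] span_S[of j] Suc.prems(1) by auto
  have fin: "finite {k. lc (g k) \<noteq> \<zero>}"
    using outK by (intro finite_subset[OF _ finK]) auto
  let ?Q = "\<lambda>c. range c \<subseteq> S j \<and> finite {k. c k \<noteq> \<zero>} \<and>
    \<zero> = (\<Oplus>k\<in>{k. c k \<noteq> \<zero>}. c k \<otimes> (y (Suc j) [^] (k::nat)))"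
  have Q: "?Q (\<lambda>k. lc (g k))" using rng fin sum outK Suc.prems(4) by simp
  have Q0: "?Q (\<lambda>_. \<zero>)" using subringE(2)[OF S_subring[of j]] Suc.prems(1) by auto
  obtain c0 where c0: "\<forall>c. ?Q c \<longrightarrow> c = c0"
    using S_basis[OF Suc.prems(1) subringE(2)[OF S_subring[OF Suc.prems(1)]]]
    by (elim ex1E) (rule that)
  have "(\<lambda>k. lc (g k)) = (\<lambda>_. \<zero>)"
    using c0[rule_format, OF Q] c0[rule_format, OF Q0] by (rule trans[OF _ sym])
  then have "g k = (\<lambda>_. \<zero>)" for k
    using Suc.IH[OF _ g(1,2), of k] Suc.prems(1) by (auto simp: fun_eq_iff)
  then have "{d \<in> ?A. count d (Suc j) = k} = {}" for k
    unfolding img by auto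
  then show ?case by (auto simp: fun_eq_iff)
qed

text \<open>The twisted scalar is only known to be a combination of monomials in the earlier
  generators. That a scalar suffices is a matter of degrees and is settled in
  \<open>commute_scalar\<close>.\<close>

lemma y_commute:
  assumes "j \<in> {1..s}" "a \<in> L"
  shows "\<exists>t\<in>span (exponents (j - 1)). y j \<otimes> a = t \<otimes> y j"
proof -
  have "j - 1 \<le> s" using assms by auto
  then have a: "a \<in> S (j - 1)" using S_mono[of 0 "j - 1"] assms S_0 by auto
  from a have "\<sigma> j a \<in> S (j - 1)" "y j \<otimes> a = \<sigma> j a \<otimes> y j"
    using ext[OF assms(1)] by (auto simp: ore_extension_def ring_hom_def)
  then show ?thesis using S_span[OF \<open>j - 1 \<le> s\<close>] by auto
qed

end

section \<open>Rewriting products of monomials\<close>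

locale lifted_generators = ring_filtration R lteq F
  for R :: "('a, 'm) ring_scheme" (structure)
    and lteq :: "'i::cancel_comm_monoid_add \<Rightarrow> 'i \<Rightarrow> bool" and F +
  fixes s :: nat and x :: "nat \<Rightarrow> 'a" and \<gamma> :: "nat \<Rightarrow> 'i"
  assumes x_in_F: "j \<in> {1..s} \<Longrightarrow> x j \<in> F (\<gamma> j)"
begin

abbreviation B :: "nat multiset \<Rightarrow> 'a" where "B \<equiv> monomial R x"
abbreviation E :: "nat multiset set" where "E \<equiv> exponents s"
definition deg :: "nat multiset \<Rightarrow> 'i" where "deg d = (\<Sum>i\<in>#d. \<gamma> i)"

lemma deg_simps [simp]:
  "deg {#} = 0" "deg (add_mset i d) = \<gamma> i + deg d" "deg (a + b) = deg a + deg b"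
  by (simp_all add: deg_def)

lemma x_carrier: "j \<in> {1..s} \<Longrightarrow> x j \<in> carrier R"
  using x_in_F F_carrier by blast

sublocale left_family R "F 0" B E
proof (intro left_family.intro left_family_axioms.intro ring_axioms F0_subring)
  show "B d \<in> carrier R" if "d \<in> E" for d
    using that x_carrier by (intro monomial_closed) (auto simp: exponents_def)
qed

lemma B_empty: "B {#} = \<one>"
  by (rule monomial_empty)

lemma B_single: "j \<in> {1..s} \<Longrightarrow> B {#j#} = x j"
  by (intro monomial_single x_carrier)

lemma B_in_F: "d \<in> E \<Longrightarrow> B d \<in> F (deg d)"
proof (induction d rule: multiset_induct_min)
  case empty
  then show ?case by (simp add: B_empty F_one)
next
  case (add i d)
  then have "B (add_mset i d) = x i \<otimes> B d" by (intro monomial_Cons) auto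
  then show ?case using add x_in_F[of i] F_mult by simp
qed

lemma B_Cons: "\<lbrakk>\<And>k. k \<in># d \<Longrightarrow> i \<le> k\<rbrakk> \<Longrightarrow> B (add_mset i d) = x i \<otimes> B d"
  by (rule monomial_Cons)

end

locale weighted_generators = lifted_generators +
  fixes w :: "nat \<Rightarrow> nat"
begin

definition wt :: "nat multiset \<Rightarrow> nat" where "wt d = (\<Sum>i\<in>#d. w i)"

lemma wt_simps [simp]:
  "wt {#} = 0" "wt (add_mset i d) = w i + wt d" "wt (a + b) = wt a + wt b"
  by (simp_all add: wt_def)

text \<open>Both strict inequalities survive adding a fixed exponent to \<open>d\<close> and
  \<open>e\<close>, so errors of this kind can be multiplied by monomials on either side once those
  products can be rewritten.\<close>

definition W :: "nat multiset \<Rightarrow> 'a set" where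
  "W e = span {d \<in> E. lt (deg d) (deg e) \<and> wt d < wt e}"

text \<open>The coefficient may be zero, so this is an upper bound on \<open>v\<close> and does not
  assert that \<open>B e\<close> really occurs.\<close>

definition lead :: "'a \<Rightarrow> nat multiset \<Rightarrow> bool" where
  "lead v e \<longleftrightarrow> (\<exists>c\<in>F 0. \<exists>u\<in>W e. v = c \<otimes> B e \<oplus> u)"

lemma leadI: "c \<in> F 0 \<Longrightarrow> u \<in> W e \<Longrightarrow> lead (c \<otimes> B e \<oplus> u) e"
  by (auto simp: lead_def)

lemma W_carrier: "u \<in> W e \<Longrightarrow> u \<in> carrier R"
  unfolding W_def by (rule span_closed) auto

lemma W_zero: "\<zero> \<in> W e"
  unfolding W_def by (rule lspan_zero)

lemma W_add: "u \<in> W e \<Longrightarrow> v \<in> W e \<Longrightarrow> u \<oplus> v \<in> W e"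
  unfolding W_def by (rule span_add) auto

lemma W_scale: "a \<in> F 0 \<Longrightarrow> v \<in> W e \<Longrightarrow> a \<otimes> v \<in> W e"
  unfolding W_def by (rule span_scale) auto

lemma lead_add:
  assumes "e \<in> E" "lead v e" "u \<in> W e"
  shows "lead (v \<oplus> u) e"
proof -
  obtain c u' where c: "c \<in> F 0" "u' \<in> W e" "v = c \<otimes> B e \<oplus> u'" using assms by (auto simp: lead_def)
  moreover from this have "v \<oplus> u = c \<otimes> B e \<oplus> (u' \<oplus> u)"
    using assms by (simp add: a_assoc L_carrier B_closed W_carrier)
  ultimately show ?thesis using leadI[OF c(1) W_add[OF c(2) assms(3)]] by simp
qed

lemma lead_scale:
  assumes "e \<in> E" "lead v e" "a \<in> F 0"
  shows "lead (a \<otimes> v) e"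
proof -
  obtain c u where c: "c \<in> F 0" "u \<in> W e" "v = c \<otimes> B e \<oplus> u" using assms by (auto simp: lead_def)
  then have "a \<otimes> v = (a \<otimes> c) \<otimes> B e \<oplus> a \<otimes> u"
    using assms by (simp add: r_distr m_assoc L_carrier B_closed W_carrier)
  then show ?thesis using leadI[OF L_rules(6)[OF assms(3) c(1)] W_scale[OF assms(3) c(2)]] by simp
qed

lemma lead_B: "e \<in> E \<Longrightarrow> a \<in> F 0 \<Longrightarrow> lead (a \<otimes> B e) e"
  unfolding lead_def using W_zero[of e] L_carrier B_closed by (intro bexI[of _ a] bexI[of _ \<zero>]) auto

lemma lead_in_W:
  assumes "lead v d" "d \<in> E" "lt (deg d) (deg e)" "wt d < wt e"
  shows "v \<in> W e"
proof -
  obtain c u where c: "c \<in> F 0" "u \<in> W d" "v = c \<otimes> B d \<oplus> u" using assms by (auto simp: lead_def)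
  have "c \<otimes> B d \<in> W e"
    unfolding W_def using assms c by (intro span_gen) auto
  moreover have "W d \<subseteq> W e"
    unfolding W_def using assms ord.less_trans by (intro lspan_mono) auto
  ultimately show ?thesis using c W_add by auto
qed

text \<open>The induction hypothesis of the Noetherian induction, for the degrees in a lower set \<open>H\<close>.\<close>

definition rewritable where
  "rewritable H \<longleftrightarrow> (\<forall>\<beta>\<in>H. \<forall>\<alpha>. lteq \<alpha> \<beta> \<longrightarrow> \<alpha> \<in> H) \<and>
    (\<forall>j\<in>{1..s}. \<forall>m\<in>F 0. \<forall>b\<in>E. \<gamma> j + deg b \<in> H \<longrightarrow> lead (x j \<otimes> m \<otimes> B b) (add_mset j b))"

lemma rewritableD:
  assumes "rewritable H"
  shows "\<beta> \<in> H \<Longrightarrow> lteq \<alpha> \<beta> \<Longrightarrow> \<alpha> \<in> H"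
    and "\<lbrakk>j \<in> {1..s}; m \<in> F 0; b \<in> E; \<gamma> j + deg b \<in> H\<rbrakk> \<Longrightarrow> lead (x j \<otimes> m \<otimes> B b) (add_mset j b)"
  using assms unfolding rewritable_def by blast+

lemma W_induct:
  assumes "v \<in> W e" "\<zero> \<in> M" "\<And>u w. u \<in> M \<Longrightarrow> w \<in> M \<Longrightarrow> u \<oplus> w \<in> M"
    "\<And>a d. \<lbrakk>a \<in> F 0; d \<in> E; lt (deg d) (deg e); wt d < wt e\<rbrakk> \<Longrightarrow> a \<otimes> B d \<in> M"
  shows "v \<in> M"
  using assms(1) unfolding W_def by (rule span_least) (use assms in auto)

text \<open>Every term of \<open>v\<close> has degree below \<open>deg e\<close>, so the products to
  be rewritten have degree strictly below \<open>\<gamma> i + deg e\<close>. Thus the induction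
  hypothesis suffices even when that degree itself is not yet covered.\<close>

lemma x_mult_W:
  assumes H: "rewritable H" and i: "i \<in> {1..s}" and e: "e \<in> E"
    and v: "v \<in> W e" and lower: "\<And>\<beta>. lt \<beta> (\<gamma> i + deg e) \<Longrightarrow> \<beta> \<in> H"
  shows "x i \<otimes> v \<in> W (add_mset i e)"
proof -
  have "v \<in> {v \<in> carrier R. x i \<otimes> v \<in> W (add_mset i e)}"
  proof (rule W_induct[OF v])
    fix a d assume d: "a \<in> F 0" "d \<in> E" "lt (deg d) (deg e)" "wt d < wt e"
    have l: "lt (\<gamma> i + deg d) (\<gamma> i + deg e)" using d by (intro add_le_lt) auto
    have "lead (x i \<otimes> a \<otimes> B d) (add_mset i d)"
      using d i lower[OF l] by (intro rewritableD(2)[OF H]) auto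
    then have "x i \<otimes> a \<otimes> B d \<in> W (add_mset i e)"
      using d l i by (intro lead_in_W[of _ "add_mset i d"]) auto
    then show "a \<otimes> B d \<in> {v \<in> carrier R. x i \<otimes> v \<in> W (add_mset i e)}"
      using d x_carrier[OF i] by (simp add: m_assoc L_carrier B_closed)
  qed (use x_carrier[OF i] W_zero W_add in \<open>auto simp: r_distr\<close>)
  then show ?thesis by simp
qed

text \<open>Peel the smallest generator off \<open>a\<close>. It meets the leading term of the
  shorter product, which is rewritten by hypothesis, and an error term, which
  \<open>x_mult_W\<close> keeps small. The scalar in the middle is essential: after each step a
  coefficient stands between the next generator and the remaining monomial.\<close>

lemma lead_mult:
  assumes H: "rewritable H"
  shows "\<lbrakk>a \<in> E; m \<in> F 0; b \<in> E; deg a + deg b \<in> H\<rbrakk> \<Longrightarrow> lead (B a \<otimes> m \<otimes> B b) (a + b)"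
proof (induction a rule: multiset_induct_min)
  case empty
  then show ?case using lead_B[of b m] by (simp add: B_empty L_carrier)
next
  case (add i a)
  then have i: "i \<in> {1..s}" and a: "a \<in> E" by auto
  have "lteq (0 + (deg a + deg b)) (\<gamma> i + (deg a + deg b))"
    by (intro add_mono zero_lteq ord.order_refl)
  moreover have in_H: "\<gamma> i + deg (a + b) \<in> H" using add.prems by (simp add: add.assoc)
  ultimately have "deg a + deg b \<in> H" using rewritableD(1)[OF H] by simp
  then have "lead (B a \<otimes> m \<otimes> B b) (a + b)" using add a by auto
  then obtain c u where c: "c \<in> F 0" "u \<in> W (a + b)" "B a \<otimes> m \<otimes> B b = c \<otimes> B (a + b) \<oplus> u"
    by (auto simp: lead_def)
  have "B (add_mset i a) = x i \<otimes> B a" using add by (intro B_Cons) auto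
  then have "B (add_mset i a) \<otimes> m \<otimes> B b = x i \<otimes> (B a \<otimes> m \<otimes> B b)"
    using add.prems a x_carrier[OF i] by (simp add: m_assoc L_carrier B_closed)
  also have "\<dots> = x i \<otimes> c \<otimes> B (a + b) \<oplus> x i \<otimes> u"
    unfolding c(3) using add.prems a x_carrier[OF i] c W_carrier
    by (simp add: m_assoc r_distr L_carrier B_closed)
  finally have eq: "B (add_mset i a) \<otimes> m \<otimes> B b = x i \<otimes> c \<otimes> B (a + b) \<oplus> x i \<otimes> u" .
  have "lead (x i \<otimes> c \<otimes> B (a + b)) (add_mset i (a + b))"
    using add.prems a i c in_H by (intro rewritableD(2)[OF H]) auto
  moreover have "x i \<otimes> u \<in> W (add_mset i (a + b))"
    using add.prems a i c in_H rewritableD(1)[OF H in_H] ord.less_imp_le by (intro x_mult_W[OF H]) auto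
  ultimately show ?case
    using add.prems a i unfolding eq by (simp add: lead_add)
qed

lemma W_mult_B:
  assumes H: "rewritable H" and e: "e \<in> E" and b: "b \<in> E"
    and v: "v \<in> W e" and lower: "\<And>\<beta>. lt \<beta> (deg e + deg b) \<Longrightarrow> \<beta> \<in> H"
  shows "v \<otimes> B b \<in> W (e + b)"
proof -
  have "v \<in> {v \<in> carrier R. v \<otimes> B b \<in> W (e + b)}"
  proof (rule W_induct[OF v])
    fix a d assume d: "a \<in> F 0" "d \<in> E" "lt (deg d) (deg e)" "wt d < wt e"
    have l: "lt (deg d + deg b) (deg e + deg b)" using d by (intro add_lt_le) auto
    have "lead (B d \<otimes> \<one> \<otimes> B b) (d + b)"
      using d b lower[OF l] L_one by (intro lead_mult[OF H]) auto
    then have "a \<otimes> (B d \<otimes> B b) \<in> W (e + b)"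
      using d b l by (intro W_scale lead_in_W[of _ "d + b"]) (auto simp: B_closed)
    then show "a \<otimes> B d \<in> {v \<in> carrier R. v \<otimes> B b \<in> W (e + b)}"
      using d b by (simp add: m_assoc L_carrier B_closed)
  qed (use B_closed[OF b] W_zero W_add in \<open>auto simp: l_distr\<close>)
  then show ?thesis by simp
qed

end

locale weighted_relations = weighted_generators +
  assumes wf: "wfp lt"
    and \<gamma>_pos: "j \<in> {1..s} \<Longrightarrow> \<gamma> j \<noteq> 0"
    and rel_scalar: "j \<in> {1..s} \<Longrightarrow> m \<in> F 0 \<Longrightarrow> lead (x j \<otimes> m) {#j#}"
    and rel_swap: "1 \<le> i \<Longrightarrow> i < j \<Longrightarrow> j \<le> s \<Longrightarrow>
      \<exists>q\<in>F 0. \<exists>u\<in>W {#i, j#}. x j \<otimes> x i = q \<otimes> x i \<otimes> x j \<oplus> u"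
begin

text \<open>Induction on the total degree. If \<open>x j\<close> is not in order in front of
  \<open>B b\<close>, exchange it with the smallest generator \<open>x i\<close> of
  \<open>B b\<close>, move \<open>x j\<close> into the shorter monomial by the induction hypothesis,
  and then carry \<open>x i\<close> past the scalar that this produces. The errors are products of
  strictly smaller degree, so they are covered as well.\<close>

lemma rewritable_UNIV: "rewritable UNIV"
proof -
  have "lead (x j \<otimes> m \<otimes> B b) (add_mset j b)"
    if "j \<in> {1..s}" "m \<in> F 0" "b \<in> E" "\<gamma> j + deg b = \<alpha>" for j m b \<alpha>
    using wf that
  proof (induction \<alpha> arbitrary: j m b rule: wfp_induct_rule)
    case (less \<alpha>)
    note j = less.prems(1) and m = less.prems(2) and b = less.prems(3)
    define H where "H = {\<beta>. lt \<beta> (\<gamma> j + deg b)}"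
    have H: "rewritable H"
      unfolding rewritable_def H_def using less.IH less.prems(4) ord.le_less_trans by blast
    have lower: "lt \<beta> (\<gamma> j + deg b) \<Longrightarrow> \<beta> \<in> H" for \<beta> by (simp add: H_def)
    have jE: "add_mset j b \<in> E" using j b by simp
    have tail: "u \<otimes> B b \<in> W (add_mset j b)" if "u \<in> W {#j#}" for u
      using W_mult_B[OF H _ b that] lower j by simp
    \<comment> \<open>The scalar \<open>m\<close> is left out at first. It is moved past
      \<open>x j\<close> at the end by \<open>rel_scalar\<close>, where the resulting error times
      \<open>B b\<close> is handled by \<open>tail\<close>.\<close>
    have x_B: "lead (x j \<otimes> B b) (add_mset j b)"
    proof (cases "\<forall>k\<in>#b. j \<le> k")
      case True
      then have "x j \<otimes> B b = \<one> \<otimes> B (add_mset j b)"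
        using B_Cons[of b j] B_closed[OF jE] by simp
      then show ?thesis using lead_B[OF jE L_one] by simp
    next
      case False
      define i where "i = Min (set_mset b)"
      have "b \<noteq> {#}" using False by auto
      then have ib: "i \<in># b" and imin: "\<And>k. k \<in># b \<Longrightarrow> i \<le> k" by (auto simp: i_def)
      then have ij: "i < j" using False by (meson leI order_trans)
      obtain b' where b': "b = add_mset i b'" using ib by (metis insert_DiffM)
      have i: "i \<in> {1..s}" and b'E: "b' \<in> E" using b b' by auto
      have jb'E: "add_mset j b' \<in> E" using j b'E by simp
      have Bb: "B b = x i \<otimes> B b'" unfolding b' using imin b' by (intro B_Cons) auto
      obtain q u where q: "q \<in> F 0" "u \<in> W {#i, j#}" "x j \<otimes> x i = q \<otimes> x i \<otimes> x j \<oplus> u"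
        using rel_swap[of i j] i j ij by auto
      note c = x_carrier[OF i] x_carrier[OF j] B_closed[OF b'E] W_carrier[OF q(2)] L_carrier[OF q(1)]
      have "x j \<otimes> B b = (x j \<otimes> x i) \<otimes> B b'" using c by (simp add: Bb m_assoc)
      \<comment> \<open>The factor \<open>\<one>\<close> gives the inner product the shape required
        by \<open>rewritableD\<close>.\<close>
      also have "\<dots> = q \<otimes> (x i \<otimes> (x j \<otimes> \<one> \<otimes> B b')) \<oplus> u \<otimes> B b'"
        unfolding q(3) using c by (simp add: l_distr m_assoc)
      finally have eq: "x j \<otimes> B b = q \<otimes> (x i \<otimes> (x j \<otimes> \<one> \<otimes> B b')) \<oplus> u \<otimes> B b'" .
      have "u \<otimes> B b' \<in> W ({#i, j#} + b')"
        using lower i j b' by (intro W_mult_B[OF H _ b'E q(2)]) (auto simp: ac_simps)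
      then have u: "u \<otimes> B b' \<in> W (add_mset j b)"
        by (simp add: b' add_mset_commute)
      \<comment> \<open>Removing \<open>i\<close> strictly lowers the degree because
        \<open>\<gamma> i\<close> is nonzero; otherwise the induction would not advance.\<close>
      have "lt (0 + (\<gamma> j + deg b')) (\<gamma> i + (\<gamma> j + deg b'))"
        using \<gamma>_pos[OF i] by (intro add_lt_le zero_lt) auto
      then have "\<gamma> j + deg b' \<in> H" by (simp add: H_def b' ac_simps)
      then have "lead (x j \<otimes> \<one> \<otimes> B b') (add_mset j b')"
        using j b'E L_one by (intro rewritableD(2)[OF H]) auto
      then obtain a v where a: "a \<in> F 0" "v \<in> W (add_mset j b')"
          "x j \<otimes> \<one> \<otimes> B b' = a \<otimes> B (add_mset j b') \<oplus> v"
        by (auto simp: lead_def)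
      have v: "x i \<otimes> v \<in> W (add_mset j b)"
        using x_mult_W[OF H i jb'E a(2)] lower by (simp add: b' ac_simps add_mset_commute)
      \<comment> \<open>The scalar \<open>a\<close> now separates \<open>x i\<close> from the
        reordered monomial and must be moved to the left.\<close>
      obtain a' v' where a': "a' \<in> F 0" "v' \<in> W {#i#}" "x i \<otimes> a = a' \<otimes> x i \<oplus> v'"
        using rel_scalar[OF i a(1)] B_single[OF i] by (auto simp: lead_def)
      have v': "v' \<otimes> B (add_mset j b') \<in> W (add_mset j b)"
        using W_mult_B[OF H _ jb'E a'(2)] i lower by (simp add: b' ac_simps add_mset_commute)
      \<comment> \<open>Here the choice of \<open>i\<close> pays off: it is at most every index of
        \<open>b'\<close> and smaller than \<open>j\<close>, so this product is already
        ordered.\<close>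
      have Bj: "B (add_mset j b) = x i \<otimes> B (add_mset j b')"
        using imin ij unfolding b' by (subst add_mset_commute, intro B_Cons) auto
      have "x i \<otimes> (x j \<otimes> \<one> \<otimes> B b') = (x i \<otimes> a) \<otimes> B (add_mset j b') \<oplus> x i \<otimes> v"
        unfolding a(3) using c a W_carrier[OF a(2)] B_closed[OF jb'E]
        by (simp add: r_distr m_assoc L_carrier)
      also have "\<dots> = (a' \<otimes> B (add_mset j b) \<oplus> v' \<otimes> B (add_mset j b')) \<oplus> x i \<otimes> v"
        unfolding a'(3) Bj using c a' W_carrier[OF a'(2)] B_closed[OF jb'E]
        by (simp add: l_distr m_assoc L_carrier)
      finally have "lead (x i \<otimes> (x j \<otimes> \<one> \<otimes> B b')) (add_mset j b)"
        using lead_add[OF jE lead_add[OF jE lead_B[OF jE a'(1)] v'] v] by simp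
      then show ?thesis
        unfolding eq by (rule lead_add[OF jE lead_scale[OF jE _ q(1)] u])
    qed
    obtain c u where c: "c \<in> F 0" "u \<in> W {#j#}" "x j \<otimes> m = c \<otimes> x j \<oplus> u"
      using rel_scalar[OF j m] B_single[OF j] by (auto simp: lead_def)
    have "x j \<otimes> m \<otimes> B b = c \<otimes> (x j \<otimes> B b) \<oplus> u \<otimes> B b"
      unfolding c(3) using c(1) W_carrier[OF c(2)] x_carrier[OF j] B_closed[OF b]
      by (simp add: l_distr m_assoc L_carrier)
    then show ?case
      using x_B c tail jE by (simp add: lead_add lead_scale)
  qed
  then show ?thesis unfolding rewritable_def by blast
qed

lemma lead_monomials: "a \<in> E \<Longrightarrow> m \<in> F 0 \<Longrightarrow> b \<in> E \<Longrightarrow> lead (B a \<otimes> m \<otimes> B b) (a + b)"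
  by (rule lead_mult[OF rewritable_UNIV]) auto

end

section \<open>The filtration by weighted degree\<close>

lemma (in left_family) span_subgroup:
  assumes "D \<subseteq> E"
  shows "additive_subgroup (span D) T"
  using assms span_closed span_add span_uminus lspan_zero[of T L B D]
  by (intro additive_subgroupI add.subgroupI) (auto simp flip: a_inv_def)

lemma (in left_family) span_fin_gen:
  assumes "finite D" "D \<subseteq> E"
  shows "fin_gen_left T L (span D)"
  unfolding fin_gen_left_def
proof (intro exI conjI)
  let ?S = "B ` D"
  show "finite ?S" using assms by simp
  show "?S \<subseteq> span D" using span_base assms by auto
  have SC: "s \<in> carrier T" if "s \<in> ?S" for s using that assms B_closed by auto
  show "span D = {\<Oplus>s\<in>?S. c s \<otimes> s |c. c \<in> ?S \<rightarrow> L}"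
  proof (intro equalityI subsetI)
    fix v assume "v \<in> span D"
    then show "v \<in> {\<Oplus>s\<in>?S. c s \<otimes> s |c. c \<in> ?S \<rightarrow> L}"
    proof (induction rule: lspan_induct)
      case zero
      have "(\<Oplus>s\<in>?S. \<zero> \<otimes> s) = \<zero>" using SC by (intro add.finprod_one_eqI) auto
      then show ?case using L_zero by (auto intro!: exI[of _ "\<lambda>_. \<zero>"])
    next
      case (add a d v)
      then obtain c where c: "c \<in> ?S \<rightarrow> L" "v = (\<Oplus>s\<in>?S. c s \<otimes> s)" by auto
      \<comment> \<open>The sum runs over the values of \<open>B\<close>, not over indices, so the
        new coefficient has to be merged with the one already attached to the value
        \<open>B d\<close>.\<close>
      define c' where "c' s = (if B d = s then a else \<zero>) \<oplus> c s" for s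
      have cC: "c s \<in> carrier T" if "s \<in> ?S" for s using c(1) that L_carrier by auto
      have a: "a \<in> carrier T" "B d \<in> carrier T" using add L_carrier SC by auto
      have "(\<Oplus>s\<in>?S. c' s \<otimes> s) = (\<Oplus>s\<in>?S. (if B d = s then a \<otimes> s else \<zero>) \<oplus> c s \<otimes> s)"
        using SC cC a by (intro finsum_cong' refl) (auto simp: c'_def l_distr)
      also have "\<dots> = (\<Oplus>s\<in>?S. if B d = s then a \<otimes> s else \<zero>) \<oplus> (\<Oplus>s\<in>?S. c s \<otimes> s)"
        using SC cC a by (intro finsum_addf) auto
      also have "(\<Oplus>s\<in>?S. if B d = s then a \<otimes> s else \<zero>) = a \<otimes> B d"
        using add assms SC a by (intro finsum_singleton) auto
      finally have "a \<otimes> B d \<oplus> v = (\<Oplus>s\<in>?S. c' s \<otimes> s)" using c(2) by simp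
      moreover have "c' \<in> ?S \<rightarrow> L"
        using c(1) add(1) L_zero L_rules(7) by (auto simp: c'_def Pi_iff)
      ultimately show ?case by blast
    qed
  next
    fix v assume "v \<in> {\<Oplus>s\<in>?S. c s \<otimes> s |c. c \<in> ?S \<rightarrow> L}"
    then show "v \<in> span D" using assms by (auto intro!: span_finsum span_gen)
  qed
qed

locale weighted_basis = weighted_generators +
  assumes lead_monomials: "a \<in> E \<Longrightarrow> m \<in> F 0 \<Longrightarrow> b \<in> E \<Longrightarrow> lead (B a \<otimes> m \<otimes> B b) (a + b)"
    and w_pos: "j \<in> {1..s} \<Longrightarrow> 0 < w j"
    and F_span: "F \<alpha> = span {d \<in> E. lteq (deg d) \<alpha>}"
    and free: "f \<in> coeffs \<Longrightarrow> lc f = \<zero> \<Longrightarrow> f = (\<lambda>_. \<zero>)"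
begin

definition N where "N k = span {d \<in> E. wt d \<le> k}"

lemma size_le_wt: "d \<in> E \<Longrightarrow> size d \<le> wt d"
proof (induction d)
  case (add i d)
  then show ?case using w_pos[of i] by auto
qed simp

text \<open>Positive integer weights bound the size of a multiset by its weight. This makes every
  \<open>N k\<close> finitely generated, whatever the original degrees are.\<close>

lemma finite_wt: "finite {d \<in> E. wt d \<le> k}"
proof (rule finite_subset)
  show "{d \<in> E. wt d \<le> k} \<subseteq> mset ` {xs. set xs \<subseteq> {1..s} \<and> length xs \<le> k}"
  proof
    fix d assume d: "d \<in> {d \<in> E. wt d \<le> k}"
    obtain xs where "d = mset xs" using ex_mset[of d] by auto
    then show "d \<in> mset ` {xs. set xs \<subseteq> {1..s} \<and> length xs \<le> k}"
      using d size_le_wt[of d] by (auto simp: exponents_def)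
  qed
qed (simp add: finite_lists_length_le)

lemma N_0: "N 0 = F 0"
proof -
  have eq: "{d \<in> E. wt d \<le> 0} = {{#}}"
    using size_le_wt by fastforce
  show ?thesis
    unfolding N_def eq
  proof (intro equalityI subsetI)
    fix v assume "v \<in> span {{#}}"
    then show "v \<in> F 0"
      by (rule span_least) (auto simp: F_zero F_add B_empty L_carrier)
  next
    fix v assume "v \<in> F 0"
    then show "v \<in> span {{#}}"
      using span_gen[of "{{#}}" v "{#}"] by (simp add: B_empty L_carrier)
  qed
qed

lemma N_mono: "k \<le> l \<Longrightarrow> N k \<subseteq> N l"
  unfolding N_def by (intro lspan_mono) auto

lemma N_add: "u \<in> N k \<Longrightarrow> v \<in> N k \<Longrightarrow> u \<oplus> v \<in> N k"
  unfolding N_def by (rule span_add) auto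

lemma N_zero: "\<zero> \<in> N k"
  unfolding N_def by (rule lspan_zero)

lemma N_scale: "a \<in> F 0 \<Longrightarrow> v \<in> N k \<Longrightarrow> a \<otimes> v \<in> N k"
  unfolding N_def by (rule span_scale) auto

lemma N_carrier: "v \<in> N k \<Longrightarrow> v \<in> carrier R"
  unfolding N_def by (rule span_closed) auto

lemma lead_in_N: "lead v e \<Longrightarrow> e \<in> E \<Longrightarrow> v \<in> N (wt e)"
proof -
  assume v: "lead v e" and e: "e \<in> E"
  then obtain c u where c: "c \<in> F 0" "u \<in> W e" "v = c \<otimes> B e \<oplus> u" by (auto simp: lead_def)
  have "c \<otimes> B e \<in> N (wt e)" unfolding N_def using e c by (intro span_gen) auto
  moreover have "W e \<subseteq> N (wt e)" unfolding N_def W_def by (intro lspan_mono) auto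
  ultimately show ?thesis using N_add c by auto
qed

text \<open>After expanding both factors, the scalar of the right one stands between two monomials,
  which is exactly the shape covered by \<open>lead_monomials\<close>.\<close>

lemma N_mult:
  assumes u: "u \<in> N k" and v: "v \<in> N l"
  shows "u \<otimes> v \<in> N (k + l)"
proof -
  have "u \<in> span {d \<in> E. wt d \<le> k}" using u by (simp add: N_def)
  then have "u \<in> {u \<in> carrier R. u \<otimes> v \<in> N (k + l)}"
  proof (rule span_least)
    fix a d assume a: "a \<in> F 0" and d: "d \<in> {d \<in> E. wt d \<le> k}"
    have "v \<in> span {d \<in> E. wt d \<le> l}" using v by (simp add: N_def)
    then have "v \<in> {v \<in> carrier R. B d \<otimes> v \<in> N (k + l)}"
    proof (rule span_least)
      fix b e assume b: "b \<in> F 0" and e: "e \<in> {d \<in> E. wt d \<le> l}"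
      then have "B d \<otimes> b \<otimes> B e \<in> N (wt (d + e))"
        using d by (intro lead_in_N lead_monomials) auto
      moreover have "N (wt (d + e)) \<subseteq> N (k + l)" using d e by (intro N_mono) auto
      ultimately show "b \<otimes> B e \<in> {v \<in> carrier R. B d \<otimes> v \<in> N (k + l)}"
        using b d e by (auto simp: m_assoc[symmetric] L_carrier B_closed)
    qed (use d B_closed N_zero N_add in \<open>auto simp: r_distr\<close>)
    then have "B d \<otimes> v \<in> N (k + l)" by simp
    then show "a \<otimes> B d \<in> {u \<in> carrier R. u \<otimes> v \<in> N (k + l)}"
      using a d N_carrier[OF v] N_scale by (simp add: m_assoc L_carrier B_closed)
  qed (use N_carrier[OF v] N_zero N_add in \<open>auto simp: l_distr\<close>)
  then show ?thesis by simp
qed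

lemma N_Union: "(\<Union>k. N k) = carrier R"
proof (intro equalityI subsetI)
  fix v assume "v \<in> carrier R"
  then obtain \<alpha> where "v \<in> F \<alpha>" using F_Union by auto
  then have "v \<in> span {d \<in> E. lteq (deg d) \<alpha>}" using F_span[of \<alpha>] by simp
  then show "v \<in> (\<Union>k. N k)"
  proof (rule span_least)
    show "u \<oplus> v \<in> (\<Union>k. N k)" if "u \<in> (\<Union>k. N k)" "v \<in> (\<Union>k. N k)" for u v
    proof -
      from \<open>u \<in> (\<Union>k. N k)\<close> \<open>v \<in> (\<Union>k. N k)\<close> obtain k l where "u \<in> N k" "v \<in> N l" by auto
      then have "u \<in> N (max k l)" "v \<in> N (max k l)"
        using N_mono[of k "max k l"] N_mono[of l "max k l"] by auto
      then show ?thesis using N_add by blast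
    qed
    show "a \<otimes> B d \<in> (\<Union>k. N k)" if "a \<in> F 0" "d \<in> {d \<in> E. lteq (deg d) \<alpha>}" for a d
      using lead_in_N[OF lead_B] that by blast
  qed (use N_zero in auto)
qed (use N_carrier in auto)

lemma N_ring_filtration: "ring_filtration R (\<le>) N"
proof (intro ring_filtration.intro ring_filtration_axioms.intro ring_axioms admissible.intro)
  show "admissible_order ((\<le>) :: nat \<Rightarrow> nat \<Rightarrow> bool)"
    by (auto simp: admissible_order_def reflp_def transp_def antisymp_def totalp_on_def)
  show "additive_subgroup (N k) R" for k
    unfolding N_def by (rule span_subgroup) auto
qed (use N_mono N_mult N_Union N_0 F_one in auto)

text \<open>The choice refers to neither filtration separately: its error term lies in
  \<open>W\<close>, so the same function serves for degree and for weight.\<close>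

definition lead_coeff where
  "lead_coeff a m b = (SOME c. c \<in> F 0 \<and> (\<exists>u\<in>W (a + b). B a \<otimes> m \<otimes> B b = c \<otimes> B (a + b) \<oplus> u))"

lemma lead_coeff:
  assumes "a \<in> E" "m \<in> F 0" "b \<in> E"
  shows "lead_coeff a m b \<in> F 0"
    and "B a \<otimes> m \<otimes> B b \<ominus> lead_coeff a m b \<otimes> B (a + b) \<in> W (a + b)"
proof -
  have "\<exists>c. c \<in> F 0 \<and> (\<exists>u\<in>W (a + b). B a \<otimes> m \<otimes> B b = c \<otimes> B (a + b) \<oplus> u)"
    using lead_monomials[OF assms] by (auto simp: lead_def)
  from someI_ex[OF this, folded lead_coeff_def]
  obtain u where c: "lead_coeff a m b \<in> F 0" and u: "u \<in> W (a + b)"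
    "B a \<otimes> m \<otimes> B b = lead_coeff a m b \<otimes> B (a + b) \<oplus> u" by auto
  show "lead_coeff a m b \<in> F 0" by fact
  have cB: "lead_coeff a m b \<otimes> B (a + b) \<in> carrier R"
    using assms c by (simp add: L_carrier B_closed)
  then have "B a \<otimes> m \<otimes> B b \<ominus> lead_coeff a m b \<otimes> B (a + b) = u"
    using W_carrier[OF u(1)] unfolding u(2)
    by (simp add: a_minus_def a_comm[of _ u] a_assoc r_neg)
  then show "B a \<otimes> m \<otimes> B b \<ominus> lead_coeff a m b \<otimes> B (a + b) \<in> W (a + b)"
    using u by simp
qed

lemma filtered_basis_F: "filtered_basis R lteq F B E deg lead_coeff"
proof (intro filtered_basis.intro filtered_basis_axioms.intro ring_filtration_axioms left_family_axioms)
  show "B a \<otimes> m \<otimes> B b \<ominus> lead_coeff a m b \<otimes> B (a + b) \<in> span {d \<in> E. lt (deg d) (deg (a + b))}"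
    if "a \<in> E" "m \<in> F 0" "b \<in> E" for a m b
  proof -
    have "W (a + b) \<subseteq> span {d \<in> E. lt (deg d) (deg (a + b))}"
      unfolding W_def by (intro lspan_mono) auto
    then show ?thesis using lead_coeff(2)[OF that] by blast
  qed
  show "F \<alpha> = span {d \<in> E. lteq (deg d) \<alpha>}" for \<alpha> by (rule F_span)
qed (use B_empty free lead_coeff in auto)

lemma filtered_basis_N: "filtered_basis R (\<le>) N B E wt lead_coeff"
proof -
  interpret N: ring_filtration R "(\<le>)" N by (rule N_ring_filtration)
  show ?thesis
  proof (intro filtered_basis.intro filtered_basis_axioms.intro N_ring_filtration, unfold N_0)
    show "B a \<otimes> m \<otimes> B b \<ominus> lead_coeff a m b \<otimes> B (a + b) \<in> span {d \<in> E. N.lt (wt d) (wt (a + b))}"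
      if "a \<in> E" "m \<in> F 0" "b \<in> E" for a m b
    proof -
      have "W (a + b) \<subseteq> span {d \<in> E. N.lt (wt d) (wt (a + b))}"
        unfolding W_def N.lt_def by (intro lspan_mono) auto
      then show ?thesis using lead_coeff(2)[OF that] by blast
    qed
  qed (use left_family_axioms B_empty free lead_coeff N_def in auto)
qed

text \<open>Since \<open>N 0 = F 0\<close>, the coefficient functions of the two filtered bases are
  the same, and both isomorphisms start from one structure \<open>A.C\<close>.\<close>

lemma graded_N_iso: "assoc_graded R (\<le>) N \<simeq> assoc_graded R lteq F"
proof -
  interpret A: filtered_basis R lteq F B E deg lead_coeff by (rule filtered_basis_F)
  interpret N: filtered_basis R "(\<le>)" N B E wt lead_coeff by (rule filtered_basis_N)
  show ?thesis
  proof (rule ring_iso_quotient)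
    show "(\<lambda>f. N.fam (N.hpart f)) \<in> ring_iso A.C (assoc_graded R (\<le>) N)"
      using N.coeff_ring_iso unfolding N_0 .
    show "(\<lambda>f. fam (A.hpart f)) \<in> ring_iso A.C (assoc_graded R lteq F)"
      by (rule A.coeff_ring_iso)
    have C: "carrier A.C = coeffs" "f \<oplus>\<^bsub>A.C\<^esub> g = (\<lambda>e. f e \<oplus> g e)"
      "\<one>\<^bsub>A.C\<^esub> = (\<lambda>e. if e = {#} then \<one> else \<zero>)" for f g
      by (auto simp: coeff_ring_def)
    show "f \<otimes>\<^bsub>A.C\<^esub> g \<in> carrier A.C" if "f \<in> carrier A.C" "g \<in> carrier A.C" for f g
      using A.coeff_mult(1) that by (simp add: C)
    show "f \<oplus>\<^bsub>A.C\<^esub> g \<in> carrier A.C" if "f \<in> carrier A.C" "g \<in> carrier A.C" for f g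
      using coeffs_add that by (simp add: C)
    show "\<one>\<^bsub>A.C\<^esub> \<in> carrier A.C"
      unfolding C by (rule lc_single(1)) (use L_one in auto)
  qed
qed

end

text \<open>What remains is the action of \<open>K\<close>. A scalar from \<open>K\<close> can be
  absorbed into the coefficient of each monomial, because \<open>F 0\<close> is itself a
  \<open>K\<close>-submodule.\<close>

lemma refiltration:
  fixes K :: "('k, 'l) ring_scheme" and R :: "('k, 'a, 'm) module_scheme" (structure)
  assumes K: "assoc_algebra K R" and sub: "submodule (F 0) K R"
    and wb: "weighted_basis R lteq F s x \<gamma> w"
  shows "\<exists>Rk :: nat \<Rightarrow> 'a set. filtration K R (\<le>) Rk \<and> Rk 0 = F 0 \<and>
    (\<forall>k. fin_gen_left R (F 0) (Rk k)) \<and> assoc_graded R (\<le>) Rk \<simeq> assoc_graded R lteq F"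
proof (intro exI conjI allI)
  interpret weighted_basis R lteq F s x \<gamma> w by (rule wb)
  interpret K: assoc_algebra K R by (rule K)
  have smult: "a \<odot>\<^bsub>R\<^esub> v \<in> N k" if "a \<in> carrier K" "v \<in> N k" for a v k
  proof -
    have "v \<in> span {d \<in> E. wt d \<le> k}" using that(2) by (simp add: N_def)
    then have "v \<in> {v \<in> carrier R. a \<odot>\<^bsub>R\<^esub> v \<in> N k}"
    proof (rule span_least)
      fix m d assume m: "m \<in> F 0" and d: "d \<in> {d \<in> E. wt d \<le> k}"
      have am: "a \<odot>\<^bsub>R\<^esub> m \<in> F 0" using sub that(1) m by (rule submodule.smult_closed)
      have "a \<odot>\<^bsub>R\<^esub> (m \<otimes> B d) = (a \<odot>\<^bsub>R\<^esub> m) \<otimes> B d"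
        using K.smult_mult_left[OF that(1)] m d by (simp add: L_carrier B_closed)
      moreover have "(a \<odot>\<^bsub>R\<^esub> m) \<otimes> B d \<in> N k"
        unfolding N_def using am d by (intro span_gen) auto
      ultimately show "m \<otimes> B d \<in> {v \<in> carrier R. a \<odot>\<^bsub>R\<^esub> v \<in> N k}"
        using m d by (simp add: L_carrier B_closed)
    qed (use K.smult_r_distr K.smult_r_null that(1) N_zero N_add in auto)
    then show ?thesis by simp
  qed
  have "submodule (N k) K R" for k
  proof (rule K.submoduleI)
    show "\<ominus> a \<in> N k" if "a \<in> N k" for a
      using that unfolding N_def by (intro span_uminus) auto
  qed (use N_carrier N_zero N_add smult in auto)
  then show "filtration K R (\<le>) N"
    unfolding filtration_def using N_mono N_mult N_Union N_0 F_one by auto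
  show "N 0 = F 0" by (rule N_0)
  show "fin_gen_left R (F 0) (N k)" for k
    unfolding N_def by (intro span_fin_gen finite_wt) auto
  show "assoc_graded R (\<le>) N \<simeq> assoc_graded R lteq F" by (rule graded_N_iso)
qed

section \<open>Admissible orders are well-founded\<close>

text \<open>A monotone subsequence that decreases attains its minimum and is constant from there on,
  so a tail of it is weakly increasing.\<close>

lemma nat_seq_has_incseq:
  fixes h :: "nat \<Rightarrow> nat"
  shows "\<exists>r. strict_mono r \<and> incseq (\<lambda>k. h (r k))"
proof -
  obtain r where r: "strict_mono r" "monoseq (\<lambda>k. h (r k))"
    using seq_monosub[of h] by auto
  show ?thesis
  proof (cases "incseq (\<lambda>k. h (r k))")
    case False
    then have dec: "decseq (\<lambda>k. h (r k))" using r by (auto simp: monoseq_iff)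
    define m where "m = (LEAST v. v \<in> range (\<lambda>k. h (r k)))"
    have "m \<in> range (\<lambda>k. h (r k))" unfolding m_def by (rule LeastI_ex) auto
    then obtain k0 where k0: "h (r k0) = m" by auto
    have "h (r (k0 + k)) = m" for k
    proof (rule antisym)
      show "h (r (k0 + k)) \<le> m" using decseqD[OF dec, of k0 "k0 + k"] k0 by simp
      show "m \<le> h (r (k0 + k))" unfolding m_def by (rule Least_le) auto
    qed
    moreover have "strict_mono (\<lambda>k. r (k0 + k))" using r by (simp add: strict_mono_def)
    ultimately show ?thesis by (intro exI[of _ "\<lambda>k. r (k0 + k)"]) (auto simp: incseq_def)
  qed (use r in auto)
qed

text \<open>Dickson's lemma by thinning one coordinate at a time: passing to a further subsequence
  preserves monotonicity in the coordinates already treated.\<close>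

lemma vec_seq_has_incseq:
  fixes f :: "nat \<Rightarrow> nat ^ 'n"
  assumes "finite I"
  shows "\<exists>r. strict_mono r \<and> (\<forall>i\<in>I. incseq (\<lambda>k. f (r k) $ i))"
  using assms
proof (induction I)
  case empty
  show ?case by (auto intro: exI[of _ id] simp: strict_mono_def)
next
  case (insert i I)
  then obtain r where r: "strict_mono r" "\<forall>i\<in>I. incseq (\<lambda>k. f (r k) $ i)" by auto
  obtain r' where r': "strict_mono r'" "incseq (\<lambda>k. f (r (r' k)) $ i)"
    using nat_seq_has_incseq[of "\<lambda>k. f (r k) $ i"] by auto
  have "incseq (\<lambda>k. f (r (r' k)) $ i')" if "i' \<in> I" for i'
    using r(2) that r'(1) by (auto simp: incseq_def strict_mono_less_eq)
  moreover have "strict_mono (\<lambda>k. r (r' k))" using r(1) r'(1) by (simp add: strict_mono_def)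
  ultimately show ?case using r'(2) by (intro exI[of _ "\<lambda>k. r (r' k)"]) auto
qed

text \<open>In a descending sequence, two members comparable in all coordinates would differ by a
  vector of naturals. Such a vector is at least 0 in the order, so the later member would not be
  smaller.\<close>

lemma admissible_wf:
  fixes lteq :: "nat ^ 'n \<Rightarrow> nat ^ 'n \<Rightarrow> bool"
  assumes "admissible lteq"
  shows "wfp (admissible.lt lteq)"
proof -
  interpret admissible lteq by fact
  have "wf {(a, b). lt a b}"
    unfolding wf_iff_no_infinite_down_chain
  proof
    assume "\<exists>f. \<forall>k. (f (Suc k), f k) \<in> {(a, b). lt a b}"
    then obtain f where f: "\<And>k. lt (f (Suc k)) (f k)" by auto
    have desc: "lt (f j) (f i)" if "i < j" for i j
      using that f by (induction j) (auto simp: less_Suc_eq intro: ord.less_trans)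
    obtain r where r: "strict_mono r" "\<forall>i\<in>UNIV. incseq (\<lambda>k. f (r k) $ i)"
      using vec_seq_has_incseq[of UNIV f] by auto
    have "f (r 1) = f (r 0) + (\<chi> i. f (r 1) $ i - f (r 0) $ i)"
      using r(2) by (auto simp: vec_eq_iff incseq_def)
    moreover have "lteq (f (r 0) + 0) (f (r 0) + (\<chi> i. f (r 1) $ i - f (r 0) $ i))"
      by (intro add_mono zero_lteq ord.order_refl)
    ultimately have "lteq (f (r 0)) (f (r 1))" by simp
    moreover have "lt (f (r 1)) (f (r 0))"
      using r(1) by (intro desc) (auto simp: strict_mono_def)
    ultimately show False using ord.not_le by blast
  qed
  then show ?thesis by (simp add: wfp_def)
qed

section \<open>Lifting the Ore basis to the filtered ring\<close>

lemma (in left_family) lc_inj: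
  assumes free: "\<And>f. f \<in> coeffs \<Longrightarrow> lc f = \<zero> \<Longrightarrow> f = (\<lambda>_. \<zero>)"
    and "f \<in> coeffs" "g \<in> coeffs" "lc f = lc g"
  shows "f = g"
proof -
  have "lc (\<lambda>d. f d \<ominus> g d) = \<zero>"
    using lc_minus[OF assms(2,3)] lc_closed[OF assms(3)] assms(4) by (simp add: a_minus_def r_neg)
  from free[OF coeffs_minus[OF assms(2,3)] this] show ?thesis
    using coeffsD(2)[OF assms(2)] coeffsD(2)[OF assms(3)] by (auto simp: fun_eq_iff)
qed

lemma (in admissible) finite_has_max:
  "finite A \<Longrightarrow> A \<noteq> {} \<Longrightarrow> \<exists>a\<in>A. \<forall>b\<in>A. lteq (h b) (h a)"
proof (induction A rule: finite_ne_induct)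
  case (insert x A)
  then obtain a where a: "a \<in> A" "\<forall>b\<in>A. lteq (h b) (h a)" by auto
  show ?case
  proof (cases "lteq (h x) (h a)")
    case False
    then have "lteq (h a) (h x)" using ord.linear by blast
    then show ?thesis using a ord.order_trans by (intro bexI[of _ x]) auto
  qed (use a in auto)
qed auto

context ring_filtration
begin

lemma graded_add_at: "g \<in> carrier G \<Longrightarrow> h \<in> carrier G \<Longrightarrow> (g \<oplus>\<^bsub>G\<^esub> h) \<alpha> = g \<alpha> <+> h \<alpha>"
  by (simp add: assoc_graded_def piece_simps)

lemma zero_at: "\<zero>\<^bsub>G\<^esub> \<alpha> = cset \<alpha> \<zero>"
  by (simp add: fam_zero fam_def)

lemma cls_finsum:
  assumes "ring G" "\<And>i. i \<in> A \<Longrightarrow> h i \<in> F \<alpha>"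
  shows "finsum G (\<lambda>i. cls \<alpha> (h i)) A = cls \<alpha> (finsum R h A)"
proof -
  interpret G: ring G by fact
  show ?thesis using assms(2)
  proof (induction A rule: infinite_finite_induct)
    case (insert i A)
    have "finsum R h A \<in> F \<alpha>" using insert by (intro F_finsum) auto
    moreover have "finsum R h (insert i A) = h i \<oplus> finsum R h A"
      using insert F_carrier by (intro finsum_insert) auto
    moreover have "finsum G (\<lambda>i. cls \<alpha> (h i)) (insert i A) =
        cls \<alpha> (h i) \<oplus>\<^bsub>G\<^esub> finsum G (\<lambda>i. cls \<alpha> (h i)) A"
      using insert cls_in_graded by (intro G.finsum_insert) auto
    ultimately show ?case using insert by (simp add: cls_add)
  qed (auto simp: finsum_infinite G.finsum_infinite cls_zero)
qed

end

section \<open>Transfer of the Ore basis to the filtered ring\<close>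

locale graded_ore = lifted_generators +
  fixes \<sigma> and S
  assumes tower: "ore_tower G (emb ` F 0) s (\<lambda>j. cls (\<gamma> j) (x j)) \<sigma> S"
    and wf: "wfp lt"
begin

sublocale T: ore_tower G "emb ` F 0" s "\<lambda>j. cls (\<gamma> j) (x j)" \<sigma> S
  by (rule tower)

lemma Y_eq: "d \<in> E \<Longrightarrow> T.Y d = cls (deg d) (B d)"
proof (induction d rule: multiset_induct_min)
  case empty
  then show ?case by (simp add: T.monomial_empty B_empty one_eq_cls)
next
  case (add i d)
  then have "T.Y (add_mset i d) = cls (\<gamma> i) (x i) \<otimes>\<^bsub>G\<^esub> T.Y d" by (intro T.monomial_Cons) auto
  also have "\<dots> = cls (\<gamma> i + deg d) (x i \<otimes> B d)"
    using add x_in_F[of i] B_in_F[of d] by (simp add: cls_mult)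
  also have "x i \<otimes> B d = B (add_mset i d)" using add by (intro B_Cons[symmetric]) auto
  finally show ?case by simp
qed

lemma emb_mult_Y:
  assumes "m \<in> F 0" "d \<in> E"
  shows "emb m \<otimes>\<^bsub>G\<^esub> T.Y d = cls (deg d) (m \<otimes> B d)"
  using cls_mult[OF assms(1) B_in_F[OF assms(2)]] assms by (simp add: Y_eq emb_eq_cls)

lemma graded_span_component:
  assumes "g \<in> T.span D" "D \<subseteq> E"
  shows "\<exists>r\<in>span {d \<in> D. deg d = \<alpha>}. g \<alpha> = cset \<alpha> r"
  using assms(1)
proof (induction rule: lspan_induct)
  case zero
  show ?case by (rule bexI[of _ \<zero>]) (simp_all add: zero_at lspan_zero)
next
  case (add a d v)
  then obtain m r where m: "m \<in> F 0" "a = emb m" and r: "r \<in> span {d \<in> D. deg d = \<alpha>}" "v \<alpha> = cset \<alpha> r"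
    by auto
  have d: "d \<in> E" using add assms by auto
  have v: "v \<in> carrier G" using T.span_closed[OF add(3)] assms by auto
  have mB: "m \<otimes> B d \<in> F (deg d)" using F0_mult[OF m(1) B_in_F[OF d]] .
  have rc: "r \<in> carrier R" using span_closed[OF r(1)] assms by auto
  define r' where "r' = (if deg d = \<alpha> then m \<otimes> B d else \<zero>)"
  have r': "r' \<in> span {d \<in> D. deg d = \<alpha>}"
    using assms m add by (auto simp: r'_def lspan_zero intro!: span_gen)
  have "(a \<otimes>\<^bsub>G\<^esub> T.Y d \<oplus>\<^bsub>G\<^esub> v) \<alpha> = cls (deg d) (m \<otimes> B d) \<alpha> <+> v \<alpha>"
    unfolding m(2) emb_mult_Y[OF m(1) d] using cls_in_graded[OF mB] v by (rule graded_add_at)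
  also have "\<dots> = cset \<alpha> (r' \<oplus> r)"
    unfolding r(2) cls_at using rc F_carrier[OF mB] by (simp add: r'_def cset_add)
  finally show ?case
    using span_add[OF _ r' r(1)] assms by (intro bexI[of _ "r' \<oplus> r"]) auto
qed

lemma graded_component:
  assumes "r \<in> F \<alpha>"
  shows "\<exists>r'\<in>span {d \<in> E. deg d = \<alpha>}. r \<ominus> r' \<in> Fm \<alpha>"
proof -
  have "cls \<alpha> r \<in> T.span E"
    using T.S_span[of s] T.S_s cls_in_graded[OF assms] by auto
  from graded_span_component[OF this order_refl, of \<alpha>]
  obtain r' where r': "r' \<in> span {d \<in> E. deg d = \<alpha>}" "cset \<alpha> r = cset \<alpha> r'"
    by (auto simp: cls_at)
  have "r' \<in> carrier R" using span_closed[OF r'(1)] by auto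
  then have "r \<ominus> r' \<in> Fm \<alpha>" using cset_eq_iff[OF F_carrier[OF assms]] r'(2) by blast
  then show ?thesis using r' by auto
qed

text \<open>Subtracting a combination of monomials of exact degree \<alpha> moves an element of
  \<open>F \<alpha>\<close> into a strictly smaller piece or to zero; well-foundedness ends the
  process.\<close>

lemma F_span: "F \<alpha> = span {d \<in> E. lteq (deg d) \<alpha>}"
proof
  show "F \<alpha> \<subseteq> span {d \<in> E. lteq (deg d) \<alpha>}"
    using wf
  proof (induction \<alpha> rule: wfp_induct_rule)
    case (less \<alpha>)
    show ?case
    proof
      fix r assume r: "r \<in> F \<alpha>"
      obtain r' where r': "r' \<in> span {d \<in> E. deg d = \<alpha>}" "r \<ominus> r' \<in> Fm \<alpha>"
        using graded_component[OF r] by auto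
      have "span {d \<in> E. deg d = \<alpha>} \<subseteq> span {d \<in> E. lteq (deg d) \<alpha>}"
        by (intro lspan_mono) auto
      then have "r' \<in> span {d \<in> E. lteq (deg d) \<alpha>}" using r' by auto
      moreover have "r \<ominus> r' \<in> span {d \<in> E. lteq (deg d) \<alpha>}"
      proof (cases "r \<ominus> r' = \<zero>")
        case False
        then obtain \<delta> where \<delta>: "lt \<delta> \<alpha>" "r \<ominus> r' \<in> F \<delta>" using r'(2) by (auto simp: Fm_iff)
        have "span {d \<in> E. lteq (deg d) \<delta>} \<subseteq> span {d \<in> E. lteq (deg d) \<alpha>}"
          using ord.order_trans[OF _ ord.less_imp_le[OF \<delta>(1)]] by (intro lspan_mono) auto
        then show ?thesis using less[OF \<delta>(1)] \<delta>(2) by blast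
      qed (simp add: lspan_zero)
      ultimately have "(r \<ominus> r') \<oplus> r' \<in> span {d \<in> E. lteq (deg d) \<alpha>}"
        by (intro span_add) auto
      moreover have "r' \<in> carrier R" using span_closed[OF r'(1)] by auto
      ultimately show "r \<in> span {d \<in> E. lteq (deg d) \<alpha>}"
        using F_carrier[OF r] by (simp add: a_minus_def a_assoc l_neg)
    qed
  qed
  show "span {d \<in> E. lteq (deg d) \<alpha>} \<subseteq> F \<alpha>"
  proof
    fix v assume "v \<in> span {d \<in> E. lteq (deg d) \<alpha>}"
    then show "v \<in> F \<alpha>"
      by (rule span_least) (use F_zero F_add subsetD[OF F_mono] F0_mult[OF _ B_in_F] in auto)
  qed
qed

lemma Fm_span: "Fm \<alpha> \<subseteq> span {d \<in> E. lt (deg d) \<alpha>}"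
proof
  fix v assume "v \<in> Fm \<alpha>"
  show "v \<in> span {d \<in> E. lt (deg d) \<alpha>}"
  proof (cases "v = \<zero>")
    case False
    then obtain \<delta> where \<delta>: "lt \<delta> \<alpha>" "v \<in> F \<delta>" using \<open>v \<in> Fm \<alpha>\<close> by (auto simp: Fm_iff)
    have "span {d \<in> E. lteq (deg d) \<delta>} \<subseteq> span {d \<in> E. lt (deg d) \<alpha>}"
      using ord.le_less_trans[OF _ \<delta>(1)] by (intro lspan_mono) auto
    then show ?thesis using \<delta>(2) F_span[of \<delta>] by blast
  qed (simp add: lspan_zero)
qed

lemma span_lt_Fm: "v \<in> span {d \<in> E. lt (deg d) \<alpha>} \<Longrightarrow> v \<in> Fm \<alpha>"
  by (rule span_least[of v "{d \<in> E. lt (deg d) \<alpha>}"])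
    (use Fm_zero Fm_add F0_mult[OF _ B_in_F] in \<open>auto simp: Fm_iff\<close>)

text \<open>A vanishing combination has vanishing top-degree part, whose class is a combination of the
  Ore basis.\<close>

lemma free:
  assumes f: "f \<in> coeffs" and z: "lc f = \<zero>"
  shows "f = (\<lambda>_. \<zero>)"
proof (rule ccontr)
  assume "f \<noteq> (\<lambda>_. \<zero>)"
  then have "{d. f d \<noteq> \<zero>} \<noteq> {}" by auto
  then obtain a where a: "f a \<noteq> \<zero>" "\<And>b. f b \<noteq> \<zero> \<Longrightarrow> lteq (deg b) (deg a)"
    using finite_has_max[OF coeffsD(3)[OF f], of deg] by auto
  define \<alpha> where "\<alpha> = deg a"
  define f1 where "f1 d = (if deg d = \<alpha> then f d else \<zero>)" for d
  define f2 where "f2 d = (if deg d \<noteq> \<alpha> then f d else \<zero>)" for d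
  have f1: "f1 \<in> coeffs" and f2: "f2 \<in> coeffs"
    unfolding f1_def f2_def by (intro coeffs_restrict f)+
  have "(\<lambda>d. f1 d \<oplus> f2 d) = f"
    using coeffsD(2)[OF f] by (auto simp: f1_def f2_def)
  then have sum: "lc f1 \<oplus> lc f2 = \<zero>"
    using lc_add[OF f1 f2] z by simp
  have "lc f2 \<in> span {d \<in> E. lt (deg d) \<alpha>}"
    using a(2) coeffsD(4)[OF f]
    by (intro lc_in_span f2) (auto simp: f2_def lt_def \<alpha>_def)
  then have "\<ominus> lc f2 \<in> Fm \<alpha>" by (intro Fm_uminus span_lt_Fm)
  moreover have "lc f1 = \<ominus> lc f2"
    using sum lc_closed[OF f1] lc_closed[OF f2] by (simp add: minus_equality)
  ultimately have Fm: "lc f1 \<in> Fm \<alpha>" by simp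
  \<comment> \<open>As \<open>Fm 0\<close> is trivial, \<open>emb\<close> sends no nonzero scalar to
    zero, so passing to the graded ring does not shrink the support.\<close>
  let ?g = "\<lambda>d. emb (f1 d)"
  have supp: "{d. ?g d \<noteq> \<zero>\<^bsub>G\<^esub>} = {d. f1 d \<noteq> \<zero>}"
    using emb_eq_zero_iff[OF coeffsD(1)[OF f1]] by auto
  have g: "?g \<in> T.coeffs"
    unfolding T.coeffs_def mem_Collect_eq supp using coeffsD[OF f1] by auto
  have f1_supp: "d \<in> E" "deg d = \<alpha>" if "f1 d \<noteq> \<zero>" for d
    using coeffsD(4)[OF f1] that by (auto simp: f1_def split: if_splits)
  have in_F: "f1 d \<otimes> B d \<in> F \<alpha>" if "f1 d \<noteq> \<zero>" for d
    using F0_mult[OF coeffsD(1)[OF f1] B_in_F[OF f1_supp(1)[OF that]], of d] f1_supp(2)[OF that]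
    by simp
  have "T.lc ?g = (\<Oplus>\<^bsub>G\<^esub>d\<in>{d. f1 d \<noteq> \<zero>}. cls \<alpha> (f1 d \<otimes> B d))"
    unfolding T.lc_def supp
  proof (intro T.finsum_cong' refl)
    fix d assume d: "d \<in> {d. f1 d \<noteq> \<zero>}"
    then have "d \<in> E" "deg d = \<alpha>" using f1_supp by auto
    then show "?g d \<otimes>\<^bsub>G\<^esub> T.Y d = cls \<alpha> (f1 d \<otimes> B d)"
      using emb_mult_Y[OF coeffsD(1)[OF f1]] by simp
  qed (use in_F cls_in_graded in auto)
  also have "\<dots> = cls \<alpha> (lc f1)"
    unfolding lc_def by (rule cls_finsum) (use in_F T.ring_axioms in auto)
  also have "\<dots> = \<zero>\<^bsub>G\<^esub>" by (rule cls_eq_zero[OF Fm])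
  finally have "?g = (\<lambda>_. \<zero>\<^bsub>G\<^esub>)"
    using T.S_free[OF order_refl g] T.coeffsD(4)[OF g] by simp
  then have "f1 a = \<zero>" using emb_eq_zero_iff[OF coeffsD(1)[OF f1]] by (simp add: fun_eq_iff)
  then show False using a by (simp add: f1_def \<alpha>_def)
qed

text \<open>If \<open>\<gamma> j\<close> were 0, then \<open>x j\<close> would itself be a scalar,
  and \<open>\<one> \<otimes> x j \<oplus> (\<ominus> x j) \<otimes> \<one> = \<zero>\<close> would
  be a nontrivial relation between the monomials \<open>{#j#}\<close> and
  \<open>{#}\<close>.\<close>

lemma \<gamma>_nonzero:
  assumes "\<one> \<noteq> \<zero>" "j \<in> {1..s}"
  shows "\<gamma> j \<noteq> 0"
proof
  assume "\<gamma> j = 0"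
  then have xj: "\<ominus> x j \<in> F 0" using x_in_F[OF assms(2)] F_uminus by simp
  note c = lc_single[OF L_one, of "{#j#}"] lc_single[OF xj, of "{#}"]
  have "lc (\<lambda>e. (if e = {#j#} then \<one> else \<zero>) \<oplus> (if e = {#} then \<ominus> x j else \<zero>)) = \<zero>"
    using c assms x_carrier[OF assms(2)]
    by (subst lc_add) (auto simp: B_single B_empty r_neg)
  moreover have "(\<lambda>e. (if e = {#j#} then \<one> else \<zero>) \<oplus> (if e = {#} then \<ominus> x j else \<zero>)) \<in> coeffs"
    using c assms by (intro coeffs_add) auto
  ultimately have "(\<lambda>e. (if e = {#j#} then \<one> else \<zero>) \<oplus> (if e = {#} then \<ominus> x j else \<zero>)) = (\<lambda>_. \<zero>)"
    using free by blast
  from fun_cong[OF this, of "{#j#}"] show False using assms by simp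
qed

lemma deg_eq_0: "\<one> \<noteq> \<zero> \<Longrightarrow> d \<in> E \<Longrightarrow> deg d = 0 \<Longrightarrow> d = {#}"
  by (induction d) (auto simp: add_eq_0_iff \<gamma>_nonzero)

text \<open>The class of \<open>x j \<otimes> m\<close> is homogeneous of degree
  \<open>\<gamma> j\<close> and a combination of Ore monomials ending in \<open>y j\<close>. Such a
  monomial has degree \<open>\<gamma> j\<close> only if the rest of it has degree 0, hence is empty;
  so only a scalar multiple of \<open>y j\<close> survives.\<close>

lemma commute_scalar:
  assumes "\<one> \<noteq> \<zero>" "j \<in> {1..s}" "m \<in> F 0"
  shows "\<exists>c\<in>F 0. x j \<otimes> m \<ominus> c \<otimes> x j \<in> Fm (\<gamma> j)"
proof -
  define D where "D = add_mset j ` exponents (j - 1)"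
  have sub: "exponents (j - 1) \<subseteq> E" using assms by (intro exponents_mono) auto
  then have DE: "D \<subseteq> E" using assms by (auto simp: D_def)
  obtain t where t: "t \<in> T.span (exponents (j - 1))"
    "cls (\<gamma> j) (x j) \<otimes>\<^bsub>G\<^esub> emb m = t \<otimes>\<^bsub>G\<^esub> cls (\<gamma> j) (x j)"
    using T.y_commute[OF assms(2), of "emb m"] assms by auto
  have "t \<otimes>\<^bsub>G\<^esub> cls (\<gamma> j) (x j) \<in> T.span D"
    using t(1) sub DE cls_in_graded[OF x_in_F[OF assms(2)]]
  proof (rule T.span_mult_right)
    fix d assume d: "d \<in> exponents (j - 1)"
    then have "T.Y (add_mset j d) = T.Y d \<otimes>\<^bsub>G\<^esub> cls (\<gamma> j) (x j)"
      using assms T.y_carrier by (intro T.monomial_snoc) (auto simp: exponents_def subset_iff)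
    moreover have "T.Y (add_mset j d) \<in> T.span D"
      using d DE by (intro T.span_base) (auto simp: D_def)
    ultimately show "T.Y d \<otimes>\<^bsub>G\<^esub> cls (\<gamma> j) (x j) \<in> T.span D" by simp
  qed
  from graded_span_component[OF this DE, of "\<gamma> j"]
  obtain r where r: "r \<in> span {d \<in> D. deg d = \<gamma> j}"
    "(t \<otimes>\<^bsub>G\<^esub> cls (\<gamma> j) (x j)) (\<gamma> j) = cset (\<gamma> j) r" by auto
  have eqD: "{d \<in> D. deg d = \<gamma> j} \<subseteq> {{#j#}}"
    using deg_eq_0[OF assms(1)] sub by (auto simp: D_def)
  have "r \<in> {c \<otimes> x j |c. c \<in> F 0}"
  proof (rule span_least[OF subsetD[OF lspan_mono[OF eqD] r(1)]])
    show "\<zero> \<in> {c \<otimes> x j |c. c \<in> F 0}"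
      using x_carrier[OF assms(2)] F_zero by (auto intro!: exI[of _ \<zero>])
    show "u \<oplus> v \<in> {c \<otimes> x j |c. c \<in> F 0}"
      if "u \<in> {c \<otimes> x j |c. c \<in> F 0}" "v \<in> {c \<otimes> x j |c. c \<in> F 0}" for u v
    proof -
      obtain c c' where "u = c \<otimes> x j" "v = c' \<otimes> x j" "c \<in> F 0" "c' \<in> F 0"
        using \<open>u \<in> _\<close> \<open>v \<in> _\<close> by auto
      then show ?thesis
        using F_add[of c 0 c'] x_carrier[OF assms(2)]
        by (auto intro!: exI[of _ "c \<oplus> c'"] simp: l_distr L_carrier)
    qed
  qed (use assms in \<open>auto simp: B_single\<close>)
  then obtain c where c: "c \<in> F 0" "r = c \<otimes> x j" by auto
  have "cset (\<gamma> j) (x j \<otimes> m) = cset (\<gamma> j) (c \<otimes> x j)"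
  proof -
    have "cls (\<gamma> j) (x j \<otimes> m) = t \<otimes>\<^bsub>G\<^esub> cls (\<gamma> j) (x j)"
      using t(2) cls_mult[OF x_in_F[OF assms(2)] assms(3)] by (simp add: emb_eq_cls)
    from fun_cong[OF this, of "\<gamma> j"] show ?thesis using r(2) c(2) by (simp add: cls_at)
  qed
  then show ?thesis
    using c(1) cset_eq_iff[of "x j \<otimes> m" "c \<otimes> x j"] x_carrier[OF assms(2)] assms(3)
    by (auto simp: L_carrier)
qed

lemma commute_generators:
  assumes "i \<in> {1..s}" "j \<in> {1..s}" "q \<in> F 0"
    "cls (\<gamma> j) (x j) \<otimes>\<^bsub>G\<^esub> cls (\<gamma> i) (x i) = emb q \<otimes>\<^bsub>G\<^esub> cls (\<gamma> i) (x i) \<otimes>\<^bsub>G\<^esub> cls (\<gamma> j) (x j)"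
  shows "x j \<otimes> x i \<ominus> q \<otimes> x i \<otimes> x j \<in> Fm (\<gamma> i + \<gamma> j)"
proof -
  note c = x_in_F[OF assms(1)] x_in_F[OF assms(2)]
  have "cls (\<gamma> i + \<gamma> j) (x j \<otimes> x i) = cls (\<gamma> i + \<gamma> j) (q \<otimes> x i \<otimes> x j)"
    using assms(4) cls_mult[OF c(2,1)] cls_mult[OF assms(3) c(1)]
      cls_mult[OF F0_mult[OF assms(3) c(1)] c(2)] by (simp add: emb_eq_cls add.commute)
  from fun_cong[OF this, of "\<gamma> i + \<gamma> j"]
  have "cset (\<gamma> i + \<gamma> j) (x j \<otimes> x i) = cset (\<gamma> i + \<gamma> j) (q \<otimes> x i \<otimes> x j)"
    by (simp add: cls_at)
  then show ?thesis
    using cset_eq_iff c F_carrier[OF c(1)] F_carrier[OF c(2)] L_carrier[OF assms(3)] by simp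
qed

text \<open>Finitely many generators involve only a finite set \<open>A\<close> of monomials, so
  \<open>F \<alpha>\<close> is spanned by \<open>A\<close>. By uniqueness of coefficients, a
  monomial lying in this span must belong to \<open>A\<close>.\<close>

lemma finite_degree_le:
  assumes "\<one> \<noteq> \<zero>" "fin_gen_left R (F 0) (F \<alpha>)"
  shows "finite {d \<in> E. lteq (deg d) \<alpha>}"
proof -
  obtain Z where Z: "finite Z" "Z \<subseteq> F \<alpha>" "F \<alpha> = {\<Oplus>s\<in>Z. c s \<otimes> s |c. c \<in> Z \<rightarrow> F 0}"
    using assms(2) unfolding fin_gen_left_def by auto
  have "\<exists>f. f \<in> coeffs \<and> z = lc f" if "z \<in> Z" for z
  proof -
    have "z \<in> span {d \<in> E. lteq (deg d) \<alpha>}" using F_span[of \<alpha>] that Z(2) by blast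
    then show ?thesis by (rule span_lcE) auto
  qed
  then obtain f where f: "\<And>z. z \<in> Z \<Longrightarrow> f z \<in> coeffs" "\<And>z. z \<in> Z \<Longrightarrow> z = lc (f z)" by metis
  define A where "A = (\<Union>z\<in>Z. {d. f z d \<noteq> \<zero>})"
  have A: "finite A" "A \<subseteq> E" using Z(1) coeffsD(3,4)[OF f(1)] by (auto simp: A_def)
  have Z_span: "z \<in> span A" if "z \<in> Z" for z
    using lc_in_span[OF f(1)[OF that] _ A(2)] f(2)[OF that] that by (auto simp: A_def)
  have F_A: "v \<in> span A" if "v \<in> F \<alpha>" for v
  proof -
    from that obtain c where c: "c \<in> Z \<rightarrow> F 0" "v = (\<Oplus>s\<in>Z. c s \<otimes> s)"
      unfolding Z(3) by auto
    then show ?thesis using A(2) Z_span by (auto intro!: span_finsum span_scale)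
  qed
  have "d \<in> A" if d: "d \<in> E" "lteq (deg d) \<alpha>" for d
  proof -
    have "B d \<in> F \<alpha>" using B_in_F[OF d(1)] F_mono[OF d(2)] by blast
    from F_A[OF this] A(2) obtain g where g: "g \<in> coeffs" "{d. g d \<noteq> \<zero>} \<subseteq> A" "B d = lc g"
      by (rule span_lcE)
    have "lc (\<lambda>e. if e = d then \<one> else \<zero>) = lc g"
      using lc_single(2)[OF L_one d(1)] B_closed[OF d(1)] g(3) by simp
    from lc_inj[OF free lc_single(1)[OF L_one d(1)] g(1) this]
    have "g d = \<one>" by auto
    then show ?thesis using g(2) assms(1) by auto
  qed
  then show ?thesis using A(1) by (intro finite_subset[OF _ A(1)]) auto
qed

text \<open>Size 2 is all that is needed: the leading exponents of the defining relations are
  \<open>{#j#}\<close> and \<open>{#i, j#}\<close>. For larger exponents, weight may well disagree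
  with degree.\<close>

lemma weights_exist:
  assumes "\<one> \<noteq> \<zero>" and fg: "\<And>\<alpha>. fin_gen_left R (F 0) (F \<alpha>)"
  shows "\<exists>w::nat \<Rightarrow> nat. (\<forall>j\<in>{1..s}. 0 < w j) \<and> (\<forall>e\<in>E. size e \<le> 2 \<longrightarrow>
    (\<forall>d\<in>E. lt (deg d) (deg e) \<longrightarrow> (\<Sum>i\<in>#d. w i) < (\<Sum>i\<in>#e. w i)))"
proof -
  define V where "V = (\<lambda>(d, e) (i::nat). int (count e i) - int (count d i))"
  \<comment> \<open>\<open>P'\<close> gives the full additive semigroup in which the elimination
    takes place, \<open>Q\<close> the finite part on which positivity is demanded. \<open>V\<close>
    turns a pair into its signed difference, so that a functional positive there compares
    weights.\<close>
  define P' where "P' = {(d, e). d \<in> E \<and> e \<in> E \<and> lt (deg d) (deg e)}"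
  define Q where "Q = {(d, e) \<in> P'. size e \<le> 2}"
  have "finite {e \<in> E. size e \<le> 2}"
  proof (rule finite_subset)
    show "{e \<in> E. size e \<le> 2} \<subseteq> mset ` {xs. set xs \<subseteq> {1..s} \<and> length xs \<le> 2}"
    proof
      fix d assume d: "d \<in> {e \<in> E. size e \<le> 2}"
      obtain xs where "d = mset xs" using ex_mset[of d] by auto
      then show "d \<in> mset ` {xs. set xs \<subseteq> {1..s} \<and> length xs \<le> 2}"
        using d by (auto simp: exponents_def)
    qed
  qed (simp add: finite_lists_length_le)
  then have "finite (\<Union>e\<in>{e \<in> E. size e \<le> 2}. {d \<in> E. lteq (deg d) (deg e)} \<times> {e})"
    using finite_degree_le[OF assms(1) fg] by auto
  moreover have "Q \<subseteq> (\<Union>e\<in>{e \<in> E. size e \<le> 2}. {d \<in> E. lteq (deg d) (deg e)} \<times> {e})"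
    by (auto simp: Q_def P'_def lt_def)
  ultimately have finQ: "finite Q" by (rule finite_subset[rotated])
  have add: "(\<lambda>i. v i + v' i) \<in> V ` P'" if v: "v \<in> V ` P'" and v': "v' \<in> V ` P'" for v v'
  proof -
    obtain d e d' e' where *: "(d, e) \<in> P'" "(d', e') \<in> P'" "v = V (d, e)" "v' = V (d', e')"
      using v v' by auto
    then have "(d + d', e + e') \<in> P'"
      using add_lt_le[of "deg d" "deg e" "deg d'" "deg e'"] by (auto simp: P'_def lt_def)
    moreover have "(\<lambda>i. v i + v' i) = V (d + d', e + e')" using * by (auto simp: V_def)
    ultimately show ?thesis by blast
  qed
  have nz: "(\<lambda>_. 0) \<notin> V ` P'"
  proof
    assume "(\<lambda>_. 0) \<in> V ` P'"
    then obtain d e where "(d, e) \<in> P'" "V (d, e) = (\<lambda>_. 0)" by (metis imageE surj_pair)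
    then have "d = e" by (auto simp: V_def multiset_eq_iff fun_eq_iff)
    then show False using \<open>(d, e) \<in> P'\<close> by (simp add: P'_def)
  qed
  have zero_out: "v i = 0" if "v \<in> V ` Q" "i \<notin> {1..s}" for v i
    using that by (auto simp: V_def Q_def P'_def exponents_def count_eq_zero_iff)
      (metis atLeastAtMost_iff count_eq_zero_iff diff_self le0 of_nat_0 subsetD One_nat_def)+
  obtain u where u: "\<forall>v\<in>V ` Q. 0 < (\<Sum>i\<in>{1..s}. u i * v i)"
    using positive_functional_exists[of "{1..s}" "V ` P'" "V ` Q"] add nz finQ zero_out
    by (auto simp: Q_def)
  \<comment> \<open>The empty exponent lies below each generator, so positivity of the weights is
    itself one of the demanded inequalities. It also makes the later conversion by
    \<open>nat\<close> harmless.\<close>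
  have pos: "0 < u j" if j: "j \<in> {1..s}" for j
  proof -
    have "({#}, {#j#}) \<in> Q" using j zero_lt \<gamma>_nonzero[OF assms(1) j] by (simp add: Q_def P'_def)
    then have "0 < (\<Sum>i\<in>{1..s}. u i * V ({#}, {#j#}) i)" using u by blast
    also have "\<dots> = (\<Sum>i\<in>{1..s}. if i = j then u i else 0)"
      by (intro sum.cong) (auto simp: V_def)
    finally show ?thesis using j by simp
  qed
  define w where "w i = nat (u i)" for i
  have wt: "int (\<Sum>i\<in>#d. w i) = (\<Sum>i\<in>{1..s}. u i * int (count d i))" if "d \<in> E" for d
    using that
  proof (induction d)
    case (add k d)
    then have k: "k \<in> {1..s}" by simp
    have "(\<Sum>i\<in>{1..s}. u i * int (count (add_mset k d) i)) =
      (\<Sum>i\<in>{1..s}. (if i = k then u i else 0) + u i * int (count d i))"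
      by (intro sum.cong) (auto simp: algebra_simps)
    also have "\<dots> = u k + (\<Sum>i\<in>{1..s}. u i * int (count d i))"
      using k by (simp add: sum.distrib)
    also have "\<dots> = int (\<Sum>i\<in>#add_mset k d. w i)"
      using add pos[OF k] by (simp add: w_def)
    finally show ?case by simp
  qed simp
  have "(\<Sum>i\<in>#d. w i) < (\<Sum>i\<in>#e. w i)"
    if "e \<in> E" "size e \<le> 2" "d \<in> E" "lt (deg d) (deg e)" for d e
  proof -
    have "(d, e) \<in> Q" using that by (simp add: Q_def P'_def)
    then have "0 < (\<Sum>i\<in>{1..s}. u i * V (d, e) i)" using u by blast
    also have "\<dots> = int (\<Sum>i\<in>#e. w i) - int (\<Sum>i\<in>#d. w i)"
      unfolding wt[OF that(1)] wt[OF that(3)] by (simp add: V_def algebra_simps sum_subtractf)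
    finally show ?thesis by linarith
  qed
  then show ?thesis using pos by (intro exI[of _ w]) (auto simp: w_def)
qed

lemma weighted_basis_exists:
  assumes fg: "\<And>\<alpha>. fin_gen_left R (F 0) (F \<alpha>)"
    and swap: "\<And>i j. 1 \<le> i \<Longrightarrow> i < j \<Longrightarrow> j \<le> s \<Longrightarrow>
      \<exists>q\<in>F 0. x j \<otimes> x i \<ominus> q \<otimes> x i \<otimes> x j \<in> Fm (\<gamma> i + \<gamma> j)"
  shows "\<exists>w. weighted_basis R lteq F s x \<gamma> w"
proof (cases "\<one> = \<zero>")
  \<comment> \<open>In the trivial ring generators may have degree 0, so weights cannot be derived
    from degrees. Every element is zero there, and the constant weight 1 works.\<close>
  case True
  interpret weighted_generators R lteq F s x \<gamma> "\<lambda>_. 1"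
    by (intro weighted_generators.intro lifted_generators_axioms)
  have "lead v e" if "v \<in> carrier R" "e \<in> E" for v e
  proof -
    have "v = \<one> \<otimes> v" using that by simp
    then have "v = \<zero> \<otimes> B e \<oplus> \<zero>" using that True B_closed[of e] by simp
    then show ?thesis using leadI[OF L_zero W_zero] by metis
  qed
  then have "weighted_basis R lteq F s x \<gamma> (\<lambda>_. 1)"
    by (intro weighted_basis.intro weighted_basis_axioms.intro weighted_generators_axioms F_span free)
      (auto simp: B_closed L_carrier)
  then show ?thesis by blast
next
  case False
  obtain w :: "nat \<Rightarrow> nat" where w: "\<And>j. j \<in> {1..s} \<Longrightarrow> 0 < w j"
    "\<And>d e. \<lbrakk>e \<in> E; size e \<le> 2; d \<in> E; lt (deg d) (deg e)\<rbrakk> \<Longrightarrow> (\<Sum>i\<in>#d. w i) < (\<Sum>i\<in>#e. w i)"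
    using weights_exist[OF False fg] by blast
  interpret weighted_generators R lteq F s x \<gamma> w
    by (intro weighted_generators.intro lifted_generators_axioms)
  \<comment> \<open>By the choice of \<open>w\<close>, any error of smaller degree than a small
    exponent \<open>e\<close> automatically has smaller weight too.\<close>
  have in_W: "v \<in> W e" if "v \<in> Fm (deg e)" "e \<in> E" "size e \<le> 2" for v e
  proof -
    have "span {d \<in> E. lt (deg d) (deg e)} \<subseteq> W e"
      unfolding W_def using w(2)[OF that(2,3)] by (intro lspan_mono) (auto simp: wt_def)
    then show ?thesis using Fm_span that(1) by blast
  qed
  have minus: "a = b \<oplus> (a \<ominus> b)" if "a \<in> carrier R" "b \<in> carrier R" for a b
    using that by (simp add: a_minus_def a_comm[of a] a_assoc[symmetric] r_neg)
  have "weighted_relations R lteq F s x \<gamma> w"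
  proof (intro weighted_relations.intro weighted_relations_axioms.intro weighted_generators_axioms wf)
    show "\<gamma> j \<noteq> 0" if "j \<in> {1..s}" for j using \<gamma>_nonzero[OF False that] .
    show "lead (x j \<otimes> m) {#j#}" if j: "j \<in> {1..s}" and m: "m \<in> F 0" for j m
    proof -
      obtain c where c: "c \<in> F 0" "x j \<otimes> m \<ominus> c \<otimes> x j \<in> Fm (\<gamma> j)"
        using commute_scalar[OF False j m] by auto
      have "x j \<otimes> m \<ominus> c \<otimes> x j \<in> W {#j#}" using c j by (intro in_W) auto
      then have "lead (c \<otimes> B {#j#} \<oplus> (x j \<otimes> m \<ominus> c \<otimes> x j)) {#j#}" using c by (intro leadI)
      moreover have "x j \<otimes> m = c \<otimes> x j \<oplus> (x j \<otimes> m \<ominus> c \<otimes> x j)"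
        using j m c x_carrier by (intro minus) (auto simp: L_carrier)
      ultimately show ?thesis using B_single[OF j] by simp
    qed
    show "\<exists>q\<in>F 0. \<exists>u\<in>W {#i, j#}. x j \<otimes> x i = q \<otimes> x i \<otimes> x j \<oplus> u"
      if ij: "1 \<le> i" "i < j" "j \<le> s" for i j
    proof -
      obtain q where q: "q \<in> F 0" "x j \<otimes> x i \<ominus> q \<otimes> x i \<otimes> x j \<in> Fm (\<gamma> i + \<gamma> j)"
        using swap[OF ij] by auto
      have "x j \<otimes> x i \<ominus> q \<otimes> x i \<otimes> x j \<in> W {#i, j#}" using q ij by (intro in_W) auto
      moreover have "x j \<otimes> x i = q \<otimes> x i \<otimes> x j \<oplus> (x j \<otimes> x i \<ominus> q \<otimes> x i \<otimes> x j)"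
        using q ij x_carrier[of i] x_carrier[of j] by (intro minus) (auto simp: L_carrier)
      ultimately show ?thesis using q(1) by blast
    qed
  qed
  then interpret weighted_relations R lteq F s x \<gamma> w .
  have "weighted_basis R lteq F s x \<gamma> w"
    by (intro weighted_basis.intro weighted_basis_axioms.intro weighted_generators_axioms
        F_span free lead_monomials w)
  then show ?thesis by blast
qed

end

text \<open>The Ore extension appears in the conclusion as \<open>assoc_graded R lteq F\<close>,
  which is what the hypothesis identifies with it.\<close>

theorem mainTheorem1:
  fixes K :: "('k, 'l) ring_scheme"
    and R :: "('k, 'a, 'm) module_scheme"
    and lteq :: "nat ^ 'n \<Rightarrow> nat ^ 'n \<Rightarrow> bool"
    and F :: "nat ^ 'n \<Rightarrow> 'a set"
    and s :: nat
    and y :: "nat \<Rightarrow> (nat ^ 'n \<Rightarrow> 'a set)"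
    and \<sigma> :: "nat \<Rightarrow> (nat ^ 'n \<Rightarrow> 'a set) \<Rightarrow> (nat ^ 'n \<Rightarrow> 'a set)"
  assumes "cring K" and "assoc_algebra K R"
    and "admissible_order lteq" and "filtration K R lteq F"
    and "iterated_ore_extension (assoc_graded R lteq F) (gr_embed0 R lteq F ` F 0) s y \<sigma>"
    and "\<forall>j\<in>{1..s}. gr_homogeneous R lteq F (y j)"
    and a: "left_noetherian (R\<lparr>carrier := F 0\<rparr>)"
    and b: "\<forall>i j. 1 \<le> i \<and> i < j \<and> j \<le> s \<longrightarrow>
      (\<exists>q\<in>gr_embed0 R lteq F ` F 0.
        y j \<otimes>\<^bsub>assoc_graded R lteq F\<^esub> y i =
        q \<otimes>\<^bsub>assoc_graded R lteq F\<^esub> y i \<otimes>\<^bsub>assoc_graded R lteq F\<^esub> y j)"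
    and c: "\<forall>\<alpha>. fin_gen_left R (F 0) (F \<alpha>)"
  shows "\<exists>Rk :: nat \<Rightarrow> 'a set.
    filtration K R (\<le>) Rk \<and>
    Rk 0 = F 0 \<and>
    (\<forall>k. fin_gen_left R (F 0) (Rk k)) \<and>
    assoc_graded R (\<le>) Rk \<simeq> assoc_graded R lteq F"
proof -
  interpret ring_filtration R lteq F
    using assms(2-4) by (intro ring_filtrationI) (auto simp: assoc_algebra_def)
  have "\<forall>j\<in>{1..s}. \<exists>p. snd p \<in> F (fst p) \<and> y j = cls (fst p) (snd p)"
    using assms(6) by (metis homogeneousE fst_conv snd_conv)
  then obtain p where p: "\<And>j. j \<in> {1..s} \<Longrightarrow> snd (p j) \<in> F (fst (p j))"
    "\<And>j. j \<in> {1..s} \<Longrightarrow> y j = cls (fst (p j)) (snd (p j))"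
    by metis
  define \<gamma> where "\<gamma> j = fst (p j)" for j
  define x where "x j = snd (p j)" for j
  have x: "x j \<in> F (\<gamma> j)" "y j = cls (\<gamma> j) (x j)" if "j \<in> {1..s}" for j
    using p[OF that] by (auto simp: \<gamma>_def x_def)
  obtain S where S: "ring G" "S 0 = emb ` F 0" "S s = carrier G"
    "\<And>j. j \<in> {1..s} \<Longrightarrow> ore_extension (G\<lparr>carrier := S j\<rparr>) (S (j - 1)) (y j) (\<sigma> j)"
    using assms(5) unfolding iterated_ore_extension_def by auto
  \<comment> \<open>Outside \<open>{1..s}\<close> the \<open>y j\<close> need not be homogeneous.
    Replacing them by the classes of the lifts is allowed because the tower only constrains indices
    in this range.\<close>
  have "ore_tower G (emb ` F 0) s (\<lambda>j. cls (\<gamma> j) (x j)) \<sigma> S"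
    using S x(2) by (intro ore_tower.intro ore_tower_axioms.intro) auto
  moreover have "lifted_generators R lteq F s x \<gamma>"
    using x(1) by (intro lifted_generators.intro lifted_generators_axioms.intro ring_filtration_axioms)
  ultimately have "graded_ore R lteq F s x \<gamma> \<sigma> S"
    using admissible_wf[OF admissible_axioms]
    by (intro graded_ore.intro graded_ore_axioms.intro)
  then interpret graded_ore R lteq F s x \<gamma> \<sigma> S .
  have "\<exists>w. weighted_basis R lteq F s x \<gamma> w"
  proof (rule weighted_basis_exists)
    show "fin_gen_left R (F 0) (F \<alpha>)" for \<alpha> using c by simp
    show "\<exists>q\<in>F 0. x j \<otimes>\<^bsub>R\<^esub> x i \<ominus>\<^bsub>R\<^esub> q \<otimes>\<^bsub>R\<^esub> x i \<otimes>\<^bsub>R\<^esub> x j \<in> Fm (\<gamma> i + \<gamma> j)"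
      if ij: "1 \<le> i" "i < j" "j \<le> s" for i j
    proof -
      obtain q where q: "q \<in> F 0" "y j \<otimes>\<^bsub>G\<^esub> y i = emb q \<otimes>\<^bsub>G\<^esub> y i \<otimes>\<^bsub>G\<^esub> y j"
        using b ij by blast
      have "i \<in> {1..s}" "j \<in> {1..s}" using ij by auto
      then show ?thesis using commute_generators[of i j q] q x(2) by auto
    qed
  qed
  then obtain w where "weighted_basis R lteq F s x \<gamma> w" by blast
  moreover have "submodule (F 0) K R" using assms(4) by (simp add: filtration_def)
  ultimately show ?thesis using assms(2) by (intro refiltration)
qed

end
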